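(* For each $k\ge 4$ there exist $\rho>0$ and a $\rho$-quasirandom sequence of $k$-graphs with upper density $k!/(k^k-k)$.
   Context: A $k$-graph is a $k$-uniform hypergraph. The density of a $k$-graph $H=(V,E)$ is $d(H)=|E|/\binom{|V|}{k}$. For a sequence $\mathcal H=\{H_n\}_{n\ge1}$ of $k$-graphs $H_n=(V_n,E_n)$ with $|V_n|\to\infty$, its density is $d(\mathcal H)=\lim_n d(H_n)$ (only sequences where this limit exists are considered), and its upper density is $\overline d(\mathcal H)=\lim_{s\to\infty}\max_n\max_{S\subseteq V_n,|S|=s} d(H_n[S])$. The sequence is $\rho$-quasirandom if for every $\epsilon>0$ there is $n_0$ such that for all $n>n_0$, every $W\subseteq V_n$ with $|W|\ge\epsilon|V_n|$ satisfies $d(H_n[W])\in[\rho(1-\epsilon),\rho(1+\epsilon)]$. *)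

theory Defs
  imports Complex_Main
begin

text \<open>A k-graph with vertex set V (finite) and edge set E (a set of k-subsets of V).
  Vertices are taken to be natural numbers (every finite hypergraph is isomorphic to one on nat).\<close>
definition kgraph :: "nat \<Rightarrow> nat set \<Rightarrow> nat set set \<Rightarrow> bool" where
  "kgraph k V E \<longleftrightarrow> finite V \<and> (\<forall>e\<in>E. e \<subseteq> V \<and> card e = k)"

definition density :: "nat \<Rightarrow> nat set \<Rightarrow> nat set set \<Rightarrow> real" where
  "density k V E = real (card E) / real (card V choose k)"

definition induced_density :: "nat \<Rightarrow> nat set set \<Rightarrow> nat set \<Rightarrow> real" where
  "induced_density k E S = density k S {e \<in> E. e \<subseteq> S}"

definition kgraph_seq :: "nat \<Rightarrow> (nat \<Rightarrow> nat set) \<Rightarrow> (nat \<Rightarrow> nat set set) \<Rightarrow> bool" where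
  "kgraph_seq k V E \<longleftrightarrow> (\<forall>n. kgraph k (V n) (E n))
     \<and> filterlim (\<lambda>n. card (V n)) at_top sequentially
     \<and> convergent (\<lambda>n. density k (V n) (E n))"

definition max_sub_density :: "nat \<Rightarrow> (nat \<Rightarrow> nat set) \<Rightarrow> (nat \<Rightarrow> nat set set) \<Rightarrow> nat \<Rightarrow> real" where
  "max_sub_density k V E s =
     Sup {induced_density k (E n) S | n S. S \<subseteq> V n \<and> card S = s}"

definition has_upper_density :: "nat \<Rightarrow> (nat \<Rightarrow> nat set) \<Rightarrow> (nat \<Rightarrow> nat set set) \<Rightarrow> real \<Rightarrow> bool" where
  "has_upper_density k V E d \<longleftrightarrow> (max_sub_density k V E \<longlongrightarrow> d) sequentially"

definition quasirandom :: "nat \<Rightarrow> real \<Rightarrow> (nat \<Rightarrow> nat set) \<Rightarrow> (nat \<Rightarrow> nat set set) \<Rightarrow> bool" where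
  "quasirandom k \<rho> V E \<longleftrightarrow>
     (\<forall>\<epsilon>>0. \<exists>n0. \<forall>n>n0. \<forall>W. W \<subseteq> V n \<and> real (card W) \<ge> \<epsilon> * real (card (V n)) \<longrightarrow>
        induced_density k (E n) W \<in> {\<rho> * (1 - \<epsilon>) .. \<rho> * (1 + \<epsilon>)})"

end

theory Submission
  imports Defs "HOL-Analysis.Analysis" "HOL-Real_Asymp.Real_Asymp"
begin

text \<open>Every ordered pair of vertices is given a role in \<open>{0, \<dots>, k - 1}\<close>, and a \<open>k\<close>-set is an edge
  when its vertices play \<open>k\<close> distinct roles, each vertex the same role towards all the others.

  Upper bound: for every assignment of roles to \<open>n\<close> vertices there are at most \<open>n^k / (k^k - k)\<close>
  edges. In a minimal counterexample all degrees are large, and by AM-GM this forces every vertex to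
  play one dominant role towards most others. The dominant roles partition the vertex set. Edges
  inside a part are bounded by minimality; an edge that neither lies in a part nor respects the
  partition uses pairs playing a wrong role, and each such stray pair destroys more transversal
  edges than it creates. What remains is
  \<open>(k^k - k) \<Prod> x\<^sub>i + \<Sum> x\<^sub>i^k \<le> (\<Sum> x\<^sub>i)^k\<close>.

  Lower bound and quasirandomness: the roles are read off the determinant of two vectors of the plane over
  a prime field, for which a second moment argument gives small discrepancy, except
  on a planted set of \<open>k^n\<close> vertices carrying an iterated blow-up of an edge, which is too small to
  be noticed by linear-sized sets.\<close>

section \<open>Inequalities\<close>

text \<open>The constant \<open>k^k - k\<close> comes from iterating the blow-up:
  \<open>N(k m) = m^k + k N(m)\<close> is solved by \<open>N(m) = (m^k - m) / (k^k - k)\<close>. The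
  upper bound holds for arbitrary roles, so nothing has to be known about the host in order to bound
  its dense subsets; pseudorandomness serves quasirandomness alone. The upper bound rests on a
  double count. A copy that mixes the parts contains at least \<open>k - 2\<close> stray pairs, and
  a transversal tuple that is not a copy is charged at most \<open>k\<close> times, once per
  coordinate. Hence it suffices to show at each vertex that \<open>k\<close> times the copies gained
  through strays is at most \<open>k - 2\<close> times the transversal tuples missed. The bounds
  available for the minority and for the part sizes are crude, so 4 and 5 need their own numbers.
  Determinants are used because they are antisymmetric: both ends of a pair see the same residue up
  to sign, so they can agree on an ordered pair of roles without reference to an order on the
  vertices.\<close>

lemma prod_le_mean_power:
  fixes x :: "'a \<Rightarrow> real"
  assumes "finite S" and x: "\<And>i. i \<in> S \<Longrightarrow> 0 \<le> x i"
  shows "prod x S \<le> (sum x S / card S) ^ card S"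
proof (cases "S = {}")
  case False
  have c: "card S > 0" using assms(1) False by (simp add: card_gt_0_iff)
  have p0: "prod x S \<ge> 0" by (simp add: prod_nonneg x)
  have "prod x S powr (1 / card S) \<le> sum x S / card S"
    using arith_geom_mean[OF assms(1) False x] by (simp add: sum_divide_distrib)
  then have "(prod x S powr (1 / card S)) ^ card S \<le> (sum x S / card S) ^ card S"
    by (intro power_mono) auto
  moreover have "(prod x S powr (1 / card S)) ^ card S = prod x S"
    using p0 c by (simp add: powr_powr flip: powr_realpow')
  ultimately show ?thesis by simp
qed simp

lemma bij_betw_add_mod:
  assumes "0 < (k::nat)"
  shows "bij_betw (\<lambda>r. (c + r) mod k) {..<k} {..<k}"
proof -
  have inj: "inj_on (\<lambda>r. (c + r) mod k) {..<k}"
  proof (rule inj_onI)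
    fix a b assume ab: "a \<in> {..<k}" "b \<in> {..<k}" and e: "(c + a) mod k = (c + b) mod k"
    show "a = b"
    proof (cases "a \<le> b")
      case True
      then have "k dvd (c + b) - (c + a)" using e mod_eq_dvd_iff_nat[of "c+a" "c+b" k] by simp
      then have "k dvd b - a" by simp
      with ab True show ?thesis using dvd_imp_le[of k "b - a"] by fastforce
    next
      case False
      then have "k dvd (c + a) - (c + b)" using e mod_eq_dvd_iff_nat[of "c+b" "c+a" k] by simp
      then have "k dvd a - b" by simp
      with ab False show ?thesis using dvd_imp_le[of k "a - b"] by fastforce
    qed
  qed
  moreover have "(\<lambda>r. (c + r) mod k) ` {..<k} \<subseteq> {..<k}" using assms by auto
  ultimately show ?thesis
    using endo_inj_surj[of "{..<k}"] by (auto simp: bij_betw_def)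
qed

lemma rotation_bij_betw:
  assumes "0 < k"
  shows "bij_betw (\<lambda>g. restrict (\<lambda>i. (g i + r) mod k) {..<k})
      ({..<k} \<rightarrow>\<^sub>E {..<k}) ({..<k} \<rightarrow>\<^sub>E {..<k::nat})"
proof -
  let ?rot = "\<lambda>g. restrict (\<lambda>i. (g i + r) mod k) {..<k}"
  have b: "bij_betw (\<lambda>a. (r + a) mod k) {..<k} {..<k}" using bij_betw_add_mod[OF assms] .
  have inj: "inj_on ?rot ({..<k} \<rightarrow>\<^sub>E {..<k})"
  proof (rule inj_onI)
    fix f g assume f: "f \<in> {..<k} \<rightarrow>\<^sub>E {..<k}" and g: "g \<in> {..<k} \<rightarrow>\<^sub>E {..<k}" and e: "?rot f = ?rot g"
    show "f = g"
    proof (rule PiE_ext[OF f g])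
      fix i assume i: "i \<in> {..<k}"
      have "?rot f i = ?rot g i" using e by simp
      then have "(r + f i) mod k = (r + g i) mod k" using i by (simp add: add.commute)
      moreover have "f i \<in> {..<k}" "g i \<in> {..<k}" using f g i by (meson PiE_mem)+
      ultimately show "f i = g i" using b unfolding bij_betw_def inj_on_def by blast
    qed
  qed
  moreover have "?rot ` ({..<k} \<rightarrow>\<^sub>E {..<k}) \<subseteq> ({..<k} \<rightarrow>\<^sub>E {..<k})"
    using assms by (intro image_subsetI) (simp add: restrict_PiE_iff)
  moreover have "finite ({..<k} \<rightarrow>\<^sub>E {..<k})" by (simp add: finite_PiE)
  ultimately show ?thesis unfolding bij_betw_def using endo_inj_surj[of "{..<k} \<rightarrow>\<^sub>E {..<k}" ?rot] by blast
qed

text \<open>The power on the right expands into a sum over maps \<open>g\<close>. The constant maps give the sum of powers;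
  for the others, apply AM-GM to the \<open>k\<close> rotations \<open>g + r\<close> modulo \<open>k\<close>.\<close>
lemma sum_power_ge_prod:
  fixes x :: "nat \<Rightarrow> real"
  assumes k: "0 < k" and x: "\<And>i. i < k \<Longrightarrow> 0 \<le> x i"
  shows "(real k ^ k - real k) * prod x {..<k} + (\<Sum>i<k. x i ^ k) \<le> (\<Sum>i<k. x i) ^ k"
proof -
  define G where "G = {..<k} \<rightarrow>\<^sub>E {..<k}"
  define F where "F g = (\<Prod>i<k. x (g i))" for g :: "nat \<Rightarrow> nat"
  define con where "con p = restrict (\<lambda>_. p) {..<k}" for p :: nat
  define C where "C = con ` {..<k}"
  define rot where "rot r g = restrict (\<lambda>i. (g i + r) mod k) {..<k}" for r and g :: "nat \<Rightarrow> nat"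
  have finG: "finite G" by (simp add: G_def finite_PiE)
  have CG: "C \<subseteq> G" unfolding C_def G_def con_def by (intro image_subsetI) (simp add: restrict_PiE_iff)
  have injcon: "inj_on con {..<k}"
  proof (rule inj_onI)
    fix p q assume "con p = con q"
    then have "con p 0 = con q 0" by simp
    then show "p = q" using k by (simp add: con_def)
  qed
  have cardC: "card C = k" using injcon by (simp add: C_def card_image)
  have cardG: "card G = k ^ k" by (simp add: G_def card_PiE)
  have tot: "(\<Sum>i<k. x i) ^ k = (\<Sum>g\<in>G. F g)"
    using prod_sum_PiE[of "{..<k}" "\<lambda>_. {..<k}" "\<lambda>_ p. x p"] by (simp add: G_def F_def)
  have sumC: "(\<Sum>g\<in>C. F g) = (\<Sum>p<k. x p ^ k)"
    unfolding C_def using injcon by (subst sum.reindex) (auto simp: F_def con_def)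
  have brot: "bij_betw (rot r) G G" for r
    using rotation_bij_betw[OF k, of r] by (simp add: rot_def[abs_def] G_def)
  have rotC: "rot r ` C = C" for r
  proof -
    have s: "rot r ` C \<subseteq> C"
    proof clarify
      fix g assume "g \<in> C"
      then obtain p where "p < k" "g = con p" by (auto simp: C_def)
      then have "rot r g = con ((p + r) mod k)" by (auto simp: rot_def con_def)
      then show "rot r g \<in> C" using k by (auto simp: C_def)
    qed
    have "inj_on (rot r) C" using brot[of r] CG by (meson bij_betw_imp_inj_on inj_on_subset)
    then show ?thesis using s endo_inj_surj[of C "rot r"] finG CG finite_subset by blast
  qed
  have brN: "bij_betw (rot r) (G - C) (G - C)" for r
    using brot[of r] rotC[of r] CG
    by (simp add: bij_betw_def inj_on_image_set_diff[of _ G G C] inj_on_diff)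
  have rotsum: "(\<Sum>g\<in>G - C. F (rot r g)) = (\<Sum>g\<in>G - C. F g)" for r
    using sum.reindex_bij_betw[OF brN[of r], of F] .
  have am: "real k * prod x {..<k} \<le> (\<Sum>r<k. F (rot r g))" if g: "g \<in> G" for g
  proof -
    have gi: "g i < k" if "i < k" for i using g that by (auto simp: G_def)
    have F0: "F (rot r g) \<ge> 0" for r
      unfolding F_def rot_def using k by (intro prod_nonneg) (auto intro!: x)
    \<comment> \<open>In each coordinate the rotations of \<open>g\<close> run through all residues,
      so every weight occurs exactly \<open>k\<close> times in this product.\<close>
    have "(\<Prod>r<k. F (rot r g)) = (\<Prod>r<k. \<Prod>i<k. x ((g i + r) mod k))"
      by (simp add: F_def rot_def)
    also have "\<dots> = (\<Prod>i<k. \<Prod>r<k. x ((g i + r) mod k))" by (rule prod.swap)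
    also have "\<dots> = (\<Prod>i<k. prod x {..<k})"
      by (rule prod.cong[OF refl], rule prod.reindex_bij_betw[OF bij_betw_add_mod[OF k]])
    finally have "(prod x {..<k}) ^ k = (\<Prod>r<k. F (rot r g))" by simp
    also have "\<dots> \<le> ((\<Sum>r<k. F (rot r g)) / k) ^ k"
      using prod_le_mean_power[of "{..<k}" "\<lambda>r. F (rot r g)"] F0 by simp
    finally have "prod x {..<k} \<le> (\<Sum>r<k. F (rot r g)) / k"
      using power_le_imp_le_base[of "prod x {..<k}" "k - 1" "(\<Sum>r<k. F (rot r g)) / k"] k F0
      by (simp add: sum_nonneg)
    then show ?thesis using k by (simp add: field_simps)
  qed
  have "real k * (real (card (G - C)) * prod x {..<k}) = (\<Sum>g\<in>G - C. real k * prod x {..<k})" by simp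
  also have "\<dots> \<le> (\<Sum>g\<in>G - C. \<Sum>r<k. F (rot r g))" by (rule sum_mono) (use am in auto)
  also have "\<dots> = (\<Sum>r<k. \<Sum>g\<in>G - C. F (rot r g))" by (rule sum.swap)
  also have "\<dots> = real k * (\<Sum>g\<in>G - C. F g)" by (simp add: rotsum)
  finally have "real (card (G - C)) * prod x {..<k} \<le> (\<Sum>g\<in>G - C. F g)" using k by simp
  moreover have "real (card (G - C)) = real k ^ k - real k"
  proof -
    have "card (G - C) = k ^ k - k" using CG finG cardC cardG by (simp add: card_Diff_subset finite_subset)
    moreover have "k \<le> k ^ k" using k by (simp add: self_le_power)
    ultimately show ?thesis by (simp add: of_nat_diff)
  qed
  moreover have "(\<Sum>g\<in>G. F g) = (\<Sum>g\<in>G - C. F g) + (\<Sum>g\<in>C. F g)"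
    using CG finG by (metis sum.subset_diff)
  ultimately show ?thesis using tot sumC by simp
qed

section \<open>Power sums and the size of a dominant weight\<close>

lemma sum_power_le_power_sum:
  fixes y :: "'a \<Rightarrow> real"
  assumes "finite A" "\<And>i. i \<in> A \<Longrightarrow> 0 \<le> y i" "0 < n"
  shows "(\<Sum>i\<in>A. y i ^ n) \<le> (\<Sum>i\<in>A. y i) ^ n"
  using assms
proof (induction A rule: finite_induct)
  case (insert a A)
  have ab: "u ^ n + v ^ n \<le> (u + v) ^ n" if "u \<ge> 0" "v \<ge> 0" for u v :: real
  proof -
    obtain m where m: "n = Suc m" using insert.prems by (cases n) auto
    have "u ^ m \<le> (u+v)^m" "v ^ m \<le> (u+v)^m" using that by (auto intro!: power_mono)
    then have "u * u ^ m + v * v ^ m \<le> u * (u+v)^m + v * (u+v)^m"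
      using that by (intro add_mono mult_left_mono) auto
    then show ?thesis by (simp add: m algebra_simps)
  qed
  have "y a ^ n + (\<Sum>i\<in>A. y i ^ n) \<le> y a ^ n + (\<Sum>i\<in>A. y i) ^ n"
    using insert by simp
  also have "\<dots> \<le> (y a + (\<Sum>i\<in>A. y i)) ^ n" by (rule ab) (use insert in \<open>auto intro: sum_nonneg\<close>)
  finally show ?case using insert by simp
qed (simp add: zero_power)

text \<open>Bounds the fraction of vertices towards which a vertex of large degree does not play its
  dominant role. In the limit the true value is about \<open>1 / k\<close>; the estimates for \<open>k = 4\<close>
  leave almost no room.\<close>
definition minority_bound :: "nat \<Rightarrow> real" where
  "minority_bound k = (if k = 4 then 2561 / 10000 else if k = 5 then 21 / 100
     else (real k - 1) / (real k * (real k - 2)))"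

text \<open>The weights are the fractions of vertices towards which a fixed vertex plays each role,
  and \<open>pow\<close> is what the degree forced by minimality provides. Without a dominant entry
  the power sum is too small: \<open>powM\<close> bounds it by a power of the largest entry, and
  \<open>split\<close> pools all other entries into one.\<close>

lemma exists_majority_weight:
  fixes y :: "nat \<Rightarrow> real"
  assumes k: "4 \<le> k" and y: "\<And>i. i < k \<Longrightarrow> 0 \<le> y i" and sum: "(\<Sum>i<k. y i) \<le> 1"
    and pow: "(real k - 1) ^ (k - 1) / (real k ^ (k - 1) - 1) \<le> (\<Sum>i<k. y i ^ (k - 1))"
  shows "\<exists>p<k. 1 - y p \<le> minority_bound k"
proof (rule ccontr)
  assume "\<not> ?thesis"
  then have small: "y i < 1 - minority_bound k" if "i < k" for i using that by force
  define K where "K = k - 1"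
  define L where "L = k - 2"
  have KL: "K = Suc L" "k = Suc K" using k by (auto simp: K_def L_def)
  have powM: "(\<Sum>i<k. y i ^ K) \<le> m ^ L" if m: "\<And>i. i < k \<Longrightarrow> y i \<le> m" for m
  proof -
    have m0: "0 \<le> m" using m[of 0] y[of 0] k by force
    have "(\<Sum>i<k. y i ^ K) \<le> (\<Sum>i<k. y i * m ^ L)"
      by (rule sum_mono) (use m y in \<open>auto simp: KL intro!: mult_left_mono power_mono\<close>)
    also have "\<dots> = (\<Sum>i<k. y i) * m ^ L" by (simp add: sum_distrib_right)
    also have "\<dots> \<le> 1 * m ^ L" using sum m0 by (intro mult_right_mono) auto
    finally show ?thesis by simp
  qed
  obtain p where p: "p < k" "\<And>i. i < k \<Longrightarrow> y i \<le> y p"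
  proof -
    have "Max (y ` {..<k}) \<in> y ` {..<k}" using k by (intro Max_in) (auto simp: lessThan_empty_iff)
    then obtain p where "p < k" "y p = Max (y ` {..<k})" by auto
    then show ?thesis using that[of p] by (metis Max_ge finite_imageI finite_lessThan imageI lessThan_iff)
  qed
  have split: "(\<Sum>i<k. y i ^ K) \<le> y p ^ K + (1 - y p) ^ K"
  proof -
    have "(\<Sum>i\<in>{..<k} - {p}. y i ^ K) \<le> (\<Sum>i\<in>{..<k} - {p}. y i) ^ K"
      by (rule sum_power_le_power_sum) (use y k in \<open>auto simp: K_def\<close>)
    also have "\<dots> \<le> (1 - y p) ^ K"
      using sum p(1) y by (intro power_mono sum_nonneg) (auto simp: sum.remove[of _ p])
    finally show ?thesis using p(1) by (simp add: sum.remove[of _ p])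
  qed
  have yp0: "0 \<le> y p" "y p \<le> 1"
  proof -
    have "y p \<le> (\<Sum>i<k. y i)" by (rule member_le_sum) (use p y in auto)
    then show "y p \<le> 1" using sum by simp
  qed (use p y in auto)
  have pM: "(\<Sum>i<k. y i ^ K) \<le> y p ^ L" using powM p by blast
  consider "k = 4" | "k = 5" | "k \<ge> 6" using k by linarith
  then show False
  proof cases
    case 1
    have "y p ^ 2 \<ge> 3 / 7" using pM pow 1 by (simp add: K_def L_def)
    then have l: "y p > 65 / 100" using power_mono[of "y p" "65/100" 2] yp0 by (force simp: power2_eq_square)
    have u: "y p < 7439 / 10000" using small[OF p(1)] 1 by (simp add: minority_bound_def)
    have "3 / 7 \<le> y p ^ 3 + (1 - y p) ^ 3" using split pow 1 by (simp add: K_def)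
    also have "\<dots> = 1 - 3 * (y p * (1 - y p))" by (simp add: power3_eq_cube algebra_simps)
    finally have "y p * (1 - y p) \<le> 4 / 21" by simp
    \<comment> \<open>The larger root of \<open>y (1 - y) = 4 / 21\<close> is about 0.74398;
      rounding it down to 0.7439 is the origin of the value 0.2561 of
      \<open>minority_bound 4\<close>.\<close>
    moreover have "(7439/10000 - y p) * (y p - (1 - 7439/10000)) \<ge> 0" using l u by (intro mult_nonneg_nonneg) auto
    ultimately show False by (simp add: algebra_simps)
  next
    case 2
    have "y p ^ 3 \<ge> 256 / 624" using pM pow 2 by (simp add: K_def L_def)
    then have l: "y p > 74 / 100" using power_mono[of "y p" "74/100" 3] yp0 by (force simp: power3_eq_cube)
    have u: "y p < 79 / 100" using small[OF p(1)] 2 by (simp add: minority_bound_def)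
    have "256 / 624 \<le> y p ^ 4 + (1 - y p) ^ 4" using split pow 2 by (simp add: K_def)
    also have "\<dots> \<le> (79/100) ^ 4 + (26/100) ^ 4" using l u by (intro add_mono power_mono) auto
    finally show False by (simp add: power4_eq_xxxx)
  next
    case 3
    \<comment> \<open>AM-GM for \<open>k - 2\<close> copies of \<open>B\<close> and a single 1, with
      mean \<open>A\<close>, gives \<open>B^L <= A^K\<close>. The equation
      \<open>L * B + 1 = K * A\<close> is what fixes \<open>minority_bound k\<close> for
      \<open>k >= 6\<close>. The threshold in \<open>pow\<close> exceeds \<open>A^K\<close> only
      through the \<open>- 1\<close> in its denominator.\<close>
    define A where "A = 1 - 1 / real k"
    define B where "B = 1 - minority_bound k"
    have rL: "real L = real k - 2" and rK: "real K = real k - 1" using 3 by (auto simp: L_def K_def)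
    have B: "B = (real K * A - 1) / real L"
    proof -
      have "real k - 2 \<noteq> 0" "real k \<noteq> 0" using 3 by auto
      then show ?thesis unfolding B_def A_def minority_bound_def rL rK using 3
        by (simp add: divide_simps) (simp add: algebra_simps)
    qed
    have "(\<Sum>i<k. y i ^ K) \<le> B ^ L" using powM small by (simp add: B_def less_imp_le)
    also have "B ^ L \<le> A ^ K"
    proof -
      have B0: "0 \<le> B" using small[OF p(1)] yp0 by (simp add: B_def)
      define z where "z i = (if i < L then B else 1)" for i
      have pz: "prod z {..<K} = B ^ L" by (simp add: KL(1) z_def)
      have "sum z {..<K} = real L * B + 1" by (simp add: KL(1) z_def)
      also have "\<dots> = real K * A" using 3 by (simp add: B rL)
      finally have "prod z {..<K} \<le> A ^ K"
        using prod_le_mean_power[of "{..<K}" z] B0 by (simp add: z_def KL(1))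
      then show ?thesis using pz by simp
    qed
    also have "A ^ K = (real k - 1) ^ K / real k ^ K"
      using 3 by (simp add: A_def diff_divide_distrib flip: power_divide)
    also have "\<dots> < (real k - 1) ^ K / (real k ^ K - 1)"
    proof -
      have "1 < real k ^ K" using 3 by (intro one_less_power) (auto simp: K_def)
      then show ?thesis using 3 by (intro divide_strict_left_mono) auto
    qed
    finally show False using pow by (simp add: K_def)
  qed
qed

text \<open>This is the inequality of \<open>large_uniformity_gap\<close> for
  \<open>j = k - 2\<close>, with \<open>k^k - k\<close> weakened to \<open>k^k\<close> and
  denominators cleared. Up to constants the left side is \<open>j^(j + 4)\<close>, so the factor
  \<open>j^j >= j^4\<close> leaves room for the crude bounds \<open>(1 + 1 / j)^j <= 2.72\<close>
  and \<open>j + 2 <= 3 j / 2\<close>.\<close>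

lemma large_uniformity_estimate:
  assumes j: "4 \<le> j"
  shows "(real j + 2) ^ 3 * (real j + 1) ^ (j + 1) + 4 * (real j + 2) * real j ^ j \<le> 4 * real j ^ (2 * j + 1)"
proof -
  define r where "r = real j"
  have r: "r \<ge> 4" using j by (simp add: r_def)
  have "(1 + 1 / r) ^ j \<le> exp (1 / r) ^ j" using r by (intro power_mono) auto
  also have "\<dots> = exp 1" using r by (simp add: r_def flip: exp_of_nat_mult)
  also have "\<dots> \<le> 272 / 100" using e_less_272 by simp
  finally have e: "(1 + 1 / r) ^ j \<le> 272 / 100" .
  have "(r + 1) ^ (j + 1) = r ^ (j + 1) * ((1 + 1 / r) ^ j * (1 + 1 / r))"
  proof -
    have "r + 1 = r * (1 + 1 / r)" using r by (simp add: algebra_simps)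
    then show ?thesis by (metis power_mult_distrib power_Suc2 Suc_eq_plus1)
  qed
  also have "\<dots> \<le> r ^ (j + 1) * (272 / 100 * (125 / 100))"
    using e r by (intro mult_left_mono mult_mono) (auto simp: field_simps)
  finally have A: "(r + 1) ^ (j + 1) \<le> 34 / 10 * r ^ (j + 1)" by simp
  have B: "(r + 2) ^ 3 \<le> (3 / 2 * r) ^ 3" using r by (intro power_mono) auto
  have C: "r ^ j \<ge> r ^ 4" using r j by (intro power_increasing) auto
  have r3: "r ^ 3 \<ge> 64" using power_mono[of 4 r 3] r by simp
  have r4: "r ^ 4 \<ge> 4 * r ^ 3" using r mult_right_mono[of 4 r "r^3"] by (simp add: power3_eq_cube power4_eq_xxxx)
  have "(r + 2) ^ 3 * (r + 1) ^ (j + 1) + 4 * (r + 2) * r ^ j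
      \<le> (3 / 2 * r) ^ 3 * (34 / 10 * r ^ (j + 1)) + 4 * (3 / 2 * r) * r ^ j"
    using A B r by (intro add_mono mult_mono) auto
  also have "\<dots> = r ^ (j + 1) * (11475 / 1000 * r ^ 3 + 6)"
    by (simp add: power_mult_distrib algebra_simps power_divide)
  also have "\<dots> \<le> r ^ (j + 1) * (4 * r ^ j)"
  proof (rule mult_left_mono)
    show "11475 / 1000 * r ^ 3 + 6 \<le> 4 * r ^ j" using r3 r4 C by linarith
  qed (use r in simp)
  also have "\<dots> = 4 * r ^ (2 * j + 1)" by (simp add: power_add mult_2)
  finally show ?thesis by (simp add: r_def)
qed

text \<open>Bounds, after scaling by the number of vertices, the number of copies through a vertex that
  use one of its strays, when there are \<open>s\<close> strays among \<open>e\<close> minority neighbours. For \<open>k = 4\<close> the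
  formula valid for larger \<open>k\<close> would be too weak.\<close>
definition cross_bound :: "nat \<Rightarrow> real \<Rightarrow> real \<Rightarrow> real" where
  "cross_bound k e s = (if k = 4 then s / 4 * (e - s / 3) ^ 2 else s * (e / (real k - 2)) ^ (k - 2))"

section \<open>Numerical comparison of copies gained and transversal tuples missed\<close>

lemma minority_bound_pos: "4 \<le> k \<Longrightarrow> 0 < minority_bound k"
  by (auto simp: minority_bound_def)

text \<open>The bracket will bound the product of all relative part sizes from below. Two sizes have
  product at most 1/4, so four times the bracket bounds the product of the other
  \<open>k - 2\<close>; the inequality says that this pays for the copies gained at a stray.\<close>

lemma large_uniformity_gap:
  assumes k: "6 \<le> k"
  defines "e \<equiv> minority_bound k"
  shows "real k * (real k - 1) * (e / (real k - 2)) ^ (k - 2)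
      \<le> (real k - 2) * (4 * (1 / (real k ^ k - real k) - (e / (real k - 1)) ^ (k - 1)))"
proof -
  define j where "j = k - 2"
  have kj: "k = j + 2" and j: "4 \<le> j" using k by (auto simp: j_def)
  define r where "r = real j"
  have r: "4 \<le> r" using j by (simp add: r_def)
  have rk: "real k = r + 2" by (simp add: kj r_def)
  define c where "c = (r + 2) ^ (j + 2) * r ^ (2 * j)"
  have c: "c > 0" using r by (simp add: c_def)
  have e: "e = (r + 1) / ((r + 2) * r)" using k by (simp add: e_def minority_bound_def rk add.commute)
  have e1: "e / (real k - 2) = (r + 1) / ((r + 2) * r ^ 2)" by (simp add: e rk power2_eq_square)
  have e2: "e / (real k - 1) = 1 / ((r + 2) * r)" using r by (simp add: e rk divide_simps add.commute)
  have L: "c * ((r + 2) * (r + 1) * ((r + 1) / ((r + 2) * r ^ 2)) ^ j) = (r + 2) ^ 3 * (r + 1) ^ (j + 1)"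
  proof -
    have "((r + 1) / ((r + 2) * r ^ 2)) ^ j = (r + 1) ^ j / ((r + 2) ^ j * r ^ (2 * j))"
      by (simp add: power_divide power_mult_distrib flip: power_mult)
    then show ?thesis using r by (simp add: c_def field_simps power_add power2_eq_square power3_eq_cube)
  qed
  have R: "c * (r * (4 * (1 / (r + 2) ^ (j + 2) - (1 / ((r + 2) * r)) ^ (j + 1))))
      = 4 * r ^ (2 * j + 1) - 4 * (r + 2) * r ^ j"
  proof -
    have a: "c * (1 / (r + 2) ^ (j + 2)) = r ^ (2 * j)" using r by (simp add: c_def)
    have "c * (1 / ((r + 2) * r)) ^ (j + 1) = c / ((r + 2) ^ (j + 1) * r ^ (j + 1))"
      by (simp add: power_divide power_mult_distrib)
    also have "r * \<dots> = (r + 2) * r ^ j"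
    proof -
      have "r * c = (r + 2) * r ^ j * ((r + 2) ^ (j + 1) * r ^ (j + 1))"
        by (simp add: c_def power_add mult_2)
      moreover have "(r + 2) ^ (j + 1) * r ^ (j + 1) \<noteq> 0" using r by simp
      ultimately show ?thesis by (metis nonzero_mult_div_cancel_right times_divide_eq_right)
    qed
    finally have b: "r * (c * (1 / ((r + 2) * r)) ^ (j + 1)) = (r + 2) * r ^ j" .
    have "c * (r * (4 * (1 / (r + 2) ^ (j + 2) - (1 / ((r + 2) * r)) ^ (j + 1))))
        = 4 * r * (c * (1 / (r + 2) ^ (j + 2))) - 4 * (r * (c * (1 / ((r + 2) * r)) ^ (j + 1)))"
      by (simp only: algebra_simps)
    then show ?thesis unfolding a b by simp
  qed
  have "c * ((r + 2) * (r + 1) * ((r + 1) / ((r + 2) * r ^ 2)) ^ j)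
      \<le> c * (r * (4 * (1 / (r + 2) ^ (j + 2) - (1 / ((r + 2) * r)) ^ (j + 1))))"
    unfolding L R using large_uniformity_estimate[OF j] by (simp add: r_def)
  then have "(r + 2) * (r + 1) * ((r + 1) / ((r + 2) * r ^ 2)) ^ j
      \<le> r * (4 * (1 / (r + 2) ^ (j + 2) - (1 / ((r + 2) * r)) ^ (j + 1)))"
    using c by simp
  also have "\<dots> \<le> r * (4 * (1 / ((r + 2) ^ (j + 2) - (r + 2)) - (1 / ((r + 2) * r)) ^ (j + 1)))"
  proof -
    have "(r + 2) ^ 1 < (r + 2) ^ (j + 2)" using r by (intro power_strict_increasing) auto
    then have "1 / (r + 2) ^ (j + 2) \<le> 1 / ((r + 2) ^ (j + 2) - (r + 2))"
      using r by (intro divide_left_mono) auto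
    then show ?thesis using r by simp
  qed
  finally show ?thesis unfolding e1 e2 unfolding rk by (simp add: kj add.commute)
qed

text \<open>Here \<open>x i\<close> are the relative part sizes and \<open>p\<close> is the part of a vertex with \<open>s\<close> strays:
  the transversal tuples through it that are lost outnumber the copies gained.\<close>
lemma cross_bound_le_missing:
  fixes x :: "nat \<Rightarrow> real"
  assumes k: "4 \<le> k" and x: "\<And>i. i < k \<Longrightarrow> 0 \<le> x i" and sum: "(\<Sum>i<k. x i) = 1"
    and main: "1 / (real k ^ k - real k) - (minority_bound k / (real k - 1)) ^ (k - 1) \<le> prod x {..<k}"
    and p: "p < k" and q: "q < k" "q \<noteq> p" and max: "\<And>i. i < k \<Longrightarrow> i \<noteq> p \<Longrightarrow> x i \<le> x q"
    and s: "0 \<le> s" "s \<le> minority_bound k" "s \<le> (real k - 1) * x q"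
  shows "real k * cross_bound k (minority_bound k) s
      \<le> (real k - 2) * (prod x ({..<k} - {p}) * (1 - (1 - s / ((real k - 1) * x q)) ^ (k - 1)))"
proof -
  define pi where "pi = 1 / (real k ^ k - real k) - (minority_bound k / (real k - 1)) ^ (k - 1)"
  define P where "P = prod x ({..<k} - {p})"
  define B where "B = prod x ({..<k} - {p} - {q})"
  define X where "X = x q"
  define w where "w = s / ((real k - 1) * X)"
  have PB: "P = X * B" unfolding P_def B_def X_def using q by (subst prod.remove[of _ q]) auto
  have xP: "prod x {..<k} = x p * P" unfolding P_def using p by (subst prod.remove[of _ p]) auto
  have B0: "0 \<le> B" unfolding B_def by (rule prod_nonneg) (use x in auto)
  have X0: "0 \<le> X" "0 \<le> x p" using x q p by (auto simp: X_def)
  have two: "x p + X \<le> 1"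
  proof -
    have "(\<Sum>i\<in>{p,q}. x i) \<le> (\<Sum>i<k. x i)" by (rule sum_mono2) (use p q x in auto)
    then show ?thesis using q sum by (simp add: X_def)
  qed
  have pi: "pi \<le> x p * (X * B)" using main xP PB by (simp add: pi_def)
  have prod4: "x p * X \<le> 1 / 4"
  proof -
    have "(x p + X) ^ 2 \<le> 1 ^ 2" using two X0 by (intro power_mono) auto
    moreover have "0 \<le> (x p - X) ^ 2" by simp
    ultimately show ?thesis by (simp add: power2_eq_square algebra_simps)
  qed
  have B4: "4 * pi \<le> B"
    using pi mult_right_mono[OF prod4 B0] by (simp add: mult.assoc)
  \<comment> \<open>Together with \<open>piX\<close> this keeps the largest other part away from 0
    and so limits \<open>w\<close>. For \<open>k >= 6\<close> only \<open>X > 0\<close> is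
    needed.\<close>
  have PX: "P \<le> X ^ (k - 1)"
  proof -
    have "P \<le> (\<Prod>i\<in>{..<k} - {p}. X)" unfolding P_def X_def
      by (rule prod_mono) (use x max in auto)
    then show ?thesis using p by simp
  qed
  have piX: "pi \<le> X ^ (k - 1)"
  proof -
    have "x p * P \<le> 1 * P" using two X0 B0 PB by (intro mult_right_mono) auto
    then show ?thesis using PX pi PB by simp
  qed
  consider (4) "k = 4" | (5) "k = 5" | (6) "6 \<le> k" using k by linarith
  then have "real k * cross_bound k (minority_bound k) s \<le> (real k - 2) * (P * (1 - (1 - w) ^ (k - 1)))"
  proof cases
    case 6
    have Xpos: "X > 0"
    proof (rule ccontr)
      assume "\<not> X > 0"
      then have "X = 0" using X0 by simp
      then have "s = 0" "pi \<le> 0" using s X_def piX k by (auto simp: power_0_left)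
      moreover have "0 < 4 * pi * (real k - 2)"
      proof -
        have "0 < real k * (real k - 1) * (minority_bound k / (real k - 2)) ^ (k - 2)"
          using 6 minority_bound_pos[of k] by (intro mult_pos_pos zero_less_power divide_pos_pos) auto
        then show ?thesis using large_uniformity_gap[OF 6] by (simp add: pi_def algebra_simps)
      qed
      ultimately show False using 6 by (simp add: zero_less_mult_iff)
    qed
    have w: "0 \<le> w" "w \<le> 1" using s Xpos 6 by (auto simp: w_def X_def divide_simps)
    \<comment> \<open>The linear bound is enough for \<open>k >= 6\<close>; the size
      \<open>X\<close> then cancels in \<open>P * w\<close>.\<close>
    have "(1 - w) ^ (k - 1) \<le> (1 - w) ^ 1" using w 6 by (intro power_decreasing) auto
    then have "P * w \<le> P * (1 - (1 - w) ^ (k - 1))" using PB X0 B0 by (intro mult_left_mono) auto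
    moreover have "P * w = B * s / (real k - 1)" using Xpos 6 by (simp add: PB w_def)
    ultimately have A: "B * s / (real k - 1) \<le> P * (1 - (1 - w) ^ (k - 1))" by simp
    have "real k * (real k - 1) * (minority_bound k / (real k - 2)) ^ (k - 2) \<le> (real k - 2) * (4 * pi)"
      using large_uniformity_gap[OF 6] by (simp add: pi_def)
    also have "\<dots> \<le> (real k - 2) * B" using B4 6 by (intro mult_left_mono) auto
    finally have "s * (real k * (real k - 1) * (minority_bound k / (real k - 2)) ^ (k - 2)) \<le> s * ((real k - 2) * B)"
      using s by (intro mult_left_mono) auto
    then have "real k * cross_bound k (minority_bound k) s \<le> (real k - 2) * (B * s / (real k - 1))"
      using 6 by (simp add: cross_bound_def field_simps)
    also have "\<dots> \<le> (real k - 2) * (P * (1 - (1 - w) ^ (k - 1)))"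
      using A 6 by (intro mult_left_mono) auto
    finally show ?thesis .
  next
    case 5
    have mb: "minority_bound 5 = 21 / 100" by (simp add: minority_bound_def)
    have pi5: "pi \<ge> 3129 / 10000000" using 5 by (simp add: pi_def mb power_divide)
    have Xl: "X > 13 / 100"
    proof (rule ccontr)
      assume "\<not> ?thesis"
      then have "X ^ 4 \<le> (13/100) ^ 4" using X0 by (intro power_mono) auto
      then show False using piX pi5 5 by (simp add: power_divide)
    qed
    have w: "0 \<le> w" "w \<le> 45 / 100" using s Xl by (auto simp: w_def mb divide_simps 5)
    \<comment> \<open>A single \<open>w\<close>, as for larger \<open>k\<close>, would be too
      wasteful with only \<open>B >= 4 * pi\<close> at hand; the range \<open>w <= 0.45\<close>
      allows \<open>2 * w\<close>.\<close>
    have "2 * w \<le> 1 - (1 - w) ^ 4"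
    proof -
      have "0 \<le> w * (2 - 6 * w + 4 * w ^ 2 - w ^ 3)"
      proof (rule mult_nonneg_nonneg)
        have "w * w ^ 2 \<le> 45 / 100 * w ^ 2" using w by (intro mult_right_mono) auto
        moreover have "17 / 10 * w \<le> w ^ 2 + 5625 / 10000"
        proof -
          have "0 \<le> (45/100 - w) * (125/100 - w)" using w by (intro mult_nonneg_nonneg) auto
          then show ?thesis by (simp add: power2_eq_square field_simps)
        qed
        moreover have "w ^ 3 = w * w ^ 2" by (simp add: power3_eq_cube power2_eq_square)
        ultimately show "0 \<le> 2 - 6 * w + 4 * w ^ 2 - w ^ 3" using w by linarith
      qed (use w in auto)
      then show ?thesis by (simp add: power2_eq_square power3_eq_cube power4_eq_xxxx algebra_simps)
    qed
    then have "P * (2 * w) \<le> P * (1 - (1 - w) ^ (k - 1))" using PB X0 B0 5 by (intro mult_left_mono) auto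
    moreover have "P * (2 * w) = B * s / 2" using Xl 5 by (simp add: PB w_def)
    ultimately have A: "B * s / 2 \<le> P * (1 - (1 - w) ^ (k - 1))" by simp
    have "5 * (7/100)^3 \<le> 3 / 2 * B" using B4 pi5 by (simp add: power_divide)
    then have "s * (5 * (7/100)^3) \<le> s * (3 / 2 * B)" using s by (intro mult_left_mono) auto
    then show ?thesis using A by (simp add: cross_bound_def mb 5 power_divide mult.commute[of B s])
  next
    case 4
    have mb: "minority_bound 4 = 2561 / 10000" by (simp add: minority_bound_def)
    have pi4: "pi \<ge> 33461 / 10000000" using 4 by (simp add: pi_def mb power_divide)
    \<comment> \<open>The constant is three fifths of the minority bound, rounded up, so that
      \<open>w <= 5/3 * z\<close> below. Its cube slightly exceeds the lower bound for
      \<open>pi\<close>, hence the detour through \<open>x p\<close>.\<close>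
    have Xl: "X > 1537 / 10000"
    proof (rule ccontr)
      assume X: "\<not> ?thesis"
      then have "X ^ 3 \<le> (1537/10000) ^ 3" using X0 by (intro power_mono) auto
      then have P3: "P \<le> 3632 / 1000000" using PX 4 by (simp add: power_divide)
      have "pi \<le> x p * (3632 / 1000000)" using mult_left_mono[OF P3 X0(2)] pi PB by simp
      then have "x p > 92 / 100" using pi4 by simp
      then have "X \<le> 8 / 100" using two by simp
      then have "X ^ 3 \<le> (8/100) ^ 3" using X0 by (intro power_mono) auto
      then show False using piX pi4 4 by (simp add: power_divide)
    qed
    \<comment> \<open>For \<open>k = 4\<close> the bound \<open>4 * pi\<close> is too small. If
      \<open>B\<close> violated this one, then \<open>a = x p + X\<close> would exceed 0.638, and
      the product of all four sizes, at most \<open>(a (1 - a))^2 / 16\<close>, would drop below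
      \<open>pi\<close>.\<close>
    have Bl: "(2561 / 10000) ^ 2 / 2 \<le> B"
    proof (rule ccontr)
      assume nb: "\<not> ?thesis"
      define a where "a = x p + X"
      have a0: "0 \<le> a" "a \<le> 1" using X0 two by (auto simp: a_def)
      have c2: "card ({..<k} - {p} - {q}) = 2" using p q 4 by simp
      have s2: "(\<Sum>i\<in>{..<k} - {p} - {q}. x i) = 1 - a"
      proof -
        have "(\<Sum>i<k. x i) = x p + (\<Sum>i\<in>{..<k} - {p}. x i)" using p by (simp add: sum.remove)
        also have "(\<Sum>i\<in>{..<k} - {p}. x i) = X + (\<Sum>i\<in>{..<k} - {p} - {q}. x i)"
          unfolding X_def using q by (intro sum.remove) auto
        finally show ?thesis using sum by (simp add: a_def)
      qed
      have Bu: "B \<le> ((1 - a) / 2) ^ 2"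
        using prod_le_mean_power[of "{..<k} - {p} - {q}" x] x c2 s2 by (simp add: B_def)
      have Au: "x p * X \<le> (a / 2) ^ 2"
        using zero_le_power2[of "x p - X"] by (simp add: a_def power2_eq_square algebra_simps)
      have "pi \<le> x p * X * (32794 / 1000000)"
      proof -
        have "x p * X * B \<le> x p * X * (32794 / 1000000)"
          using nb X0 by (intro mult_left_mono) (auto simp: power2_eq_square)
        then show ?thesis using pi by (simp add: mult.assoc)
      qed
      then have "(a / 2) ^ 2 \<ge> 10202 / 100000" using Au pi4 by simp
      then have al: "a > 638 / 1000"
        using power_mono[of "a / 2" "319/1000" 2] a0 by (force simp: power_divide)
      have "a * (1 - a) \<le> 638 / 1000 * (362 / 1000)"
      proof -
        have "0 \<le> (a - 638/1000) * (a - 362/1000)" using al by (intro mult_nonneg_nonneg) auto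
        then show ?thesis by (simp add: algebra_simps)
      qed
      then have "(a * (1 - a)) ^ 2 \<le> (638 / 1000 * (362 / 1000)) ^ 2" using a0 by (intro power_mono) auto
      then have "(a / 2) ^ 2 * ((1 - a) / 2) ^ 2 \<le> (638 / 1000 * (362 / 1000)) ^ 2 / 16"
        by (simp add: power_divide power_mult_distrib)
      moreover have "x p * X * B \<le> (a / 2) ^ 2 * ((1 - a) / 2) ^ 2"
        using Au Bu X0 B0 by (intro mult_mono) auto
      ultimately show False using pi pi4 by (simp add: power_divide mult.assoc)
    qed
    define z where "z = s / (3 * (2561 / 10000))"
    have z: "0 \<le> z" "z \<le> 1 / 3" using s(1,2) 4 by (auto simp: z_def mb)
    have w: "0 \<le> w" "w \<le> 5 / 3 * z"
    proof -
      show "0 \<le> w" using s Xl 4 by (simp add: w_def)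
      have "w \<le> s / (3 * (1537 / 10000))" unfolding w_def using Xl s 4 by (intro divide_left_mono) auto
      also have "\<dots> \<le> 5 / 3 * z" using s by (simp add: z_def)
      finally show "w \<le> 5 / 3 * z" .
    qed
    \<comment> \<open>For \<open>w > 0\<close> the right side is
      \<open>(1 - (1 - w)^3) / (3 w)\<close>, which decreases in the range at hand, so the
      comparison is made at the endpoint \<open>w = 5/3 * z\<close>.\<close>
    have wz: "(1 - z) ^ 2 \<le> 1 - w + w ^ 2 / 3"
    proof -
      have "0 \<le> (5/3*z - w) * (1 - (5/3*z + w) / 3)" using w z by (intro mult_nonneg_nonneg) auto
      then have "1 - 5/3*z + (5/3*z) ^ 2 / 3 \<le> 1 - w + w ^ 2 / 3" by (simp add: power2_eq_square field_simps)
      moreover have "0 \<le> z * (1/3 - 2/27 * z)" using z by (intro mult_nonneg_nonneg) auto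
      ultimately show ?thesis by (simp add: power2_eq_square field_simps)
    qed
    have "cross_bound k (minority_bound k) s = s / 2 * ((2561 / 10000) ^ 2 / 2 * (1 - z) ^ 2)"
      by (simp add: cross_bound_def mb 4 z_def power2_eq_square algebra_simps)
    also have "\<dots> \<le> s / 2 * (B * (1 - w + w ^ 2 / 3))"
      using Bl wz s B0 by (intro mult_left_mono mult_mono) auto
    also have "B * (s * (1 - w + w ^ 2 / 3)) = P * (1 - (1 - w) ^ 3)"
    proof -
      have sw: "s = 3 * X * w" using Xl 4 by (simp add: w_def)
      show ?thesis unfolding PB sw by (simp add: power2_eq_square power3_eq_cube algebra_simps)
    qed
    then have "s / 2 * (B * (1 - w + w ^ 2 / 3)) = P * (1 - (1 - w) ^ 3) / 2" by (simp add: mult.left_commute)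
    finally show ?thesis using 4 by simp
  qed
  then show ?thesis by (simp add: P_def w_def X_def)
qed

section \<open>The extremal bound\<close>

text \<open>\<open>R u v\<close> is the role that \<open>u\<close> plays towards \<open>v\<close>; a copy of an edge is a tuple in which
  the \<open>i\<close>-th vertex plays role \<open>i\<close> towards all the others.\<close>

definition copies :: "nat \<Rightarrow> ('a \<Rightarrow> 'a \<Rightarrow> nat) \<Rightarrow> 'a set \<Rightarrow> (nat \<Rightarrow> 'a) set" where
  "copies k R V = {x \<in> {..<k} \<rightarrow>\<^sub>E V. \<forall>i<k. \<forall>j<k. i \<noteq> j \<longrightarrow> R (x i) (x j) = i}"

section \<open>Copies through a vertex, counted by roles\<close>

lemma finite_copies: "finite V \<Longrightarrow> finite (copies k R V)"
  unfolding copies_def by (rule finite_subset[of _ "{..<k} \<rightarrow>\<^sub>E V"]) (blast, simp add: finite_PiE)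

lemma copies_mono: "U \<subseteq> V \<Longrightarrow> copies k R U \<subseteq> copies k R V"
  unfolding copies_def using PiE_mono[of "{..<k}" "\<lambda>_. U" "\<lambda>_. V"] by blast

text \<open>Injectivity of copies is automatic: if \<open>x i\<close> and \<open>x j\<close>
  coincided, the role of that vertex towards itself would be both \<open>i\<close> and
  \<open>j\<close>.\<close>

lemma copiesD:
  assumes "x \<in> copies k R V" "i < k"
  shows "x i \<in> V" "\<And>j. j < k \<Longrightarrow> j \<noteq> i \<Longrightarrow> R (x i) (x j) = i" "\<And>j. j < k \<Longrightarrow> j \<noteq> i \<Longrightarrow> x j \<noteq> x i"
proof -
  show "x i \<in> V" using assms by (auto simp: copies_def)
  show r: "R (x i) (x j) = i" if "j < k" "j \<noteq> i" for j using assms that by (auto simp: copies_def)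
  show "x j \<noteq> x i" if "j < k" "j \<noteq> i" for j
  proof
    assume e: "x j = x i"
    have "R (x i) (x j) = i" using r that by blast
    moreover have "R (x j) (x i) = j" using assms that by (auto simp: copies_def)
    ultimately show False using e that by simp
  qed
qed

lemma card_tuples_le_prod:
  fixes k :: nat
  assumes X: "X \<subseteq> {..<k} \<rightarrow>\<^sub>E V" and p: "p < k"
    and A: "\<And>j. j < k \<Longrightarrow> j \<noteq> p \<Longrightarrow> finite (A j)"
    and x: "\<And>x j. x \<in> X \<Longrightarrow> x p = u \<and> (j < k \<longrightarrow> j \<noteq> p \<longrightarrow> x j \<in> A j)"
  shows "card X \<le> (\<Prod>j\<in>{..<k} - {p}. card (A j))"
proof -
  let ?B = "\<lambda>j. if j = p then {u} else A j"
  have "X \<subseteq> PiE {..<k} ?B"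
  proof
    fix y assume y: "y \<in> X"
    then have "y \<in> {..<k} \<rightarrow>\<^sub>E V" using X by blast
    then show "y \<in> PiE {..<k} ?B" using x[OF y] by (auto simp: PiE_iff)
  qed
  moreover have "finite (PiE {..<k} ?B)" using A by (intro finite_PiE) auto
  ultimately have "card X \<le> card (PiE {..<k} ?B)" by (rule card_mono[rotated])
  also have "\<dots> = (\<Prod>j<k. card (?B j))" by (simp add: card_PiE)
  also have "\<dots> = (\<Prod>j\<in>{..<k} - {p}. card (?B j))" using p by (simp add: prod.remove[of _ p])
  also have "\<dots> = (\<Prod>j\<in>{..<k} - {p}. card (A j))" by (rule prod.cong) auto
  finally show ?thesis .
qed

locale role_structure =
  fixes k :: nat and R :: "'a \<Rightarrow> 'a \<Rightarrow> nat" and V :: "'a set"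
  assumes k: "4 \<le> k" and fin: "finite V"
begin

definition nbr :: "'a \<Rightarrow> nat \<Rightarrow> nat \<Rightarrow> 'a set" where
  "nbr u i j = {w \<in> V. R u w = i \<and> R w u = j}"

definition playing :: "'a \<Rightarrow> nat \<Rightarrow> 'a set" where
  "playing u i = {w \<in> V - {u}. R u w = i}"

abbreviation "C \<equiv> copies k R V"

lemma finite_nbr [simp]: "finite (nbr u i j)" using fin by (simp add: nbr_def)
lemma finite_playing [simp]: "finite (playing u i)" using fin by (simp add: playing_def)

lemma sum_card_nbr_le: "(\<Sum>j\<in>{..<k} - {i}. card (nbr u i j)) \<le> card (playing u i)"
proof -
  have "(\<Sum>j\<in>{..<k} - {i}. card (nbr u i j)) = card (\<Union>j\<in>{..<k} - {i}. nbr u i j)"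
    by (rule card_UN_disjoint[symmetric]) (auto simp: nbr_def fin)
  also have "\<dots> \<le> card (playing u i)"
    by (rule card_mono) (auto simp: nbr_def playing_def fin)
  finally show ?thesis .
qed

lemma card_copies_through_le_prod:
  assumes "p < k"
  shows "card {x \<in> C. x p = u} \<le> (\<Prod>j\<in>{..<k} - {p}. card (nbr u p j))"
proof (rule card_tuples_le_prod[OF _ assms])
  show "{x \<in> C. x p = u} \<subseteq> {..<k} \<rightarrow>\<^sub>E V" by (auto simp: copies_def)
  fix x j assume x: "x \<in> {x \<in> C. x p = u}"
  have "x j \<in> nbr u p j" if "j < k" "j \<noteq> p"
    using x that assms by (auto simp: nbr_def dest: copiesD)
  then show "x p = u \<and> (j < k \<longrightarrow> j \<noteq> p \<longrightarrow> x j \<in> nbr u p j)" using x by auto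
qed simp

text \<open>The other vertices of a copy lie among those towards which \<open>u\<close> plays
  \<open>p\<close>, and the role that they play back sorts them into \<open>k - 1\<close> disjoint
  classes; AM-GM is applied to the class sizes.\<close>

lemma card_copies_through_le:
  assumes p: "p < k"
  shows "real (card {x \<in> C. x p = u}) \<le> (real (card (playing u p)) / (real k - 1)) ^ (k - 1)"
proof -
  have c: "card ({..<k} - {p}) = k - 1" using p by simp
  have "real (card {x \<in> C. x p = u}) \<le> (\<Prod>j\<in>{..<k} - {p}. real (card (nbr u p j)))"
    using card_copies_through_le_prod[OF p, of u] by (simp only: of_nat_le_iff flip: of_nat_prod)
  also have "\<dots> \<le> ((\<Sum>j\<in>{..<k} - {p}. real (card (nbr u p j))) / real (k - 1)) ^ (k - 1)"
    using prod_le_mean_power[of "{..<k} - {p}" "\<lambda>j. real (card (nbr u p j))"] c by simp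
  also have "\<dots> \<le> (real (card (playing u p)) / real (k - 1)) ^ (k - 1)"
    using sum_card_nbr_le[of u p]
    by (intro power_mono divide_right_mono) (auto simp: sum_nonneg simp flip: of_nat_sum)
  finally show ?thesis using k by (simp add: of_nat_diff)
qed

lemma card_copies_delete_le:
  "card C \<le> card (copies k R (V - {v})) + (\<Sum>p<k. card {x \<in> C. x p = v})"
proof -
  have "C \<subseteq> copies k R (V - {v}) \<union> (\<Union>p<k. {x \<in> C. x p = v})"
    by (auto simp: copies_def PiE_iff)
  then have "card C \<le> card (copies k R (V - {v}) \<union> (\<Union>p<k. {x \<in> C. x p = v}))"
    by (rule card_mono[rotated]) (auto simp: finite_copies fin)
  also have "\<dots> \<le> card (copies k R (V - {v})) + card (\<Union>p<k. {x \<in> C. x p = v})" by (rule card_Un_le)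
  also have "card (\<Union>p<k. {x \<in> C. x p = v}) \<le> (\<Sum>p<k. card {x \<in> C. x p = v})" by (rule card_UN_le) simp
  finally show ?thesis by simp
qed

lemma sum_card_playing_le:
  assumes "finite I"
  shows "(\<Sum>i\<in>I. card (playing u i)) \<le> card {w \<in> V - {u}. R u w \<in> I}"
proof -
  have "(\<Sum>i\<in>I. card (playing u i)) = card (\<Union>i\<in>I. playing u i)"
    by (rule card_UN_disjoint[symmetric]) (auto simp: playing_def fin assms)
  also have "\<dots> \<le> card {w \<in> V - {u}. R u w \<in> I}" by (rule card_mono) (auto simp: playing_def fin)
  finally show ?thesis .
qed

end

section \<open>Dominant roles in a minimal counterexample\<close>

lemma power_Suc_add_one_ge:
  fixes m :: real
  assumes "0 \<le> m"
  shows "m ^ Suc K + real (Suc K) * m ^ K \<le> (m + 1) ^ Suc K"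
proof (induction K)
  case (Suc K)
  have "m ^ Suc (Suc K) + real (Suc (Suc K)) * m ^ Suc K
      \<le> (m + 1) * (m ^ Suc K + real (Suc K) * m ^ K)"
    using assms by (simp add: algebra_simps)
  also have "\<dots> \<le> (m + 1) * (m + 1) ^ Suc K" using Suc assms by (intro mult_left_mono) auto
  finally show ?case by simp
qed simp

text \<open>An inclusion-minimal counterexample to the bound on copies; the locale exists to be
  refuted in \<open>contradiction\<close>.\<close>

locale critical_structure = role_structure +
  assumes IH: "\<And>U. U \<subset> V \<Longrightarrow> real (card (copies k R U)) \<le> real (card U) ^ k / (real k ^ k - real k)"
    and exceeds: "real (card V) ^ k / (real k ^ k - real k) < real (card C)"
begin

abbreviation "n \<equiv> real (card V)"
abbreviation "e \<equiv> minority_bound k"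

lemma denominator_pos: "0 < real k ^ k - real k"
  using k power_strict_increasing[of 1 k "real k"] by simp

text \<open>By minimality, deleting \<open>v\<close> destroys more than
  \<open>m^K / (k^K - 1)\<close> copies, where \<open>m = n - 1\<close> and
  \<open>K = k - 1\<close>. Sorting these by the role of \<open>v\<close> and applying
  \<open>card_copies_through_le\<close> yields the hypothesis of
  \<open>exists_majority_weight\<close>.\<close>

lemma exists_dominant:
  assumes v: "v \<in> V"
  shows "\<exists>p<k. real (card {w \<in> V - {v}. R v w \<noteq> p}) \<le> e * n"
proof -
  define K where "K = k - 1"
  have kK: "k = Suc K" using k by (simp add: K_def)
  have rK: "real K = real k - 1" using k by (simp add: kK)
  define m where "m = n - 1"
  have cV: "card V > 0" using v fin by (auto simp: card_gt_0_iff)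
  have cm: "real (card (V - {v})) = m" using v fin cV by (simp add: m_def of_nat_diff)
  have m0: "m \<ge> 0" using cV by (simp add: m_def)
  define y where "y p = real (card (playing v p))" for p
  have D: "0 < real k ^ K - 1" using k one_less_power[of "real k" K] by (simp add: K_def)
  have DD: "real k ^ k - real k = real k * (real k ^ K - 1)" by (simp add: kK algebra_simps)
  have sumy: "(\<Sum>p<k. y p) \<le> m"
  proof -
    have "(\<Sum>p<k. card (playing v p)) \<le> card {w \<in> V - {v}. R v w \<in> {..<k}}"
      by (rule sum_card_playing_le) simp
    also have "\<dots> \<le> card (V - {v})" by (rule card_mono) (auto simp: fin)
    finally have "real (\<Sum>p<k. card (playing v p)) \<le> real (card (V - {v}))" by (rule of_nat_mono)
    then show ?thesis unfolding y_def cm by simp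
  qed
  have "real (card (copies k R (V - {v}))) \<le> m ^ k / (real k ^ k - real k)"
    using IH[of "V - {v}"] v unfolding cm by blast
  moreover have "real (card C) \<le> real (card (copies k R (V - {v}))) + (\<Sum>p<k. real (card {x \<in> C. x p = v}))"
    using card_copies_delete_le[of v] by (simp only: of_nat_le_iff flip: of_nat_sum of_nat_add)
  moreover have "m ^ k / (real k ^ k - real k) + m ^ K / (real k ^ K - 1) \<le> n ^ k / (real k ^ k - real k)"
  proof -
    have "m ^ k / (real k ^ k - real k) + m ^ K / (real k ^ K - 1) = (m ^ k + real k * m ^ K) / (real k ^ k - real k)"
      using k unfolding DD by (simp add: add_divide_distrib)
    also have "\<dots> \<le> n ^ k / (real k ^ k - real k)"
      using power_Suc_add_one_ge[OF m0, of K] denominator_pos by (intro divide_right_mono) (auto simp: kK m_def)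
    finally show ?thesis .
  qed
  moreover have "(\<Sum>p<k. real (card {x \<in> C. x p = v})) \<le> (\<Sum>p<k. (y p / real K) ^ K)"
    using card_copies_through_le[of _ v] by (intro sum_mono) (auto simp: y_def rK K_def)
  ultimately have big: "m ^ K / (real k ^ K - 1) < (\<Sum>p<k. (y p / real K) ^ K)"
    using exceeds by linarith
  show ?thesis
  proof (cases "m = 0")
    \<comment> \<open>Here \<open>V = {v}\<close>: the weights \<open>y p / m\<close> would divide
      by 0, but every role is dominant.\<close>
    case True
    have "card {w \<in> V - {v}. R v w \<noteq> 0} \<le> card (V - {v})" by (rule card_mono) (auto simp: fin)
    then show ?thesis using True cm k minority_bound_pos[OF k] by (intro exI[of _ 0]) auto
  next
    case False
    then have mp: "m > 0" using m0 by simp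
    have "\<exists>p<k. 1 - y p / m \<le> e"
    proof (rule exists_majority_weight[OF k])
      show "0 \<le> y i / m" for i using mp by (simp add: y_def)
      show "(\<Sum>i<k. y i / m) \<le> 1" using sumy mp by (simp flip: sum_divide_distrib)
      have "(\<Sum>p<k. (y p / real K) ^ K) = (\<Sum>p<k. (y p / m) ^ K) * (m ^ K / real K ^ K)"
        unfolding sum_distrib_right using mp by (intro sum.cong) (auto simp: power_divide)
      then have "m ^ K / (real k ^ K - 1) \<le> (\<Sum>p<k. (y p / m) ^ K) * (m ^ K / real K ^ K)" using big by simp
      then have "m ^ K * (1 / (real k ^ K - 1)) \<le> m ^ K * ((\<Sum>p<k. (y p / m) ^ K) / real K ^ K)"
        by (simp add: mult.commute)
      then have "1 / (real k ^ K - 1) \<le> (\<Sum>p<k. (y p / m) ^ K) / real K ^ K"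
        by (rule mult_left_le_imp_le) (use mp in simp)
      then have "real K ^ K / (real k ^ K - 1) \<le> (\<Sum>p<k. (y p / m) ^ K)"
        using k D by (simp add: field_simps kK)
      then show "(real k - 1) ^ (k - 1) / (real k ^ (k - 1) - 1) \<le> (\<Sum>i<k. (y i / m) ^ (k - 1))"
        unfolding rK unfolding K_def .
    qed
    then obtain p where p: "p < k" "1 - y p / m \<le> e" by blast
    have "V - {v} = playing v p \<union> {w \<in> V - {v}. R v w \<noteq> p}" by (auto simp: playing_def)
    moreover have "playing v p \<inter> {w \<in> V - {v}. R v w \<noteq> p} = {}" by (auto simp: playing_def)
    ultimately have "card (V - {v}) = card (playing v p) + card {w \<in> V - {v}. R v w \<noteq> p}"
      using fin by (metis (no_types, lifting) card_Un_disjoint finite_Diff finite_Un)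
    then have "real (card {w \<in> V - {v}. R v w \<noteq> p}) = m - y p" using cm by (simp add: y_def)
    also have "\<dots> \<le> e * m" using p(2) mp by (simp add: field_simps)
    also have "\<dots> \<le> e * n" using minority_bound_pos[OF k] by (simp add: m_def)
    finally show ?thesis using p(1) by blast
  qed
qed

end

text \<open>Here \<open>f i\<close> is the dominant role of the \<open>i\<close>-th vertex of a copy.\<close>
lemma card_stray_pairs_ge:
  fixes f :: "nat \<Rightarrow> nat"
  assumes i0: "i0 < k" "f i0 \<noteq> i0" and nonconst: "\<And>p. \<exists>j<k. f j \<noteq> p"
  shows "k - 2 \<le> card {(i, j). i < k \<and> j < k \<and> f i \<noteq> i \<and> f j \<noteq> f i}"
proof -
  define p where "p = f i0"
  define F where "F = {i. i < k \<and> f i = p}"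
  define G where "G = {j. j < k \<and> f j \<noteq> p}"
  have fin: "finite F" "finite G" by (auto simp: F_def G_def)
  have FG: "card F + card G = k"
  proof -
    have "card (F \<union> G) = card F + card G" by (rule card_Un_disjoint) (auto simp: fin F_def G_def)
    moreover have "F \<union> G = {..<k}" by (auto simp: F_def G_def)
    ultimately show ?thesis by simp
  qed
  have G1: "card G \<ge> 1" using nonconst[of p] fin by (auto simp: G_def Suc_le_eq card_gt_0_iff)
  have i0F: "i0 \<in> F - {p}" using i0 by (auto simp: F_def p_def)
  have F1: "card (F - {p}) \<ge> 1" using i0F fin by (metis Suc_le_eq One_nat_def card_gt_0_iff empty_iff finite_Diff)
  have F2: "card (F - {p}) \<ge> card F - 1" using fin by (simp add: card_Diff_singleton_if)
  \<comment> \<open>Removing \<open>p\<close> drops the only index of \<open>F\<close> that equals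
    its own dominant role. A class of size one is treated apart because
    \<open>(card F - 1) * card G\<close> would vanish; there \<open>F\<close> consists of
    \<open>i0\<close>, which differs from \<open>p\<close>.\<close>
  have "k - 2 \<le> card (F - {p}) * card G"
  proof (cases "card F \<le> 1")
    case True
    have "k - 2 \<le> 1 * card G" using FG True by simp
    also have "\<dots> \<le> card (F - {p}) * card G" using F1 by (intro mult_right_mono) auto
    finally show ?thesis .
  next
    case False
    define a b where "a = card F - 2" and "b = card G - 1"
    have ab: "card F - 1 = a + 1" "card G = b + 1" "k - 2 = a + b + 1"
      using False G1 FG by (auto simp: a_def b_def)
    have "k - 2 \<le> (card F - 1) * card G" unfolding ab by simp
    also have "\<dots> \<le> card (F - {p}) * card G" using F2 by (intro mult_right_mono) auto
    finally show ?thesis .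
  qed
  also have "\<dots> = card ((F - {p}) \<times> G)" by (simp add: card_cartesian_product)
  also have "\<dots> \<le> card {(i, j). i < k \<and> j < k \<and> f i \<noteq> i \<and> f j \<noteq> f i}"
    by (rule card_mono, rule finite_subset[of _ "{..<k} \<times> {..<k}"]) (auto simp: F_def G_def)
  finally show ?thesis .
qed

text \<open>The function \<open>t (D - t)^2\<close> is not concave on all of \<open>[0, D]\<close>,
  so Jensen does not apply. Its tangent at the mean \<open>m\<close> still lies above it wherever
  \<open>t + 2 m <= 2 D\<close>, which follows from \<open>t <= 3 m <= D\<close>.\<close>

lemma sum_mult_square_le:
  fixes w :: "'a \<Rightarrow> real"
  assumes J: "finite J" "card J = 3" and w: "\<And>j. j \<in> J \<Longrightarrow> 0 \<le> w j" and D: "sum w J \<le> D"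
  shows "(\<Sum>j\<in>J. w j * (D - w j) ^ 2) \<le> sum w J * (D - sum w J / 3) ^ 2"
proof -
  define m where "m = sum w J / 3"
  have sm: "sum w J = 3 * m" by (simp add: m_def)
  have m0: "0 \<le> m" using w by (simp add: m_def sum_nonneg)
  have tangent: "w j * (D - w j) ^ 2 \<le> m * (D - m) ^ 2 + ((D - m) ^ 2 - 2 * m * (D - m)) * (w j - m)"
    if j: "j \<in> J" for j
  proof -
    have "w j \<le> 3 * m" using member_le_sum[of j J w] J j w sm by simp
    then have "(w j - m) ^ 2 * (w j + 2 * m - 2 * D) \<le> 0" using D sm m0 by (intro mult_nonneg_nonpos) auto
    moreover have "w j * (D - w j) ^ 2 - (m * (D - m) ^ 2 + ((D - m) ^ 2 - 2 * m * (D - m)) * (w j - m))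
        = (w j - m) ^ 2 * (w j + 2 * m - 2 * D)"
      by (simp add: power2_eq_square algebra_simps)
    ultimately show ?thesis by linarith
  qed
  have "(\<Sum>j\<in>J. w j * (D - w j) ^ 2)
      \<le> (\<Sum>j\<in>J. m * (D - m) ^ 2 + ((D - m) ^ 2 - 2 * m * (D - m)) * (w j - m))"
    by (rule sum_mono) (rule tangent)
  also have "\<dots> = 3 * m * (D - m) ^ 2 + ((D - m) ^ 2 - 2 * m * (D - m)) * (\<Sum>j\<in>J. w j - m)"
    by (simp add: sum.distrib J sum_distrib_left)
  also have "(\<Sum>j\<in>J. w j - m) = 0" by (simp add: sum_subtractf J sm)
  finally show ?thesis by (simp add: sm)
qed

text \<open>For a fixed vertex, \<open>i\<close> is a minority role that it plays,
  \<open>nn i j\<close> and \<open>w i j\<close> count the neighbours and the strays that answer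
  with role \<open>j\<close>, and \<open>E\<close> is the whole minority budget. The left side
  places a stray at \<open>j\<close> and arbitrary neighbours elsewhere; AM-GM bounds these free
  choices.\<close>

lemma cross_sum_le:
  fixes w nn :: "nat \<Rightarrow> nat \<Rightarrow> real"
  assumes k: "4 \<le> k" and I: "I \<subseteq> {..<k}"
    and w: "\<And>i j. i \<in> I \<Longrightarrow> j \<in> {..<k} - {i} \<Longrightarrow> 0 \<le> w i j \<and> w i j \<le> nn i j"
    and E: "(\<Sum>i\<in>I. \<Sum>j\<in>{..<k} - {i}. nn i j) \<le> E"
  shows "(\<Sum>i\<in>I. \<Sum>j\<in>{..<k} - {i}. w i j * (\<Prod>l\<in>{..<k} - {i} - {j}. nn i l))
      \<le> cross_bound k E (\<Sum>i\<in>I. \<Sum>j\<in>{..<k} - {i}. w i j)"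
proof -
  define J where "J i = {..<k} - {i}" for i
  define S where "S i = (\<Sum>j\<in>J i. w i j)" for i
  define N where "N i = (\<Sum>j\<in>J i. nn i j)" for i
  define s where "s = (\<Sum>i\<in>I. S i)"
  have finI: "finite I" using I finite_subset by blast
  have finJ: "finite (J i)" for i by (simp add: J_def)
  have nn0: "0 \<le> nn i j" if "i \<in> I" "j \<in> J i" for i j using w[of i j] that by (auto simp: J_def)
  have w0: "0 \<le> w i j" "w i j \<le> nn i j" if "i \<in> I" "j \<in> J i" for i j using w[of i j] that by (auto simp: J_def)
  have S0: "0 \<le> S i" if "i \<in> I" for i unfolding S_def by (rule sum_nonneg) (use w0 that in auto)
  have SN: "S i \<le> N i" if "i \<in> I" for i unfolding S_def N_def by (rule sum_mono) (use w0 that in auto)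
  have NE: "N i + (s - S i) \<le> E" if i: "i \<in> I" for i
  proof -
    have "s = S i + (\<Sum>i\<in>I - {i}. S i)" unfolding s_def using finI i by (rule sum.remove)
    moreover have "(\<Sum>i\<in>I. N i) = N i + (\<Sum>i\<in>I - {i}. N i)" using finI i by (rule sum.remove)
    moreover have "(\<Sum>i\<in>I - {i}. S i) \<le> (\<Sum>i\<in>I - {i}. N i)" by (rule sum_mono) (use SN in auto)
    ultimately show ?thesis using E by (simp add: N_def J_def)
  qed
  have sS: "S i \<le> s" if "i \<in> I" for i unfolding s_def by (rule member_le_sum) (use that finI S0 in auto)
  have prod: "(\<Prod>l\<in>J i - {j}. nn i l) \<le> ((N i - w i j) / (real k - 2)) ^ (k - 2)"
    if ij: "i \<in> I" "j \<in> J i" for i j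
  proof -
    have c: "card (J i - {j}) = k - 2" using ij I by (auto simp: J_def)
    have "(\<Prod>l\<in>J i - {j}. nn i l) \<le> ((\<Sum>l\<in>J i - {j}. nn i l) / real (k - 2)) ^ (k - 2)"
      using prod_le_mean_power[of "J i - {j}" "nn i"] nn0 ij finJ c by simp
    also have "(\<Sum>l\<in>J i - {j}. nn i l) = N i - nn i j" using ij finJ by (simp add: N_def sum.remove[of _ j])
    also have "((N i - nn i j) / real (k - 2)) ^ (k - 2) \<le> ((N i - w i j) / real (k - 2)) ^ (k - 2)"
    proof (intro power_mono divide_right_mono)
      have "nn i j \<le> N i" unfolding N_def by (rule member_le_sum) (use ij nn0 finJ in auto)
      then show "0 \<le> (N i - nn i j) / real (k - 2)" by simp
    qed (use w0 ij in auto)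
    finally show ?thesis using k by (simp add: of_nat_diff)
  qed
  have "(\<Sum>i\<in>I. \<Sum>j\<in>J i. w i j * (\<Prod>l\<in>J i - {j}. nn i l)) \<le> cross_bound k E s"
  proof (cases "k = 4")
    case False
    have "(\<Sum>i\<in>I. \<Sum>j\<in>J i. w i j * (\<Prod>l\<in>J i - {j}. nn i l))
        \<le> (\<Sum>i\<in>I. \<Sum>j\<in>J i. w i j * (E / (real k - 2)) ^ (k - 2))"
    proof (intro sum_mono mult_left_mono)
      fix i j assume ij: "i \<in> I" "j \<in> J i"
      have "w i j \<le> N i"
        using w0[OF ij] member_le_sum[of j "J i" "nn i"] ij nn0 finJ by (force simp: N_def)
      then have "((N i - w i j) / (real k - 2)) ^ (k - 2) \<le> (E / (real k - 2)) ^ (k - 2)"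
        using k w0[OF ij] NE[OF ij(1)] sS[OF ij(1)] by (intro power_mono divide_right_mono) auto
      with prod[OF ij] show "(\<Prod>l\<in>J i - {j}. nn i l) \<le> (E / (real k - 2)) ^ (k - 2)" by linarith
    qed (use w0 in auto)
    also have "\<dots> = s * (E / (real k - 2)) ^ (k - 2)" by (simp add: s_def S_def sum_distrib_right)
    finally show ?thesis using False by (simp add: cross_bound_def)
  next
    case True
    have "(\<Sum>j\<in>J i. w i j * (\<Prod>l\<in>J i - {j}. nn i l)) \<le> S i * (E - s / 3) ^ 2 / 4" if i: "i \<in> I" for i
    proof -
      \<comment> \<open>The strays of the other roles already use up \<open>s - S i\<close> of the
        budget. Keeping track of this is the gain over the formula for larger
        \<open>k\<close>.\<close>
      define D where "D = E - (s - S i)"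
      have ND: "N i \<le> D" using NE[OF i] by (simp add: D_def)
      have "(\<Sum>j\<in>J i. w i j * (\<Prod>l\<in>J i - {j}. nn i l)) \<le> (\<Sum>j\<in>J i. w i j * (D - w i j) ^ 2 / 4)"
      proof (rule sum_mono)
        fix j assume j: "j \<in> J i"
        have "w i j \<le> N i"
          using w0[OF i j] member_le_sum[of j "J i" "nn i"] i j nn0 finJ by (force simp: N_def)
        then have "((N i - w i j) / 2) ^ 2 \<le> ((D - w i j) / 2) ^ 2" using ND by (intro power_mono) auto
        then have "(\<Prod>l\<in>J i - {j}. nn i l) \<le> (D - w i j) ^ 2 / 4"
          using prod[OF i j] True by (simp add: power_divide)
        then have "w i j * (\<Prod>l\<in>J i - {j}. nn i l) \<le> w i j * ((D - w i j) ^ 2 / 4)"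
          using w0[OF i j] by (intro mult_left_mono) auto
        then show "w i j * (\<Prod>l\<in>J i - {j}. nn i l) \<le> w i j * (D - w i j) ^ 2 / 4" by simp
      qed
      also have "\<dots> \<le> S i * (D - S i / 3) ^ 2 / 4"
      proof -
        have "card (J i) = 3" using True i I by (auto simp: J_def)
        then have "(\<Sum>j\<in>J i. w i j * (D - w i j) ^ 2) \<le> S i * (D - S i / 3) ^ 2"
          unfolding S_def using finJ w0[OF i] SN[OF i] ND by (intro sum_mult_square_le) (auto simp: S_def)
        then show ?thesis by (simp flip: sum_divide_distrib)
      qed
      also have "\<dots> \<le> S i * (E - s / 3) ^ 2 / 4"
      proof -
        have "(D - S i / 3) ^ 2 \<le> (E - s / 3) ^ 2"
          using SN[OF i] ND S0[OF i] sS[OF i] by (intro power_mono) (auto simp: D_def)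
        then show ?thesis using S0[OF i] by (intro divide_right_mono mult_left_mono) auto
      qed
      finally show ?thesis .
    qed
    then have "(\<Sum>i\<in>I. \<Sum>j\<in>J i. w i j * (\<Prod>l\<in>J i - {j}. nn i l)) \<le> (\<Sum>i\<in>I. S i * (E - s / 3) ^ 2 / 4)"
      by (rule sum_mono)
    also have "\<dots> = s / 4 * (E - s / 3) ^ 2"
      by (simp add: s_def flip: sum_distrib_right sum_divide_distrib)
    finally show ?thesis using True by (simp add: cross_bound_def)
  qed
  then show ?thesis by (simp add: J_def s_def S_def)
qed

text \<open>Applied to part sizes \<open>x q\<close> from which \<open>t q\<close> strays are
  removed. Measuring every removal against the largest part \<open>X\<close> separates the sizes
  from the removals, and by AM-GM only the total removed matters.\<close>

lemma prod_diff_le: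
  fixes x t :: "'a \<Rightarrow> real"
  assumes J: "finite J" "J \<noteq> {}" and X: "0 < X"
    and t: "\<And>q. q \<in> J \<Longrightarrow> 0 \<le> t q \<and> t q \<le> x q \<and> x q \<le> X"
  shows "(\<Prod>q\<in>J. x q - t q) \<le> prod x J * (1 - sum t J / (real (card J) * X)) ^ card J"
proof -
  have "(\<Prod>q\<in>J. x q - t q) \<le> (\<Prod>q\<in>J. x q * (1 - t q / X))"
  proof (rule prod_mono, safe)
    fix q assume q: "q \<in> J"
    show "0 \<le> x q - t q" using t[OF q] by simp
    have "x q / X \<le> 1" using t[OF q] X by simp
    then have "t q * (x q / X) \<le> t q * 1" using t[OF q] by (intro mult_left_mono) auto
    then show "x q - t q \<le> x q * (1 - t q / X)" by (simp add: algebra_simps)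
  qed
  also have "\<dots> = prod x J * (\<Prod>q\<in>J. 1 - t q / X)" by (rule prod.distrib)
  also have "\<dots> \<le> prod x J * ((\<Sum>q\<in>J. 1 - t q / X) / card J) ^ card J"
  proof (rule mult_left_mono)
    have "0 \<le> 1 - t q / X" if "q \<in> J" for q using t[OF that] X by simp
    then show "(\<Prod>q\<in>J. 1 - t q / X) \<le> ((\<Sum>q\<in>J. 1 - t q / X) / card J) ^ card J"
      by (rule prod_le_mean_power[OF J(1)])
    show "0 \<le> prod x J" by (rule prod_nonneg) (use t in force)
  qed
  also have "(\<Sum>q\<in>J. 1 - t q / X) / card J = 1 - sum t J / (real (card J) * X)"
  proof -
    have "card J > 0" using J by (simp add: card_gt_0_iff)
    then show ?thesis using X by (simp add: sum_subtractf diff_divide_distrib flip: sum_divide_distrib)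
  qed
  finally show ?thesis .
qed

lemma cross_bound_scale:
  assumes "0 < n" "4 \<le> k"
  shows "cross_bound k (e * n) s = n ^ (k - 1) * cross_bound k e (s / n)"
proof (cases "k = 4")
  case True
  have "e * n - s / 3 = n * (e - s / n / 3)" using assms by (simp add: field_simps)
  then have "(e * n - s / 3) ^ 2 = n ^ 2 * (e - s / n / 3) ^ 2" by (simp add: power_mult_distrib)
  then show ?thesis using True assms by (simp add: cross_bound_def power2_eq_square power3_eq_cube)
next
  case False
  have "k - 1 = Suc (k - 2)" using assms by simp
  then show ?thesis using False assms by (simp add: cross_bound_def power_divide power_mult_distrib)
qed

lemma main_gap_pos:
  assumes k: "4 \<le> k"
  shows "0 < 1 / (real k ^ k - real k) - (minority_bound k / (real k - 1)) ^ (k - 1)"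
proof -
  consider "k = 4" | "k = 5" | (6) "6 \<le> k" using k by linarith
  then show ?thesis
  proof cases
    case 6
    have "0 < real k * (real k - 1) * (minority_bound k / (real k - 2)) ^ (k - 2)"
      using 6 minority_bound_pos[of k] by (intro mult_pos_pos zero_less_power divide_pos_pos) auto
    then have "0 < (real k - 2) * (4 * (1 / (real k ^ k - real k) - (minority_bound k / (real k - 1)) ^ (k - 1)))"
      using large_uniformity_gap[OF 6] by (rule less_le_trans)
    then show ?thesis using 6 by (simp add: zero_less_mult_iff)
  qed (auto simp: minority_bound_def power_divide)
qed

section \<open>The partition by dominant roles, its strays, and the final count\<close>

context critical_structure
begin

definition dom :: "'a \<Rightarrow> nat" where
  "dom v = (SOME p. p < k \<and> real (card {w \<in> V - {v}. R v w \<noteq> p}) \<le> e * n)"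

lemma dom:
  assumes "v \<in> V"
  shows "dom v < k" "real (card {w \<in> V - {v}. R v w \<noteq> dom v}) \<le> e * n"
  using someI_ex[OF exists_dominant[OF assms]] by (auto simp: dom_def)

definition part :: "nat \<Rightarrow> 'a set" where "part q = {v \<in> V. dom v = q}"

definition main :: "(nat \<Rightarrow> 'a) set" where "main = PiE {..<k} part"

definition cross :: "(nat \<Rightarrow> 'a) set" where
  "cross = {x \<in> C. (\<exists>i<k. dom (x i) \<noteq> i) \<and> (\<forall>p. \<exists>i<k. dom (x i) \<noteq> p)}"

text \<open>For \<open>i\<close> other than \<open>dom u\<close>, a transversal tuple with
  \<open>u\<close> and its stray in the places of their parts is not a copy: it would need
  \<open>u\<close> to play \<open>dom u\<close> towards the stray, but \<open>u\<close> plays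
  \<open>i\<close>.\<close>

definition stray :: "'a \<Rightarrow> nat \<Rightarrow> nat \<Rightarrow> 'a set" where
  "stray u i j = {w \<in> nbr u i j. dom w \<noteq> dom u}"

definition strays :: "'a \<Rightarrow> 'a set" where
  "strays u = (\<Union>i\<in>{..<k} - {dom u}. \<Union>j\<in>{..<k} - {i}. stray u i j)"

lemma finite_part [simp]: "finite (part q)" using fin by (simp add: part_def)
lemma finite_stray [simp]: "finite (stray u i j)" using fin by (simp add: stray_def)
lemma finite_strays [simp]: "finite (strays u)" by (simp add: strays_def)
lemma finite_main [simp]: "finite main" by (simp add: main_def finite_PiE)
lemma finite_C [simp]: "finite C" using fin by (rule finite_copies)

lemma n_pos: "0 < n"
proof -
  have "C \<noteq> {}" using exceeds denominator_pos by (intro notI) (auto simp: divide_less_0_iff)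
  then obtain x where "x \<in> C" by blast
  then have "x 0 \<in> V" using k copiesD(1)[of x k R V 0] by simp
  then show ?thesis using fin by (auto simp: card_gt_0_iff)
qed

lemma sum_minority_le:
  assumes u: "u \<in> V"
  shows "(\<Sum>i\<in>{..<k} - {dom u}. real (card (playing u i))) \<le> e * n"
proof -
  have "(\<Sum>i\<in>{..<k} - {dom u}. card (playing u i)) \<le> card {w \<in> V - {u}. R u w \<in> {..<k} - {dom u}}"
    by (rule sum_card_playing_le) simp
  also have "\<dots> \<le> card {w \<in> V - {u}. R u w \<noteq> dom u}" by (rule card_mono) (auto simp: fin)
  finally have "real (\<Sum>i\<in>{..<k} - {dom u}. card (playing u i)) \<le> real (card {w \<in> V - {u}. R u w \<noteq> dom u})"
    by (rule of_nat_mono)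
  with dom(2)[OF u] show ?thesis by simp
qed

lemma card_main: "card main = (\<Prod>q<k. card (part q))"
  by (simp add: main_def card_PiE)

text \<open>Every copy outside \<open>main\<close> has a vertex that plays a role other than its
  dominant one. Such a vertex plays minority roles towards at most \<open>e * n\<close> others, so
  through each vertex there are at most \<open>(e n / (k - 1))^(k - 1)\<close> of these copies, and
  \<open>main\<close> must make up for the rest of \<open>C\<close>.\<close>

lemma main_large:
  "n ^ k * (1 / (real k ^ k - real k) - (e / (real k - 1)) ^ (k - 1)) < (\<Prod>q<k. real (card (part q)))"
proof -
  define T where "T u = (\<Union>i\<in>{..<k} - {dom u}. {x \<in> C. x i = u})" for u
  have "C \<subseteq> main \<union> (\<Union>u\<in>V. T u)"
  proof
    fix x assume x: "x \<in> C"
    show "x \<in> main \<union> (\<Union>u\<in>V. T u)"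
    proof (cases "\<forall>i<k. dom (x i) = i")
      case True
      then have "x \<in> main" using x copiesD(1)[OF x] by (auto simp: main_def part_def copies_def PiE_iff)
      then show ?thesis by blast
    next
      case False
      then obtain i where "i < k" "dom (x i) \<noteq> i" by blast
      then have "x \<in> T (x i)" "x i \<in> V" using x copiesD(1)[OF x] by (auto simp: T_def)
      then show ?thesis by blast
    qed
  qed
  then have "card C \<le> card (main \<union> (\<Union>u\<in>V. T u))"
    by (rule card_mono[rotated]) (auto simp: T_def fin)
  also have "\<dots> \<le> card main + card (\<Union>u\<in>V. T u)" by (rule card_Un_le)
  also have "card (\<Union>u\<in>V. T u) \<le> (\<Sum>u\<in>V. card (T u))" by (rule card_UN_le[OF fin])
  finally have "card C \<le> card main + (\<Sum>u\<in>V. card (T u))" by simp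
  then have A: "real (card C) \<le> real (card main) + (\<Sum>u\<in>V. real (card (T u)))"
    by (simp only: of_nat_le_iff flip: of_nat_add of_nat_sum)
  have "real (card (T u)) \<le> (e * n / (real k - 1)) ^ (k - 1)" if u: "u \<in> V" for u
  proof -
    have "card (T u) \<le> (\<Sum>i\<in>{..<k} - {dom u}. card {x \<in> C. x i = u})"
      unfolding T_def by (rule card_UN_le) simp
    then have "real (card (T u)) \<le> real (\<Sum>i\<in>{..<k} - {dom u}. card {x \<in> C. x i = u})" by (rule of_nat_mono)
    also have "\<dots> = (\<Sum>i\<in>{..<k} - {dom u}. real (card {x \<in> C. x i = u}))" by simp
    also have "\<dots> \<le> (\<Sum>i\<in>{..<k} - {dom u}. (real (card (playing u i)) / (real k - 1)) ^ (k - 1))"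
      by (rule sum_mono) (use card_copies_through_le in auto)
    also have "\<dots> \<le> (\<Sum>i\<in>{..<k} - {dom u}. real (card (playing u i)) / (real k - 1)) ^ (k - 1)"
      using k by (intro sum_power_le_power_sum) auto
    also have "\<dots> \<le> (e * n / (real k - 1)) ^ (k - 1)"
      using sum_minority_le[OF u] k
      by (intro power_mono sum_nonneg) (auto intro!: divide_right_mono simp flip: sum_divide_distrib)
    finally show ?thesis .
  qed
  then have "(\<Sum>u\<in>V. real (card (T u))) \<le> n * (e * n / (real k - 1)) ^ (k - 1)"
    using sum_mono[of V "\<lambda>u. real (card (T u))" "\<lambda>_. (e * n / (real k - 1)) ^ (k - 1)"] by simp
  also have "\<dots> = n ^ k * (e / (real k - 1)) ^ (k - 1)"
  proof -
    obtain K where K: "k = Suc K" using k by (cases k) auto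
    show ?thesis by (simp add: K power_mult_distrib power_divide)
  qed
  finally show ?thesis using A exceeds by (simp add: card_main algebra_simps)
qed

lemma sum_card_part: "(\<Sum>q<k. card (part q)) = card V"
proof -
  have "(\<Sum>q<k. card (part q)) = card (\<Union>q<k. part q)"
    by (rule card_UN_disjoint[symmetric]) (auto simp: part_def fin)
  also have "(\<Union>q<k. part q) = V" using dom(1) by (auto simp: part_def)
  finally show ?thesis .
qed

text \<open>Needed to apply \<open>IH\<close> inside the parts. If one part were everything, another
  would be empty and with it \<open>main\<close>.\<close>

lemma part_psubset:
  assumes "p < k"
  shows "part p \<subset> V"
proof (rule ccontr)
  assume "\<not> ?thesis"
  then have pV: "part p = V" by (auto simp: part_def)
  define q where "q = (if p = 0 then 1 else 0 :: nat)"
  have "dom v = p" if "v \<in> V" for v using that pV by (auto simp: part_def)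
  then have "part q = {}" by (auto simp: part_def q_def)
  then have z: "(\<Prod>q<k. real (card (part q))) = 0" using k by (intro prod_zero) (auto simp: q_def intro!: bexI[of _ q])
  have "0 < n ^ k * (1 / (real k ^ k - real k) - (e / (real k - 1)) ^ (k - 1))"
    using main_gap_pos[OF k] n_pos by (intro mult_pos_pos zero_less_power)
  then show False using main_large z by linarith
qed

lemma card_C_le:
  "card C \<le> card (C \<inter> main) + (\<Sum>p<k. card (copies k R (part p))) + card cross"
proof -
  have "C \<subseteq> C \<inter> main \<union> (\<Union>p<k. copies k R (part p)) \<union> cross"
  proof
    fix x assume x: "x \<in> C"
    consider "\<forall>i<k. dom (x i) = i" | p where "\<forall>i<k. dom (x i) = p" | "x \<in> cross"
      using x by (auto simp: cross_def)
    then show "x \<in> C \<inter> main \<union> (\<Union>p<k. copies k R (part p)) \<union> cross"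
    proof cases
      case 1
      then have "x \<in> main" using x copiesD(1)[OF x] by (auto simp: main_def part_def copies_def PiE_iff)
      then show ?thesis using x by blast
    next
      case 2
      have "p < k" using 2 dom(1)[OF copiesD(1)[OF x, of 0]] k by auto
      moreover have "x \<in> copies k R (part p)"
        using 2 x copiesD(1)[OF x] by (auto simp: part_def copies_def PiE_iff)
      ultimately show ?thesis by blast
    qed auto
  qed
  then have "card C \<le> card (C \<inter> main \<union> (\<Union>p<k. copies k R (part p)) \<union> cross)"
    by (rule card_mono[rotated]) (auto simp: finite_copies cross_def)
  also have "\<dots> \<le> card (C \<inter> main \<union> (\<Union>p<k. copies k R (part p))) + card cross" by (rule card_Un_le)
  also have "card (C \<inter> main \<union> (\<Union>p<k. copies k R (part p)))
      \<le> card (C \<inter> main) + card (\<Union>p<k. copies k R (part p))" by (rule card_Un_le)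
  also have "card (\<Union>p<k. copies k R (part p)) \<le> (\<Sum>p<k. card (copies k R (part p)))" by (rule card_UN_le) simp
  finally show ?thesis by simp
qed

text \<open>Counts the copies in \<open>cross\<close> together with one of their stray pairs
  \<open>(i, j)\<close>, of which \<open>card_stray_pairs_ge\<close> provides \<open>k - 2\<close>,
  and sorts them by the vertex \<open>u = x i\<close>.\<close>

lemma cross_le_stray_tuples:
  "(k - 2) * card cross \<le> (\<Sum>u\<in>V. \<Sum>i\<in>{..<k} - {dom u}. \<Sum>j\<in>{..<k} - {i}.
      card {x \<in> C. x i = u \<and> x j \<in> stray u i j})"
proof -
  define B where "B x = {(i, j). i < k \<and> j < k \<and> dom (x i) \<noteq> i \<and> dom (x j) \<noteq> dom (x i)}" for x :: "nat \<Rightarrow> 'a"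
  define T where "T = (SIGMA x:cross. B x)"
  define U where "U = (SIGMA u:V. SIGMA i:{..<k} - {dom u}. SIGMA j:{..<k} - {i}.
      {x \<in> C. x i = u \<and> x j \<in> stray u i j})"
  have finB: "finite (B x)" for x
    by (rule finite_subset[of _ "{..<k} \<times> {..<k}"]) (auto simp: B_def)
  have fcr: "finite cross" by (simp add: cross_def)
  have "(k - 2) * card cross = (\<Sum>x\<in>cross. k - 2)" by simp
  also have "\<dots> \<le> (\<Sum>x\<in>cross. card (B x))"
    unfolding B_def by (rule sum_mono) (auto simp: cross_def intro: card_stray_pairs_ge)
  also have "\<dots> = card T" unfolding T_def using fcr finB by (simp add: card_SigmaI)
  also have "\<dots> \<le> card U"
  proof (rule card_inj_on_le)
    let ?f = "\<lambda>(x, i, j). (x i, i, j, x)"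
    show "inj_on ?f T" by (auto simp: inj_on_def)
    show "finite U" unfolding U_def by (intro finite_SigmaI) (auto simp: fin)
    show "?f ` T \<subseteq> U"
    proof
      fix y assume "y \<in> ?f ` T"
      then obtain x i j where y: "y = (x i, i, j, x)" and x: "x \<in> C" and
        ij: "i < k" "j < k" "dom (x i) \<noteq> i" "dom (x j) \<noteq> dom (x i)"
        by (auto simp: T_def B_def cross_def)
      then have "j \<noteq> i" by auto
      then show "y \<in> U" using y x ij copiesD[OF x, of i] copiesD[OF x, of j]
        by (auto simp: U_def stray_def nbr_def)
    qed
  qed
  also have "\<dots> = (\<Sum>u\<in>V. \<Sum>i\<in>{..<k} - {dom u}. \<Sum>j\<in>{..<k} - {i}.
      card {x \<in> C. x i = u \<and> x j \<in> stray u i j})"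
    unfolding U_def by (subst card_SigmaI; (simp add: fin)?)+
  finally show ?thesis .
qed

lemma card_stray_tuples_le:
  assumes ij: "i < k" "j < k" "j \<noteq> i"
  shows "card {x \<in> C. x i = u \<and> x j \<in> stray u i j}
      \<le> card (stray u i j) * (\<Prod>l\<in>{..<k} - {i} - {j}. card (nbr u i l))"
proof -
  let ?A = "\<lambda>l. if l = j then stray u i j else nbr u i l"
  have "card {x \<in> C. x i = u \<and> x j \<in> stray u i j} \<le> (\<Prod>l\<in>{..<k} - {i}. card (?A l))"
  proof (rule card_tuples_le_prod[OF _ ij(1)])
    show "{x \<in> C. x i = u \<and> x j \<in> stray u i j} \<subseteq> {..<k} \<rightarrow>\<^sub>E V" by (auto simp: copies_def)
    fix x l assume x: "x \<in> {x \<in> C. x i = u \<and> x j \<in> stray u i j}"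
    have "x l \<in> nbr u i l" if "l < k" "l \<noteq> i"
      using x that ij by (auto simp: nbr_def dest: copiesD)
    then show "x i = u \<and> (l < k \<longrightarrow> l \<noteq> i \<longrightarrow> x l \<in> ?A l)" using x by auto
  qed simp
  also have "\<dots> = card (?A j) * (\<Prod>l\<in>{..<k} - {i} - {j}. card (?A l))"
    using ij by (intro prod.remove) auto
  also have "(\<Prod>l\<in>{..<k} - {i} - {j}. card (?A l)) = (\<Prod>l\<in>{..<k} - {i} - {j}. card (nbr u i l))"
    by (rule prod.cong) auto
  finally show ?thesis by simp
qed

lemma card_strays: "card (strays u) = (\<Sum>i\<in>{..<k} - {dom u}. \<Sum>j\<in>{..<k} - {i}. card (stray u i j))"
proof -
  have "card (\<Union>j\<in>{..<k} - {i}. stray u i j) = (\<Sum>j\<in>{..<k} - {i}. card (stray u i j))" for i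
    by (rule card_UN_disjoint) (auto simp: stray_def nbr_def fin)
  moreover have "card (strays u) = (\<Sum>i\<in>{..<k} - {dom u}. card (\<Union>j\<in>{..<k} - {i}. stray u i j))"
    unfolding strays_def by (rule card_UN_disjoint) (auto simp: stray_def nbr_def fin)
  ultimately show ?thesis by simp
qed

lemma stray_tuples_le:
  assumes u: "u \<in> V"
  shows "real (\<Sum>i\<in>{..<k} - {dom u}. \<Sum>j\<in>{..<k} - {i}. card {x \<in> C. x i = u \<and> x j \<in> stray u i j})
      \<le> cross_bound k (e * n) (card (strays u))"
proof -
  let ?I = "{..<k} - {dom u}"
  have "(\<Sum>i\<in>?I. \<Sum>j\<in>{..<k} - {i}. card {x \<in> C. x i = u \<and> x j \<in> stray u i j})
      \<le> (\<Sum>i\<in>?I. \<Sum>j\<in>{..<k} - {i}. card (stray u i j) * (\<Prod>l\<in>{..<k} - {i} - {j}. card (nbr u i l)))"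
    by (intro sum_mono card_stray_tuples_le) auto
  then have "real (\<Sum>i\<in>?I. \<Sum>j\<in>{..<k} - {i}. card {x \<in> C. x i = u \<and> x j \<in> stray u i j})
      \<le> real (\<Sum>i\<in>?I. \<Sum>j\<in>{..<k} - {i}. card (stray u i j) * (\<Prod>l\<in>{..<k} - {i} - {j}. card (nbr u i l)))"
    by (rule of_nat_mono)
  also have "\<dots> = (\<Sum>i\<in>?I. \<Sum>j\<in>{..<k} - {i}. real (card (stray u i j)) *
      (\<Prod>l\<in>{..<k} - {i} - {j}. real (card (nbr u i l))))" by simp
  also have "\<dots> \<le> cross_bound k (e * n) (\<Sum>i\<in>?I. \<Sum>j\<in>{..<k} - {i}. real (card (stray u i j)))"
  proof (rule cross_sum_le[OF k])
    show "0 \<le> real (card (stray u i j)) \<and> real (card (stray u i j)) \<le> real (card (nbr u i j))" for i j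
      by (auto simp: stray_def intro!: card_mono)
    have "(\<Sum>i\<in>?I. \<Sum>j\<in>{..<k} - {i}. real (card (nbr u i j))) \<le> (\<Sum>i\<in>?I. real (card (playing u i)))"
      using sum_card_nbr_le by (intro sum_mono) (simp only: of_nat_le_iff flip: of_nat_sum)
    also have "\<dots> \<le> e * n" by (rule sum_minority_le[OF u])
    finally show "(\<Sum>i\<in>?I. \<Sum>j\<in>{..<k} - {i}. real (card (nbr u i j))) \<le> e * n" .
  qed auto
  finally show ?thesis by (simp add: card_strays)
qed

definition missed :: "'a \<Rightarrow> (nat \<Rightarrow> 'a) set" where
  "missed u = {x \<in> main. x (dom u) = u \<and> (\<exists>q<k. q \<noteq> dom u \<and> x q \<in> strays u)}"

lemma missedD: "x \<in> missed u \<Longrightarrow> x (dom u) = u"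
  by (simp add: missed_def)

text \<open>A tuple missed by \<open>u\<close> has \<open>u\<close> itself at coordinate
  \<open>dom u\<close>, so each coordinate charges the tuple at most once; this gives the factor
  \<open>k\<close>. The tuple is not a copy because \<open>u\<close> does not play
  \<open>dom u\<close> towards its stray.\<close>

lemma sum_missed_le: "(\<Sum>u\<in>V. card (missed u)) \<le> k * card (main - C)"
proof -
  have "(\<Sum>u\<in>V. card (missed u)) = card (SIGMA u:V. missed u)"
    using fin by (simp add: card_SigmaI missed_def)
  also have "\<dots> \<le> card ({..<k} \<times> (main - C))"
  proof (rule card_inj_on_le)
    let ?f = "\<lambda>(u, x). (dom u, x)"
    show "inj_on ?f (SIGMA u:V. missed u)"
    proof (rule inj_onI)
      fix a b assume "a \<in> (SIGMA u:V. missed u)" "b \<in> (SIGMA u:V. missed u)" and eq: "?f a = ?f b"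
      then obtain u x v y where ab: "a = (u, x)" "b = (v, y)" "x \<in> missed u" "y \<in> missed v" by blast
      have xy: "x = y" "dom u = dom v" using eq ab by simp_all
      have "u = v" using missedD[OF ab(3)] missedD[OF ab(4)] unfolding xy by (rule trans[OF sym])
      then show "a = b" using ab xy by blast
    qed
    show "finite ({..<k} \<times> (main - C))" by simp
    have "x \<notin> C" if u: "u \<in> V" and x: "x \<in> missed u" for u x
    proof
      assume xC: "x \<in> C"
      obtain q where q: "q < k" "q \<noteq> dom u" "x q \<in> strays u" and xu: "x (dom u) = u"
        using x by (auto simp: missed_def)
      have "R u (x q) = dom u" using copiesD(2)[OF xC, of "dom u" q] dom(1)[OF u] q xu by auto
      then show False using q(3) by (auto simp: strays_def stray_def nbr_def)
    qed
    then show "?f ` (SIGMA u:V. missed u) \<subseteq> {..<k} \<times> (main - C)"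
      using dom(1) by (auto simp: missed_def)
  qed
  finally show ?thesis by (simp add: card_cartesian_product)
qed

lemma card_missed:
  assumes u: "u \<in> V"
  shows "real (card (missed u)) = (\<Prod>q\<in>{..<k} - {dom u}. real (card (part q)))
      - (\<Prod>q\<in>{..<k} - {dom u}. real (card (part q)) - real (card (part q \<inter> strays u)))"
proof -
  let ?A = "\<lambda>q. if q = dom u then {u} else part q"
  let ?B = "\<lambda>q. if q = dom u then {u} else part q - strays u"
  have du: "dom u < k" by (rule dom(1)[OF u])
  have "missed u = PiE {..<k} ?A - PiE {..<k} ?B"
  proof (intro equalityI subsetI)
    fix x assume "x \<in> missed u"
    then show "x \<in> PiE {..<k} ?A - PiE {..<k} ?B"
      using du by (auto simp: missed_def main_def PiE_iff)
  next
    fix x assume x: "x \<in> PiE {..<k} ?A - PiE {..<k} ?B"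
    then have xA: "x \<in> PiE {..<k} ?A" by blast
    then have "x (dom u) \<in> ?A (dom u)" by (rule PiE_mem) (simp add: du)
    then have xu: "x (dom u) = u" by simp
    have xi: "x i \<in> ?A i" if "i < k" for i using PiE_mem[OF xA, of i] that by simp
    have "x i \<in> part i" if "i < k" for i
      using xi[OF that] u by (cases "i = dom u") (simp_all add: part_def)
    then have "x \<in> main" using PiE_ext xA unfolding main_def by (simp add: PiE_def Pi_def)
    moreover have "\<exists>q<k. q \<noteq> dom u \<and> x q \<in> strays u"
    proof (rule ccontr)
      assume "\<not> ?thesis"
      then have "x i \<in> ?B i" if "i < k" for i
        using xi[OF that] that by (cases "i = dom u") auto
      then have "x \<in> PiE {..<k} ?B" using xA by (simp add: PiE_def Pi_def)
      then show False using x by blast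
    qed
    ultimately show "x \<in> missed u" using xu by (simp add: missed_def)
  qed
  moreover have "PiE {..<k} ?B \<subseteq> PiE {..<k} ?A" by (rule PiE_mono) auto
  moreover have "finite (PiE {..<k} ?A)" "finite (PiE {..<k} ?B)" by (intro finite_PiE; simp)+
  ultimately have "real (card (missed u)) = real (card (PiE {..<k} ?A)) - real (card (PiE {..<k} ?B))"
    by (simp add: card_Diff_subset card_mono of_nat_diff)
  moreover have "card (PiE {..<k} ?A) = (\<Prod>q\<in>{..<k} - {dom u}. card (part q))"
    using du by (simp add: card_PiE prod.remove[of "{..<k}" "dom u"] cong: prod.cong_simp)
  moreover have "card (PiE {..<k} ?B) = (\<Prod>q\<in>{..<k} - {dom u}. card (part q - strays u))"
    using du by (simp add: card_PiE prod.remove[of "{..<k}" "dom u"] cong: prod.cong_simp)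
  moreover have "real (card (part q - strays u)) = real (card (part q)) - real (card (part q \<inter> strays u))" for q
    by (simp add: card_Diff_subset_Int card_mono of_nat_diff)
  ultimately show ?thesis by simp
qed

lemma sum_card_part_strays:
  "(\<Sum>q\<in>{..<k} - {dom u}. card (part q \<inter> strays u)) = card (strays u)"
proof -
  have "(\<Sum>q\<in>{..<k} - {dom u}. card (part q \<inter> strays u)) = card (\<Union>q\<in>{..<k} - {dom u}. part q \<inter> strays u)"
    by (rule card_UN_disjoint[symmetric]) (auto simp: part_def)
  also have "(\<Union>q\<in>{..<k} - {dom u}. part q \<inter> strays u) = strays u"
    using dom(1) by (auto simp: part_def strays_def stray_def nbr_def)
  finally show ?thesis .
qed

text \<open>This is \<open>cross_bound_le_missing\<close> rescaled from relative sizes to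
  cardinalities, with \<open>q\<close> a largest part among those not containing
  \<open>u\<close>.\<close>

lemma cross_bound_le_missed:
  assumes u: "u \<in> V"
  shows "real k * cross_bound k (e * n) (card (strays u)) \<le> (real k - 2) * real (card (missed u))"
proof -
  let ?J = "{..<k} - {dom u}"
  define s where "s = real (card (strays u))"
  define c where "c q = real (card (part q))" for q
  define t where "t q = real (card (part q \<inter> strays u))" for q
  have du: "dom u < k" by (rule dom(1)[OF u])
  have cJ: "card ?J = k - 1" using du by simp
  have rk1: "real (k - 1) = real k - 1" using k by (simp add: of_nat_diff)
  have st: "sum t ?J = s"
    using sum_card_part_strays[of u] by (simp add: t_def s_def flip: of_nat_sum)
  have tc: "0 \<le> t q \<and> t q \<le> c q" for q by (auto simp: t_def c_def intro!: card_mono)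
  have "?J \<noteq> {}"
  proof
    assume "?J = {}"
    then have "card ?J = 0" by (simp only: card.empty)
    then show False using cJ k by linarith
  qed
  then obtain q where q: "q \<in> ?J" and qmax: "\<And>i. i \<in> ?J \<Longrightarrow> c i \<le> c q"
    using obtains_MAX[of ?J c] Max_ge[of "c ` ?J"] by (metis finite_Diff finite_imageI finite_lessThan imageI)
  have sX: "s \<le> (real k - 1) * c q"
  proof -
    have "s \<le> (\<Sum>i\<in>?J. c q)" unfolding st[symmetric] using tc qmax by (intro sum_mono) (meson order_trans)
    then show ?thesis using cJ rk1 by simp
  qed
  have s0: "0 \<le> s" by (simp add: s_def)
  show ?thesis
  proof (cases "c q = 0")
    case True
    then have "s = 0" using sX s0 by simp
    then show ?thesis using k by (simp add: cross_bound_def flip: s_def)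
  next
    case False
    then have cq: "0 < c q" by (simp add: c_def card_gt_0_iff)
    have "(\<Prod>i\<in>?J. c i - t i) \<le> prod c ?J * (1 - s / ((real k - 1) * c q)) ^ (k - 1)"
      using prod_diff_le[of ?J "c q" t c] cq tc qmax q cJ st rk1 by auto
    then have m: "prod c ?J * (1 - (1 - s / ((real k - 1) * c q)) ^ (k - 1)) \<le> real (card (missed u))"
      using card_missed[OF u] by (simp add: c_def t_def algebra_simps)
    define x where "x i = c i / n" for i
    have px: "prod x A = prod c A / n ^ card A" if "finite A" for A
      unfolding x_def using that by (simp add: prod_dividef)
    have se: "s \<le> e * n"
    proof -
      have "card (strays u) \<le> card {w \<in> V - {u}. R u w \<noteq> dom u}"
        by (rule card_mono) (auto simp: fin strays_def stray_def nbr_def)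
      then show ?thesis using dom(2)[OF u] by (simp add: s_def)
    qed
    have "real k * cross_bound k e (s / n)
        \<le> (real k - 2) * (prod x ?J * (1 - (1 - s / n / ((real k - 1) * x q)) ^ (k - 1)))"
    proof (rule cross_bound_le_missing[OF k])
      show "0 \<le> x i" for i by (simp add: x_def c_def)
      show "(\<Sum>i<k. x i) = 1"
        using sum_card_part n_pos by (simp add: x_def c_def flip: sum_divide_distrib of_nat_sum)
      have "n ^ k * (1 / (real k ^ k - real k) - (e / (real k - 1)) ^ (k - 1)) < prod c {..<k}"
        using main_large by (simp add: c_def)
      also have "\<dots> = n ^ k * prod x {..<k}" using px[of "{..<k}"] n_pos by simp
      finally have "n ^ k * (1 / (real k ^ k - real k) - (e / (real k - 1)) ^ (k - 1)) \<le> n ^ k * prod x {..<k}"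
        by simp
      then show "1 / (real k ^ k - real k) - (e / (real k - 1)) ^ (k - 1) \<le> prod x {..<k}"
        by (rule mult_left_le_imp_le) (use n_pos in simp)
      show "dom u < k" "q < k" "q \<noteq> dom u" using du q by auto
      show "x i \<le> x q" if "i < k" "i \<noteq> dom u" for i
        using qmax[of i] that n_pos by (auto simp: x_def intro: divide_right_mono)
      show "0 \<le> s / n" using s0 n_pos by simp
      show "s / n \<le> e" using se n_pos by (simp add: divide_simps)
      show "s / n \<le> (real k - 1) * x q" using sX n_pos by (simp add: x_def divide_simps)
    qed
    also have "s / n / ((real k - 1) * x q) = s / ((real k - 1) * c q)" using n_pos by (simp add: x_def)
    also have "prod x ?J = prod c ?J / n ^ (k - 1)" using px[of ?J] cJ by simp
    finally have "n ^ (k - 1) * (real k * cross_bound k e (s / n))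
        \<le> n ^ (k - 1) * ((real k - 2) * (prod c ?J / n ^ (k - 1) * (1 - (1 - s / ((real k - 1) * c q)) ^ (k - 1))))"
      using n_pos by (intro mult_left_mono) auto
    also have "\<dots> = (real k - 2) * (prod c ?J * (1 - (1 - s / ((real k - 1) * c q)) ^ (k - 1)))"
      using n_pos by simp
    also have "\<dots> \<le> (real k - 2) * real (card (missed u))" using m k by (intro mult_left_mono) auto
    finally show ?thesis using cross_bound_scale[OF n_pos k, of e s] by (simp add: s_def mult_ac)
  qed
qed

lemma card_cross_le: "card cross \<le> card (main - C)"
proof -
  have "real ((k - 2) * card cross) \<le> real (\<Sum>u\<in>V. \<Sum>i\<in>{..<k} - {dom u}. \<Sum>j\<in>{..<k} - {i}.
      card {x \<in> C. x i = u \<and> x j \<in> stray u i j})"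
    using cross_le_stray_tuples by (rule of_nat_mono)
  also have "\<dots> = (\<Sum>u\<in>V. real (\<Sum>i\<in>{..<k} - {dom u}. \<Sum>j\<in>{..<k} - {i}.
      card {x \<in> C. x i = u \<and> x j \<in> stray u i j}))" by (rule of_nat_sum)
  also have "\<dots> \<le> (\<Sum>u\<in>V. cross_bound k (e * n) (card (strays u)))"
    by (rule sum_mono) (rule stray_tuples_le)
  finally have "real k * real ((k - 2) * card cross) \<le> real k * (\<Sum>u\<in>V. cross_bound k (e * n) (card (strays u)))"
    by (rule mult_left_mono) simp
  also have "\<dots> \<le> (\<Sum>u\<in>V. (real k - 2) * real (card (missed u)))"
    unfolding sum_distrib_left by (rule sum_mono) (rule cross_bound_le_missed)
  also have "\<dots> = (real k - 2) * real (\<Sum>u\<in>V. card (missed u))" by (simp add: sum_distrib_left)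
  also have "\<dots> \<le> (real k - 2) * real (k * card (main - C))"
    using sum_missed_le k by (intro mult_left_mono of_nat_mono) auto
  finally have "(real k * (real k - 2)) * real (card cross) \<le> (real k * (real k - 2)) * real (card (main - C))"
    using k by (simp add: of_nat_diff mult_ac)
  then have "real (card cross) \<le> real (card (main - C))"
    by (rule mult_left_le_imp_le) (use k in simp)
  then show ?thesis by simp
qed

text \<open>The mixed copies are outnumbered by the transversal tuples that are not copies, so the
  count is at most as if all of \<open>main\<close> and no mixed tuple were copies. With
  \<open>IH\<close> in the parts, \<open>sum_power_ge_prod\<close> brings this below the assumed
  number.\<close>

lemma contradiction: False
proof -
  have "card main = card (main \<inter> C) + card (main - C)" by (simp add: card_Int_Diff)
  then have "card C \<le> card main + (\<Sum>p<k. card (copies k R (part p)))"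
    using card_C_le card_cross_le by (simp add: Int_commute)
  then have "real (card C) \<le> real (card main) + (\<Sum>p<k. real (card (copies k R (part p))))"
    by (simp only: of_nat_le_iff flip: of_nat_add of_nat_sum)
  also have "\<dots> \<le> (\<Prod>q<k. real (card (part q))) + (\<Sum>p<k. real (card (part p)) ^ k / (real k ^ k - real k))"
    using IH[OF part_psubset] by (intro add_mono sum_mono) (auto simp: card_main)
  also have "\<dots> = ((real k ^ k - real k) * (\<Prod>q<k. real (card (part q))) + (\<Sum>p<k. real (card (part p)) ^ k))
      / (real k ^ k - real k)"
    using denominator_pos by (simp add: add_divide_distrib sum_divide_distrib)
  also have "\<dots> \<le> (\<Sum>p<k. real (card (part p))) ^ k / (real k ^ k - real k)"
    using denominator_pos k by (intro divide_right_mono sum_power_ge_prod) auto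
  also have "(\<Sum>p<k. real (card (part p))) = n" using sum_card_part by (simp flip: of_nat_sum)
  finally show False using exceeds by simp
qed

end

theorem card_copies_le:
  assumes k: "4 \<le> k" and "finite V"
  shows "real (card (copies k R V)) \<le> real (card V) ^ k / (real k ^ k - real k)"
  using \<open>finite V\<close>
proof (induction V rule: finite_psubset_induct)
  case (psubset V)
  show ?case
  proof (rule ccontr)
    assume "\<not> ?thesis"
    then interpret critical_structure k R V
      using psubset k by unfold_locales auto
    show False by (rule contradiction)
  qed
qed

section \<open>Edge sets and the planted structure\<close>

definition edges :: "nat \<Rightarrow> (nat \<Rightarrow> nat \<Rightarrow> nat) \<Rightarrow> nat set \<Rightarrow> nat set set" where
  "edges k R V = (\<lambda>x. x ` {..<k}) ` copies k R V"

lemma copies_inj_on: "x \<in> copies k R V \<Longrightarrow> inj_on x {..<k}"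
  by (rule inj_onI) (metis copiesD(3) lessThan_iff)

lemma kgraph_edges: "finite V \<Longrightarrow> kgraph k V (edges k R V)"
  unfolding kgraph_def edges_def using copiesD(1) by (auto simp: card_image copies_inj_on)

text \<open>The role that a vertex plays towards any other vertex of the edge is its index, so the
  set determines the tuple; \<open>2 <= k\<close> supplies the other vertex. Counting edges is
  therefore the same as counting copies, without a factor \<open>k!\<close>.\<close>

lemma inj_on_copies_image:
  assumes k: "2 \<le> k"
  shows "inj_on (\<lambda>x. x ` {..<k}) (copies k R V)"
proof (rule inj_onI)
  fix x y assume x: "x \<in> copies k R V" and y: "y \<in> copies k R V" and eq: "x ` {..<k} = y ` {..<k}"
  have "x i = y i" if i: "i < k" for i
  proof -
    have "x i \<in> y ` {..<k}" using eq i by blast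
    then obtain j where j: "j < k" "x i = y j" by auto
    define i' where "i' = (if i = 0 then 1 else 0 :: nat)"
    have i': "i' < k" "i' \<noteq> i" using k by (auto simp: i'_def)
    have "x i' \<in> y ` {..<k}" using eq i' by blast
    then obtain j' where j': "j' < k" "x i' = y j'" by auto
    have "x i' \<noteq> x i" using copiesD(3)[OF x i i'] .
    then have "j' \<noteq> j" using j j' by auto
    then have "R (y j) (y j') = j" using copiesD(2)[OF y j(1) j'(1)] by simp
    moreover have "R (x i) (x i') = i" using copiesD(2)[OF x i i'] .
    ultimately show ?thesis using j j' by simp
  qed
  then show "x = y" using x y unfolding copies_def by (auto intro: PiE_ext)
qed

lemma edges_restrict:
  assumes "S \<subseteq> V"
  shows "{e \<in> edges k R V. e \<subseteq> S} = edges k R S"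
proof
  show "edges k R S \<subseteq> {e \<in> edges k R V. e \<subseteq> S}"
    using copies_mono[OF assms, of k R] copiesD(1) by (fastforce simp: edges_def)
  show "{e \<in> edges k R V. e \<subseteq> S} \<subseteq> edges k R S"
  proof clarify
    fix e assume e: "e \<in> edges k R V" "e \<subseteq> S"
    then obtain x where x: "x \<in> copies k R V" "e = x ` {..<k}" by (auto simp: edges_def)
    then have "x \<in> copies k R S" using e(2) by (auto simp: copies_def PiE_iff)
    then show "e \<in> edges k R S" using x(2) by (auto simp: edges_def)
  qed
qed

lemma induced_density_edges:
  assumes "2 \<le> k" "S \<subseteq> V"
  shows "induced_density k (edges k R V) S = real (card (copies k R S)) / real (card S choose k)"
  unfolding induced_density_def Defs.density_def edges_restrict[OF assms(2)]
  by (simp add: edges_def card_image inj_on_copies_image[OF assms(1)])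

text \<open>The role is the digit at the lowest position where the base-\<open>k\<close> expansions differ, so that
  \<open>{..<k ^ L}\<close> carries an \<open>L\<close>-fold iterated blow-up of an edge.\<close>
primrec planted :: "nat \<Rightarrow> nat \<Rightarrow> nat \<Rightarrow> nat \<Rightarrow> nat" where
  "planted k 0 u v = 0"
| "planted k (Suc L) u v = (if u mod k \<noteq> v mod k then u mod k else planted k L (u div k) (v div k))"

text \<open>Two disjoint families of copies: the \<open>i\<close>-th vertex has lowest digit
  \<open>i\<close> and arbitrary higher digits, or all lowest digits agree and the higher digits
  form a copy one level down.\<close>

lemma card_planted_copies_Suc:
  assumes k: "2 \<le> k"
  shows "(k ^ L) ^ k + k * card (copies k (planted k L) {..<k ^ L})
      \<le> card (copies k (planted k (Suc L)) {..<k ^ Suc L})"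
proof -
  define lift where "lift c y = restrict (\<lambda>i. c i + k * y i) {..<k}" for c y :: "nat \<Rightarrow> nat"
  let ?Y = "{..<k} \<rightarrow>\<^sub>E {..<k ^ L}"
  let ?C = "copies k (planted k L) {..<k ^ L}"
  let ?D = "copies k (planted k (Suc L)) {..<k ^ Suc L}"
  define A where "A = lift id ` ?Y"
  define B where "B = (\<lambda>(c, y). lift (\<lambda>_. c) y) ` ({..<k} \<times> ?C)"
  have CY: "?C \<subseteq> ?Y" by (auto simp: copies_def)
  have lift_eqD: "c i mod k = d i mod k \<and> (c i = d i \<longrightarrow> y i = z i)"
    if "lift c y = lift d z" "i < k" for c d y z i
  proof -
    have eq: "c i + k * y i = d i + k * z i" using fun_cong[OF that(1), of i] that(2) by (simp add: lift_def)
    have "c i mod k = d i mod k" using arg_cong[OF eq, of "\<lambda>x. x mod k"] by simp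
    then show ?thesis using eq k by auto
  qed
  have injA: "inj_on (lift id) ?Y"
  proof (rule inj_onI)
    fix y z assume "y \<in> ?Y" "z \<in> ?Y" "lift id y = lift id z"
    then show "y = z" using lift_eqD[of id y id z] by (auto intro: PiE_ext)
  qed
  have injB: "inj_on (\<lambda>(c, y). lift (\<lambda>_. c) y) ({..<k} \<times> ?C)"
  proof (rule inj_onI, clarify)
    fix c y d z assume cd: "c < k" "d < k" and yz: "y \<in> ?C" "z \<in> ?C" and eq: "lift (\<lambda>_. c) y = lift (\<lambda>_. d) z"
    have "c = d" using lift_eqD[OF eq, of 0] cd k by simp
    moreover have "y = z"
      using lift_eqD[OF eq] \<open>c = d\<close> yz CY by (intro PiE_ext[of y "{..<k}" "\<lambda>_. {..<k ^ L}"]) auto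
    ultimately show "c = d \<and> y = z" by blast
  qed
  have range: "c + k * y < k ^ Suc L" if "c < k" "y < k ^ L" for c y
  proof -
    have "c + k * y < k * (y + 1)" using that by simp
    also have "\<dots> \<le> k * k ^ L" using that by (intro mult_le_mono2) simp
    finally show ?thesis by simp
  qed
  have AD: "A \<subseteq> ?D"
    unfolding A_def
  proof (rule image_subsetI)
    fix y assume y: "y \<in> ?Y"
    have "y i < k ^ L" if "i < k" for i using PiE_mem[OF y, of i] that by simp
    then have "lift id y \<in> {..<k} \<rightarrow>\<^sub>E {..<k ^ Suc L}"
      unfolding lift_def restrict_PiE_iff using range by simp
    moreover have "planted k (Suc L) (lift id y i) (lift id y j) = i" if "i < k" "j < k" "i \<noteq> j" for i j
      using that by (simp add: lift_def)
    ultimately show "lift id y \<in> ?D" by (simp add: copies_def)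
  qed
  have BD: "B \<subseteq> ?D"
    unfolding B_def
  proof (rule image_subsetI, clarify)
    fix c y assume c: "c < k" and y: "y \<in> ?C"
    have "y i < k ^ L" if "i < k" for i using copiesD(1)[OF y that] by simp
    then have "lift (\<lambda>_. c) y \<in> {..<k} \<rightarrow>\<^sub>E {..<k ^ Suc L}"
      unfolding lift_def restrict_PiE_iff using range c by simp
    moreover have "planted k (Suc L) (lift (\<lambda>_. c) y i) (lift (\<lambda>_. c) y j) = i"
      if "i < k" "j < k" "i \<noteq> j" for i j
      using that c copiesD(2)[OF y, of i j] by (simp add: lift_def)
    ultimately show "lift (\<lambda>_. c) y \<in> ?D" by (simp add: copies_def)
  qed
  have "A \<inter> B = {}"
  proof (rule ccontr)
    assume "A \<inter> B \<noteq> {}"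
    then obtain c y z where eq: "lift id y = lift (\<lambda>_. c) z" by (auto simp: A_def B_def)
    have "0 mod k = c mod k" "1 mod k = c mod k" using lift_eqD[OF eq, of 0] lift_eqD[OF eq, of 1] k by auto
    then show False using k by simp
  qed
  moreover have "finite ?D" by (simp add: finite_copies)
  ultimately have "card A + card B \<le> card ?D"
    using AD BD by (metis card_Un_disjoint card_mono finite_subset Un_least)
  moreover have "card A = (k ^ L) ^ k" by (simp add: A_def card_image[OF injA] card_PiE)
  moreover have "card B = k * card ?C" by (simp add: B_def card_image[OF injB] card_cartesian_product)
  ultimately show ?thesis by simp
qed

lemma card_planted_copies_ge:
  assumes k: "2 \<le> k"
  shows "real (k ^ L) ^ k - real (k ^ L) \<le> (real k ^ k - real k) * real (card (copies k (planted k L) {..<k ^ L}))"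
proof (induction L)
  case 0
  have "real k ^ 1 \<le> real k ^ k" using k by (intro power_increasing) auto
  then show ?case by simp
next
  case (Suc L)
  have "real k ^ 1 \<le> real k ^ k" using k by (intro power_increasing) auto
  then have pos: "0 \<le> real k ^ k - real k" by simp
  let ?N = "real (card (copies k (planted k L) {..<k ^ L}))"
  have "real ((k ^ L) ^ k + k * card (copies k (planted k L) {..<k ^ L}))
      \<le> real (card (copies k (planted k (Suc L)) {..<k ^ Suc L}))"
    using card_planted_copies_Suc[OF k, of L] by (rule of_nat_mono)
  then have "real (k ^ L) ^ k + real k * ?N \<le> real (card (copies k (planted k (Suc L)) {..<k ^ Suc L}))" by simp
  then have "(real k ^ k - real k) * (real (k ^ L) ^ k + real k * ?N)
      \<le> (real k ^ k - real k) * real (card (copies k (planted k (Suc L)) {..<k ^ Suc L}))"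
    using pos by (rule mult_left_mono)
  moreover have "real k * (real (k ^ L) ^ k - real (k ^ L)) \<le> real k * ((real k ^ k - real k) * ?N)"
    by (rule mult_left_mono[OF Suc]) simp
  moreover have "real (k ^ Suc L) ^ k - real (k ^ Suc L)
      = (real k ^ k - real k) * real (k ^ L) ^ k + real k * (real (k ^ L) ^ k - real (k ^ L))"
    by (simp add: power_mult_distrib algebra_simps)
  moreover have "(real k ^ k - real k) * (real (k ^ L) ^ k + real k * ?N)
      = (real k ^ k - real k) * real (k ^ L) ^ k + real k * ((real k ^ k - real k) * ?N)"
    by (simp only: distrib_left mult.left_commute)
  ultimately show ?case by linarith
qed

section \<open>Densities of planted sets and of their subsets\<close>

lemma fact_choose_eq_prod: "fact k * real (m choose k) = (\<Prod>i<k. real m - real i)"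
  by (simp add: binomial_gbinomial gbinomial_prod_rev atLeast0LessThan)

lemma fact_choose_le:
  assumes k: "2 \<le> k" and m: "k \<le> m"
  shows "fact k * real (m choose k) \<le> real m ^ k - real m"
proof -
  define L where "L = k - 2"
  have kL: "k = Suc (Suc L)" using k by (simp add: L_def)
  have "(\<Prod>i<L. real m - real (Suc (Suc i))) \<le> (\<Prod>i<L. real m)"
    by (rule prod_mono) (use m kL in auto)
  then have "real m * ((real m - 1) * (\<Prod>i<L. real m - real (Suc (Suc i)))) \<le> real m * ((real m - 1) * real m ^ L)"
    using m k by (intro mult_left_mono) auto
  also have "\<dots> = real m ^ k - real m * real m ^ L" by (simp add: kL algebra_simps)
  also have "\<dots> \<le> real m ^ k - real m * 1"
    using m k by (intro diff_left_mono mult_left_mono) auto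
  finally have "real m * ((real m - 1) * (\<Prod>i<L. real m - real (Suc (Suc i)))) \<le> real m ^ k - real m" by simp
  moreover have "(\<Prod>i<k. real m - real i) = real m * ((real m - 1) * (\<Prod>i<L. real m - real (Suc (Suc i))))"
    unfolding kL prod.lessThan_Suc_shift by simp
  ultimately show ?thesis unfolding fact_choose_eq_prod by simp
qed

text \<open>Every finite level already reaches the limiting density, because
  \<open>k! * (m choose k) <= m^k - m\<close> compensates for the lower-order term of the blow-up
  count.\<close>

lemma planted_density_ge:
  assumes k: "2 \<le> k" and L: "1 \<le> L"
  shows "fact k / (real k ^ k - real k)
    \<le> real (card (copies k (planted k L) {..<k ^ L})) / real (k ^ L choose k)"
proof -
  have kL: "k \<le> k ^ L" using k L by (intro self_le_power) auto
  have pos: "0 < real k ^ k - real k" using k power_strict_increasing[of 1 k "real k"] by simp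
  have c: "0 < real (k ^ L choose k)" using kL by (simp add: zero_less_binomial_iff)
  have "fact k * real (k ^ L choose k) \<le> (real k ^ k - real k) * real (card (copies k (planted k L) {..<k ^ L}))"
    using fact_choose_le[OF k kL] card_planted_copies_ge[OF k, of L] by linarith
  then show ?thesis using pos c by (simp add: divide_simps mult.commute)
qed

text \<open>The density of \<open>S\<close> is the average of the densities of the sets
  \<open>S - {v}\<close>, since each edge survives exactly \<open>card S - k\<close> deletions. This
  serves to cut planted sets, which come only in sizes \<open>k^L\<close>, down to a prescribed
  size.\<close>

lemma exists_denser_vertex_deleted:
  assumes S: "finite S" "k < card S" and E: "\<And>e. e \<in> E \<Longrightarrow> card e = k"
  shows "\<exists>v\<in>S. induced_density k E S \<le> induced_density k E (S - {v})"
proof (rule ccontr)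
  assume neg: "\<not> ?thesis"
  define m where "m = card S"
  define N where "N T = card {e \<in> E. e \<subseteq> T}" for T
  have finN: "finite {e \<in> E. e \<subseteq> T}" if "finite T" for T
    by (rule finite_subset[of _ "Pow T"]) (use that in auto)
  have cS: "card (S - {v}) = m - 1" if "v \<in> S" for v using that S by (simp add: m_def)
  have ch: "real (m - 1 choose k) * real m = real (m choose k) * real (m - k)"
  proof -
    have "m * (m - 1 choose k) = (m - k) * (m choose k)"
      using binomial_absorb_comp[of m k] by simp
    then show ?thesis by (simp add: mult.commute flip: of_nat_mult)
  qed
  have pos: "0 < real (m - 1 choose k)" "0 < real (m choose k)" "0 < m" using S by (auto simp: m_def)
  have double: "(\<Sum>v\<in>S. N (S - {v})) = (m - k) * N S"
  proof -
    have "(\<Sum>v\<in>S. N (S - {v})) = (\<Sum>v\<in>S. \<Sum>e\<in>{e \<in> E. e \<subseteq> S}. if v \<in> e then 0 else 1)"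
    proof (rule sum.cong[OF refl])
      fix v assume "v \<in> S"
      have "(\<Sum>e\<in>{e \<in> E. e \<subseteq> S}. if v \<in> e then 0 else 1) = card {e \<in> {e \<in> E. e \<subseteq> S}. v \<notin> e}"
        using finN[OF S(1)] by (subst card_eq_sum, subst sum.inter_filter) (auto intro!: sum.cong)
      also have "{e \<in> {e \<in> E. e \<subseteq> S}. v \<notin> e} = {e \<in> E. e \<subseteq> S - {v}}" by auto
      finally show "N (S - {v}) = (\<Sum>e\<in>{e \<in> E. e \<subseteq> S}. if v \<in> e then 0 else 1)" by (simp add: N_def)
    qed
    also have "\<dots> = (\<Sum>e\<in>{e \<in> E. e \<subseteq> S}. \<Sum>v\<in>S. if v \<in> e then 0 else 1)" by (rule sum.swap)
    also have "\<dots> = (\<Sum>e\<in>{e \<in> E. e \<subseteq> S}. m - k)"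
    proof (rule sum.cong[OF refl])
      fix e assume e: "e \<in> {e \<in> E. e \<subseteq> S}"
      have "(\<Sum>v\<in>S. if v \<in> e then 0 else 1) = card {v \<in> S. v \<notin> e}"
        using S by (subst card_eq_sum, subst sum.inter_filter) (auto intro!: sum.cong)
      also have "{v \<in> S. v \<notin> e} = S - e" by auto
      also have "card (S - e) = m - k" using e E[of e] finite_subset[of e S] S by (simp add: card_Diff_subset m_def)
      finally show "(\<Sum>v\<in>S. if v \<in> e then 0 else 1) = m - k" .
    qed
    finally show ?thesis by (simp add: N_def)
  qed
  have "real (N (S - {v})) * real (m choose k) < real (N S) * real (m - 1 choose k)" if "v \<in> S" for v
  proof -
    have frac: "a * Q < b * P" if "a / P < b / Q" "0 < P" "0 < Q" for a b P Q :: real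
      using that by (simp add: field_simps)
    have "\<not> induced_density k E S \<le> induced_density k E (S - {v})" using neg that by blast
    then have "real (N (S - {v})) / real (m - 1 choose k) < real (N S) / real (m choose k)"
      unfolding induced_density_def Defs.density_def cS[OF that] N_def m_def[symmetric] by (simp only: not_le)
    then show ?thesis using pos(1,2) by (rule frac)
  qed
  then have "(\<Sum>v\<in>S. real (N (S - {v})) * real (m choose k)) < (\<Sum>v\<in>S. real (N S) * real (m - 1 choose k))"
    using S by (intro sum_strict_mono) auto
  then have "real (\<Sum>v\<in>S. N (S - {v})) * real (m choose k) < real m * (real (N S) * real (m - 1 choose k))"
    by (simp add: m_def flip: sum_distrib_right of_nat_sum)
  then have "real ((m - k) * N S) * real (m choose k) < real m * (real (N S) * real (m - 1 choose k))"
    unfolding double .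
  also have "\<dots> = real (N S) * (real (m - 1 choose k) * real m)" by simp
  also have "\<dots> = real ((m - k) * N S) * real (m choose k)" unfolding ch by simp
  finally show False by simp
qed

lemma exists_denser_subset:
  assumes S: "finite S" and s: "k \<le> s" "s \<le> card S" and E: "\<And>e. e \<in> E \<Longrightarrow> card e = k"
  shows "\<exists>T\<subseteq>S. card T = s \<and> induced_density k E S \<le> induced_density k E T"
  using S s(2)
proof (induction "card S - s" arbitrary: S)
  case 0
  then show ?case by (intro exI[of _ S]) auto
next
  case (Suc d)
  have "k < card S" using Suc.hyps(2) s(1) by linarith
  then obtain v where v: "v \<in> S" "induced_density k E S \<le> induced_density k E (S - {v})"
    using exists_denser_vertex_deleted[of S k E] Suc s(1) E by auto
  have "d = card (S - {v}) - s" "s \<le> card (S - {v})" using Suc v by auto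
  then obtain T where "T \<subseteq> S - {v}" "card T = s" "induced_density k E (S - {v}) \<le> induced_density k E T"
    using Suc.hyps(1)[of "S - {v}"] Suc.prems by auto
  then show ?case using v by (intro exI[of _ T]) auto
qed

lemma power_over_choose_tendsto: "(\<lambda>s. real s ^ k / real (s choose k)) \<longlonglongrightarrow> fact k"
proof -
  have "(\<lambda>s. fact k * (\<Prod>i<k. real s / (real s - real i))) \<longlonglongrightarrow> fact k * (\<Prod>i<k. 1)"
  proof (intro tendsto_intros)
    fix i
    show "(\<lambda>s. real s / (real s - real i)) \<longlonglongrightarrow> 1" by real_asymp
  qed
  moreover have "fact k * (\<Prod>i<k. real s / (real s - real i)) = real s ^ k / real (s choose k)" if "k \<le> s" for s
  proof -
    have "real (s choose k) = (\<Prod>i<k. real s - real i) / fact k"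
      using fact_choose_eq_prod[of k s] by (simp add: field_simps)
    then show ?thesis by (simp add: prod_dividef)
  qed
  then have "\<forall>\<^sub>F s in sequentially. fact k * (\<Prod>i<k. real s / (real s - real i)) = real s ^ k / real (s choose k)"
    unfolding eventually_sequentially by blast
  ultimately show ?thesis by (simp add: tendsto_cong)
qed

section \<open>Pseudorandom roles\<close>

text \<open>A vertex \<open>u < q^2\<close> stands for the vector \<open>(u div q, u mod q)\<close> over the field with \<open>q\<close> elements.\<close>
definition det_mod :: "nat \<Rightarrow> nat \<Rightarrow> nat \<Rightarrow> nat" where
  "det_mod q u v = nat ((int (u div q) * int (v mod q) - int (u mod q) * int (v div q)) mod int q)"

section \<open>Determinants modulo a prime\<close>

lemma int_det_mod:
  assumes "0 < q"
  shows "int (det_mod q u v) = (int (u div q) * int (v mod q) - int (u mod q) * int (v div q)) mod int q"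
  using assms by (simp add: det_mod_def)

lemma det_mod_less: "0 < q \<Longrightarrow> det_mod q u v < q"
  using int_det_mod[of q u v] by (metis mod_less_divisor of_nat_0_less_iff of_nat_less_iff pos_mod_bound)

lemma det_mod_swap:
  assumes "0 < q"
  shows "det_mod q v u = (q - det_mod q u v) mod q"
proof -
  let ?d = "int (u div q) * int (v mod q) - int (u mod q) * int (v div q)"
  have "int (det_mod q v u) = (- ?d) mod int q" using assms by (simp add: int_det_mod algebra_simps)
  also have "\<dots> = (int q - ?d mod int q) mod int q" by (simp add: mod_simps)
  also have "int q - ?d mod int q = int (q - det_mod q u v)"
    using det_mod_less[OF assms, of u v] by (simp only: int_det_mod[OF assms] of_nat_diff[OF less_imp_le])
  also have "\<dots> mod int q = int ((q - det_mod q u v) mod q)" by (simp only: zmod_int)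
  finally show ?thesis by simp
qed

lemma det_mod_eq_0_iff:
  assumes "0 < q"
  shows "det_mod q u v = 0 \<longleftrightarrow> int q dvd int (u div q) * int (v mod q) - int (u mod q) * int (v div q)"
  using int_det_mod[OF assms, of u v] by (metis dvd_eq_mod_eq_0 of_nat_0 of_nat_eq_iff)

lemma eq_of_dvd_diff:
  fixes a b q :: nat
  assumes "int q dvd int a - int b" "a < q" "b < q"
  shows "a = b"
  using assms by (metis int_int_eq mod_eq_dvd_iff mod_less zmod_int)

text \<open>Cramer's rule: the map is linear in the vector \<open>u\<close>, and eliminating either
  coordinate of a difference \<open>(x, y)\<close> leaves the other times the determinant of
  \<open>b\<close> and \<open>b'\<close>, which is invertible.\<close>

lemma inj_on_det_mod_pair:
  assumes q: "prime q" and bb: "det_mod q b b' \<noteq> 0"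
  shows "inj_on (\<lambda>u. (det_mod q u b, det_mod q u b')) {..<q ^ 2}"
proof (rule inj_onI)
  fix u w assume u: "u \<in> {..<q ^ 2}" and w: "w \<in> {..<q ^ 2}"
    and eq: "(det_mod q u b, det_mod q u b') = (det_mod q w b, det_mod q w b')"
  have q0: "0 < q" using q prime_gt_0_nat by blast
  have pq: "prime (int q)" using q by simp
  define x y where "x = int (u div q) - int (w div q)" and "y = int (u mod q) - int (w mod q)"
  have d: "int q dvd x * int (c mod q) - y * int (c div q)" if "det_mod q u c = det_mod q w c" for c
  proof -
    have "(int (u div q) * int (c mod q) - int (u mod q) * int (c div q)) mod int q
        = (int (w div q) * int (c mod q) - int (w mod q) * int (c div q)) mod int q"
      using that int_det_mod[OF q0] by metis
    then have "int q dvd (int (u div q) * int (c mod q) - int (u mod q) * int (c div q))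
        - (int (w div q) * int (c mod q) - int (w mod q) * int (c div q))"
      by (simp add: mod_eq_dvd_iff)
    then show ?thesis by (simp add: x_def y_def algebra_simps)
  qed
  have d1: "int q dvd x * int (b mod q) - y * int (b div q)"
    and d2: "int q dvd x * int (b' mod q) - y * int (b' div q)" using d eq by auto
  let ?D = "int (b div q) * int (b' mod q) - int (b mod q) * int (b' div q)"
  have nD: "\<not> int q dvd ?D" using bb det_mod_eq_0_iff[OF q0] by simp
  have "int q dvd int (b div q) * (x * int (b' mod q) - y * int (b' div q))
      - int (b' div q) * (x * int (b mod q) - y * int (b div q))" using d1 d2 by simp
  also have "int (b div q) * (x * int (b' mod q) - y * int (b' div q))
      - int (b' div q) * (x * int (b mod q) - y * int (b div q)) = x * ?D" by (simp add: algebra_simps)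
  finally have "int q dvd x" using nD pq prime_dvd_mult_iff by blast
  have "int q dvd int (b mod q) * (x * int (b' mod q) - y * int (b' div q))
      - int (b' mod q) * (x * int (b mod q) - y * int (b div q))" using d1 d2 by simp
  also have "int (b mod q) * (x * int (b' mod q) - y * int (b' div q))
      - int (b' mod q) * (x * int (b mod q) - y * int (b div q)) = y * ?D" by (simp add: algebra_simps)
  finally have "int q dvd y" using nD pq prime_dvd_mult_iff by blast
  have "u div q = w div q" using \<open>int q dvd x\<close> u w
    by (intro eq_of_dvd_diff[of q]) (auto simp: x_def power2_eq_square less_mult_imp_div_less)
  moreover have "u mod q = w mod q" using \<open>int q dvd y\<close> q0
    by (intro eq_of_dvd_diff[of q]) (auto simp: y_def)
  ultimately show "u = w" by (metis div_mult_mod_eq)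
qed

text \<open>An injection between sets of size \<open>q^2\<close> is onto, so the two determinants
  range over all pairs of residues and the correlation factors.\<close>

lemma sum_det_mod_pair:
  fixes f :: "nat \<Rightarrow> real"
  assumes q: "prime q" and bb: "det_mod q b b' \<noteq> 0"
  shows "(\<Sum>u<q ^ 2. f (det_mod q u b) * f (det_mod q u b')) = (\<Sum>t<q. f t) ^ 2"
proof -
  have q0: "0 < q" using q prime_gt_0_nat by blast
  let ?p = "\<lambda>u. (det_mod q u b, det_mod q u b')"
  have inj: "inj_on ?p {..<q ^ 2}" by (rule inj_on_det_mod_pair[OF q bb])
  have sub: "?p ` {..<q ^ 2} \<subseteq> {..<q} \<times> {..<q}" using det_mod_less[OF q0] by auto
  have cim: "card (?p ` {..<q ^ 2}) = q * q"
    unfolding card_image[OF inj] by (simp add: power2_eq_square)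
  have "?p ` {..<q ^ 2} = {..<q} \<times> {..<q}"
    by (rule card_subset_eq[OF _ sub]) (simp_all only: cim finite_cartesian_product finite_lessThan card_cartesian_product card_lessThan)
  then have bij: "bij_betw ?p {..<q ^ 2} ({..<q} \<times> {..<q})" using inj by (simp add: bij_betw_def)
  have "(\<Sum>u<q ^ 2. f (det_mod q u b) * f (det_mod q u b')) = (\<Sum>(s, t)\<in>{..<q} \<times> {..<q}. f s * f t)"
    using sum.reindex_bij_betw[OF bij, of "\<lambda>(s, t). f s * f t"] by simp
  also have "\<dots> = (\<Sum>t<q. f t) ^ 2"
    by (simp add: power2_eq_square sum_product sum.cartesian_product)
  finally show ?thesis .
qed

text \<open>The solutions form a line through the origin: a nonzero coordinate of \<open>b\<close>
  lets one coordinate of \<open>b'\<close> determine the other.\<close>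

lemma card_det_mod_eq_0_le:
  assumes q: "prime q" and b: "b < q ^ 2" "b \<noteq> 0"
  shows "card {b' \<in> {..<q ^ 2}. det_mod q b b' = 0} \<le> q"
proof -
  have q0: "0 < q" using q prime_gt_0_nat by blast
  have pq: "prime (int q)" using q by simp
  let ?Z = "{b' \<in> {..<q ^ 2}. det_mod q b b' = 0}"
  have bl: "b div q < q" "b mod q < q" using b q0 by (auto simp: power2_eq_square less_mult_imp_div_less)
  have dz: "int q dvd int (b div q) * (int (x mod q) - int (y mod q)) - int (b mod q) * (int (x div q) - int (y div q))"
    if "x \<in> ?Z" "y \<in> ?Z" for x y
  proof -
    have "int q dvd int (b div q) * int (x mod q) - int (b mod q) * int (x div q)"
      "int q dvd int (b div q) * int (y mod q) - int (b mod q) * int (y div q)"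
      using that det_mod_eq_0_iff[OF q0] by auto
    from dvd_diff[OF this] show ?thesis by (simp add: algebra_simps)
  qed
  have ndvd: "\<not> int q dvd int c" if "0 < c" "c < q" for c using that by (auto dest: nat_dvd_not_less)
  have cardle: "card ?Z \<le> q" if inj: "inj_on g ?Z" and im: "g ` ?Z \<subseteq> {..<q}" for g :: "nat \<Rightarrow> nat"
    using card_inj_on_le[OF inj im] by simp
  show ?thesis
  proof (cases "b div q = 0")
    case False
    show ?thesis
    proof (rule cardle[of "\<lambda>x. x div q"])
      show "inj_on (\<lambda>x. x div q) ?Z"
      proof (rule inj_onI)
        fix x y assume xy: "x \<in> ?Z" "y \<in> ?Z" "x div q = y div q"
        then have "int q dvd int (b div q) * (int (x mod q) - int (y mod q))" using dz[OF xy(1,2)] by simp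
        then have "int q dvd int (x mod q) - int (y mod q)"
          using ndvd[of "b div q"] bl False pq prime_dvd_mult_iff by blast
        then have "x mod q = y mod q" using q0 by (intro eq_of_dvd_diff[of q]) auto
        then show "x = y" using xy(3) by (metis div_mult_mod_eq)
      qed
      show "(\<lambda>x. x div q) ` ?Z \<subseteq> {..<q}" by (auto simp: power2_eq_square less_mult_imp_div_less)
    qed
  next
    case True
    then have bm: "b mod q \<noteq> 0" using b(2) by (metis div_mult_mod_eq mult_0 add_0)
    show ?thesis
    proof (rule cardle[of "\<lambda>x. x mod q"])
      show "inj_on (\<lambda>x. x mod q) ?Z"
      proof (rule inj_onI)
        fix x y assume xy: "x \<in> ?Z" "y \<in> ?Z" "x mod q = y mod q"
        then have "int q dvd int (b mod q) * (int (x div q) - int (y div q))"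
          using dz[OF xy(1,2)] True by simp
        then have "int q dvd int (x div q) - int (y div q)"
          using ndvd[of "b mod q"] bl bm pq prime_dvd_mult_iff by blast
        then have "x div q = y div q" using xy(1,2)
          by (intro eq_of_dvd_diff[of q]) (auto simp: power2_eq_square less_mult_imp_div_less)
        then show "x = y" using xy(3) by (metis div_mult_mod_eq)
      qed
      show "(\<lambda>x. x mod q) ` ?Z \<subseteq> {..<q}" using q0 by auto
    qed
  qed
qed

lemma sum_card_det_mod_eq_0_le:
  assumes q: "prime q"
  shows "(\<Sum>b<q ^ 2. card {b' \<in> {..<q ^ 2}. det_mod q b b' = 0}) \<le> 2 * q ^ 3"
proof -
  have q0: "0 < q" using q prime_gt_0_nat by blast
  \<comment> \<open>The zero vector is dependent on all \<open>q^2\<close> vectors and needs the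
    extra term.\<close>
  have "(\<Sum>b<q ^ 2. card {b' \<in> {..<q ^ 2}. det_mod q b b' = 0})
      \<le> (\<Sum>b<q ^ 2. q + (if b = 0 then q ^ 2 else 0))"
  proof (rule sum_mono)
    fix b assume "b \<in> {..<q ^ 2}"
    moreover have "card {b' \<in> {..<q ^ 2}. det_mod q b b' = 0} \<le> card {..<q ^ 2}" by (rule card_mono) auto
    ultimately show "card {b' \<in> {..<q ^ 2}. det_mod q b b' = 0} \<le> q + (if b = 0 then q ^ 2 else 0)"
      using card_det_mod_eq_0_le[OF q, of b] by auto
  qed
  also have "\<dots> = q ^ 3 + q ^ 2" using q0 by (simp add: sum.distrib power3_eq_cube power2_eq_square)
  also have "\<dots> \<le> 2 * q ^ 3" using q0 by (simp add: power_increasing)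
  finally show ?thesis .
qed

text \<open>By Cauchy-Schwarz the square is controlled by correlations of two columns \<open>b, c\<close>. For linearly
  independent vectors the two determinants are independent and uniform, and only
  \<open>O(q^3)\<close> pairs of vectors are dependent.\<close>
lemma det_mod_discrepancy:
  fixes f :: "nat \<Rightarrow> real"
  assumes q: "prime q" and f: "\<And>t. t < q \<Longrightarrow> \<bar>f t\<bar> \<le> 1" and C: "\<bar>\<Sum>t<q. f t\<bar> \<le> C"
    and \<alpha>: "\<And>u. \<bar>\<alpha> u\<bar> \<le> 1" and \<beta>: "\<And>u. \<bar>\<beta> u\<bar> \<le> 1"
  shows "(\<Sum>u<q ^ 2. \<Sum>v<q ^ 2. \<alpha> u * \<beta> v * f (det_mod q u v)) ^ 2 \<le> C ^ 2 * real q ^ 6 + 2 * real q ^ 7"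
proof -
  have q0: "0 < q" using q prime_gt_0_nat by blast
  have f': "\<bar>f (det_mod q u v)\<bar> \<le> 1" for u v using f det_mod_less[OF q0] by blast
  define g where "g u = (\<Sum>v<q ^ 2. \<beta> v * f (det_mod q u v))" for u
  define T where "T b c = (\<Sum>u<q ^ 2. f (det_mod q u b) * f (det_mod q u c))" for b c
  have T: "\<bar>T b c\<bar> \<le> C ^ 2 + (if det_mod q b c = 0 then real q ^ 2 else 0)" for b c
  proof (cases "det_mod q b c = 0")
    case False
    have Tbc: "T b c = (\<Sum>t<q. f t) ^ 2" unfolding T_def by (rule sum_det_mod_pair[OF q False])
    have "(\<Sum>t<q. f t) ^ 2 \<le> C ^ 2" using C abs_le_square_iff[of "\<Sum>t<q. f t" C] by simp
    then show ?thesis using False unfolding Tbc by simp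
  next
    case True
    have "\<bar>T b c\<bar> \<le> (\<Sum>u<q ^ 2. \<bar>f (det_mod q u b) * f (det_mod q u c)\<bar>)" unfolding T_def by (rule sum_abs)
    also have "\<dots> \<le> (\<Sum>u<q ^ 2. 1)"
      by (rule sum_mono) (use f' in \<open>auto simp: abs_mult intro: mult_le_one\<close>)
    finally have "\<bar>T b c\<bar> \<le> real q ^ 2" by simp
    then show ?thesis unfolding if_P[OF True] using zero_le_power2[of C] by linarith
  qed
  have "(\<Sum>u<q ^ 2. g u ^ 2) = (\<Sum>b<q ^ 2. \<Sum>c<q ^ 2. \<beta> b * \<beta> c * T b c)"
  proof -
    have "(\<Sum>u<q ^ 2. g u ^ 2) = (\<Sum>u<q ^ 2. \<Sum>b<q ^ 2. \<Sum>c<q ^ 2.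
        \<beta> b * \<beta> c * (f (det_mod q u b) * f (det_mod q u c)))"
      unfolding g_def power2_eq_square sum_product by (intro sum.cong refl) (simp add: mult_ac)
    also have "\<dots> = (\<Sum>b<q ^ 2. \<Sum>u<q ^ 2. \<Sum>c<q ^ 2.
        \<beta> b * \<beta> c * (f (det_mod q u b) * f (det_mod q u c)))" by (rule sum.swap)
    also have "\<dots> = (\<Sum>b<q ^ 2. \<Sum>c<q ^ 2. \<Sum>u<q ^ 2.
        \<beta> b * \<beta> c * (f (det_mod q u b) * f (det_mod q u c)))"
      by (rule sum.cong[OF refl], rule sum.swap)
    finally show ?thesis by (simp add: T_def sum_distrib_left)
  qed
  also have "\<dots> \<le> (\<Sum>b<q ^ 2. \<Sum>c<q ^ 2. C ^ 2 + (if det_mod q b c = 0 then real q ^ 2 else 0))"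
  proof (intro sum_mono)
    fix b c
    have "\<bar>\<beta> b * \<beta> c\<bar> \<le> 1" using \<beta> by (auto simp: abs_mult intro: mult_le_one)
    then have "\<bar>\<beta> b * \<beta> c\<bar> * \<bar>T b c\<bar> \<le> 1 * \<bar>T b c\<bar>" by (intro mult_right_mono) auto
    then have "\<beta> b * \<beta> c * T b c \<le> \<bar>T b c\<bar>" by (metis abs_le_D1 abs_mult mult_1)
    with T[of b c] show "\<beta> b * \<beta> c * T b c \<le> C ^ 2 + (if det_mod q b c = 0 then real q ^ 2 else 0)" by linarith
  qed
  also have "\<dots> = C ^ 2 * real q ^ 4 + real q ^ 2 * real (\<Sum>b<q ^ 2. card {c \<in> {..<q ^ 2}. det_mod q b c = 0})"
  proof -
    have "(\<Sum>c<q ^ 2. if det_mod q b c = 0 then real q ^ 2 else 0) = real q ^ 2 * real (card {c \<in> {..<q ^ 2}. det_mod q b c = 0})" for b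
      by (simp add: sum.inter_filter[symmetric])
    then show ?thesis by (simp add: sum.distrib sum_distrib_left power_mult_distrib flip: power_mult power_add)
  qed
  also have "\<dots> \<le> C ^ 2 * real q ^ 4 + real q ^ 2 * real (2 * q ^ 3)"
    using sum_card_det_mod_eq_0_le[OF q] by (intro add_left_mono mult_left_mono of_nat_mono) auto
  finally have g2: "(\<Sum>u<q ^ 2. g u ^ 2) \<le> C ^ 2 * real q ^ 4 + real q ^ 2 * real (2 * q ^ 3)" .
  have "(\<Sum>u<q ^ 2. \<Sum>v<q ^ 2. \<alpha> u * \<beta> v * f (det_mod q u v)) = (\<Sum>u<q ^ 2. \<alpha> u * g u)"
    by (simp add: g_def sum_distrib_left mult.assoc)
  also have "\<dots> ^ 2 \<le> (\<Sum>u<q ^ 2. \<alpha> u ^ 2) * (\<Sum>u<q ^ 2. g u ^ 2)" by (rule Cauchy_Schwarz_ineq_sum)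
  also have "\<dots> \<le> real q ^ 2 * (\<Sum>u<q ^ 2. g u ^ 2)"
  proof (rule mult_right_mono)
    have "(\<Sum>u<q ^ 2. \<alpha> u ^ 2) \<le> (\<Sum>u<q ^ 2. 1)"
      by (rule sum_mono) (use \<alpha> abs_square_le_1 in blast)
    then show "(\<Sum>u<q ^ 2. \<alpha> u ^ 2) \<le> real q ^ 2" by simp
  qed (simp add: sum_nonneg)
  also have "\<dots> \<le> real q ^ 2 * (C ^ 2 * real q ^ 4 + real q ^ 2 * real (2 * q ^ 3))"
    using g2 by (intro mult_left_mono) auto
  also have "\<dots> = C ^ 2 * real q ^ 6 + 2 * real q ^ 7" by (simp add: algebra_simps flip: power_add)
  finally show ?thesis .
qed

section \<open>From pairwise discrepancy to the number of copies\<close>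

lemma sum_PiE_insert:
  assumes "i \<notin> S"
  shows "(\<Sum>x\<in>insert i S \<rightarrow>\<^sub>E W. f x) = (\<Sum>y\<in>S \<rightarrow>\<^sub>E W. \<Sum>u\<in>W. f (y(i := u)))"
proof -
  have "(\<Sum>x\<in>insert i S \<rightarrow>\<^sub>E W. f x) = (\<Sum>(u, y)\<in>W \<times> (S \<rightarrow>\<^sub>E W). f (y(i := u)))"
    unfolding PiE_insert_eq
    by (subst sum.reindex[OF inj_combinator[OF assms]]) (auto intro!: sum.cong)
  also have "\<dots> = (\<Sum>u\<in>W. \<Sum>y\<in>S \<rightarrow>\<^sub>E W. f (y(i := u)))" by (simp add: sum.cartesian_product)
  also have "\<dots> = (\<Sum>y\<in>S \<rightarrow>\<^sub>E W. \<Sum>u\<in>W. f (y(i := u)))" by (rule sum.swap)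
  finally show ?thesis .
qed

lemma prod_in_unit_interval:
  fixes f :: "'a \<Rightarrow> real"
  assumes "\<And>a. 0 \<le> f a \<and> f a \<le> 1"
  shows "0 \<le> prod f A" "prod f A \<le> 1"
  using assms by (auto intro: prod_nonneg prod_le_1)

text \<open>The factors \<open>F p\<close> are replaced by \<open>c\<close> one pair at a time; with all other coordinates fixed, the
  remaining factors separate into weights \<open>\<alpha>\<close> and \<open>\<beta>\<close>.\<close>
lemma counting_lemma:
  fixes F :: "nat \<times> nat \<Rightarrow> 'a \<Rightarrow> 'a \<Rightarrow> real" and c \<delta> :: real
  assumes W: "finite W" and c: "0 \<le> c" "c \<le> 1"
    and F: "\<And>p u v. 0 \<le> F p u v \<and> F p u v \<le> 1"
    and disc: "\<And>i j \<alpha> \<beta>. i < j \<Longrightarrow> j < k \<Longrightarrow> (\<And>u. 0 \<le> \<alpha> u \<and> \<alpha> u \<le> 1) \<Longrightarrow> (\<And>v. 0 \<le> \<beta> v \<and> \<beta> v \<le> 1)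
      \<Longrightarrow> \<bar>\<Sum>u\<in>W. \<Sum>v\<in>W. \<alpha> u * \<beta> v * (F (i, j) u v - c)\<bar> \<le> \<delta>"
    and P: "finite P" "P \<subseteq> {(i, j). i < j \<and> j < k}"
  shows "\<bar>(\<Sum>x\<in>{..<k} \<rightarrow>\<^sub>E W. \<Prod>p\<in>P. F p (x (fst p)) (x (snd p))) - c ^ card P * real (card W) ^ k\<bar>
    \<le> real (card P) * \<delta> * real (card W) ^ (k - 2)"
  using P
proof (induction P rule: finite_induct)
  case empty
  then show ?case by (simp add: card_PiE)
next
  case (insert p P)
  obtain i j where p: "p = (i, j)" by (cases p)
  have ij: "i < j" "j < k" using insert.prems p by auto
  define S where "S = {..<k} - {i} - {j}"
  define G where "G x = (\<Prod>p\<in>P. F p (x (fst p)) (x (snd p)))" for x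
  have kS: "{..<k} = insert i (insert j S)" and iS: "i \<notin> insert j S" and jS: "j \<notin> S"
    using ij by (auto simp: S_def)
  have cS: "card S = k - 2" using ij by (simp add: S_def)
  have IH: "\<bar>(\<Sum>x\<in>{..<k} \<rightarrow>\<^sub>E W. G x) - c ^ card P * real (card W) ^ k\<bar>
      \<le> real (card P) * \<delta> * real (card W) ^ (k - 2)"
    using insert by (simp add: G_def)
  have replace: "\<bar>\<Sum>x\<in>{..<k} \<rightarrow>\<^sub>E W. (F p (x i) (x j) - c) * G x\<bar> \<le> \<delta> * real (card W) ^ (k - 2)"
  proof -
    have inner: "\<bar>\<Sum>v\<in>W. \<Sum>u\<in>W. (F p u v - c) * G (y(j := v, i := u))\<bar> \<le> \<delta>" for y
    proof -
      define I J where "I = {r \<in> P. fst r = i \<or> snd r = i}" and "J = {r \<in> P. fst r = j \<or> snd r = j}"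
      define A where "A u = (\<Prod>r\<in>I. F r ((y(i := u)) (fst r)) ((y(i := u)) (snd r)))" for u
      define B where "B v = (\<Prod>r\<in>J. F r ((y(j := v)) (fst r)) ((y(j := v)) (snd r)))" for v
      define D where "D = (\<Prod>r\<in>P - I - J. F r (y (fst r)) (y (snd r)))"
      \<comment> \<open>The only increasing pair that meets both \<open>i\<close> and
        \<open>j\<close> is \<open>p\<close> itself, which is not in \<open>P\<close>. So no
        remaining factor depends on both \<open>u\<close> and \<open>v\<close>.\<close>
      have IJ: "I \<inter> J = {}" using insert.prems insert.hyps(2) p ij by (auto simp: I_def J_def)
      have iJ: "fst r \<noteq> i" "snd r \<noteq> i" if "r \<in> J" for r using that IJ by (auto simp: I_def J_def)
      have jI: "fst r \<noteq> j" "snd r \<noteq> j" if "r \<in> I" for r using that IJ by (auto simp: I_def J_def)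
      have G: "G (y(j := v, i := u)) = A u * B v * D" for u v
      proof -
        let ?h = "\<lambda>r. F r ((y(j := v, i := u)) (fst r)) ((y(j := v, i := u)) (snd r))"
        have "G (y(j := v, i := u)) = prod ?h (P - I) * prod ?h I"
          unfolding G_def using insert.hyps(1) by (intro prod.subset_diff) (auto simp: I_def)
        also have "prod ?h (P - I) = prod ?h (P - I - J) * prod ?h J"
          using insert.hyps(1) IJ by (intro prod.subset_diff) (auto simp: J_def)
        also have "prod ?h I = A u" unfolding A_def by (rule prod.cong[OF refl]) (simp add: jI)
        also have "prod ?h J = B v" unfolding B_def by (rule prod.cong[OF refl]) (simp add: iJ)
        also have "prod ?h (P - I - J) = D"
          unfolding D_def by (rule prod.cong[OF refl]) (auto simp: I_def J_def)
        finally show ?thesis by (simp only: mult_ac)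
      qed
      have unit: "0 \<le> A u \<and> A u \<le> 1" "0 \<le> B u \<and> B u \<le> 1" "0 \<le> D" "D \<le> 1" for u
        unfolding A_def B_def D_def using F by (auto intro: prod_in_unit_interval)
      have "(\<Sum>v\<in>W. \<Sum>u\<in>W. (F p u v - c) * G (y(j := v, i := u)))
          = D * (\<Sum>u\<in>W. \<Sum>v\<in>W. A u * B v * (F p u v - c))"
        unfolding G sum_distrib_left by (subst sum.swap) (simp add: mult_ac)
      moreover have "\<bar>\<Sum>u\<in>W. \<Sum>v\<in>W. A u * B v * (F p u v - c)\<bar> \<le> \<delta>"
        unfolding p by (rule disc[OF ij]) (use unit in auto)
      ultimately have "\<bar>\<Sum>v\<in>W. \<Sum>u\<in>W. (F p u v - c) * G (y(j := v, i := u))\<bar> \<le> D * \<delta>"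
        using unit(3) by (simp add: abs_mult mult_left_mono)
      also have "\<dots> \<le> 1 * \<delta>"
      proof (rule mult_right_mono[OF unit(4)])
        show "0 \<le> \<delta>" using disc[OF ij, of "\<lambda>_. 0" "\<lambda>_. 0"] by simp
      qed
      finally show ?thesis by simp
    qed
    have "(\<Sum>x\<in>{..<k} \<rightarrow>\<^sub>E W. (F p (x i) (x j) - c) * G x)
        = (\<Sum>y\<in>S \<rightarrow>\<^sub>E W. \<Sum>v\<in>W. \<Sum>u\<in>W. (F p u v - c) * G (y(j := v, i := u)))"
      using ij unfolding kS sum_PiE_insert[OF iS] sum_PiE_insert[OF jS] by simp
    also have "\<bar>\<dots>\<bar> \<le> (\<Sum>y\<in>S \<rightarrow>\<^sub>E W. \<bar>\<Sum>v\<in>W. \<Sum>u\<in>W. (F p u v - c) * G (y(j := v, i := u))\<bar>)"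
      by (rule sum_abs)
    also have "\<dots> \<le> (\<Sum>y\<in>S \<rightarrow>\<^sub>E W. \<delta>)" by (rule sum_mono) (rule inner)
    also have "\<dots> = \<delta> * real (card W) ^ (k - 2)" using cS by (simp add: card_PiE S_def)
    finally show ?thesis .
  qed
  have tri: "\<bar>a + c * b\<bar> \<le> \<bar>a\<bar> + c * \<bar>b\<bar>" for a b
    using abs_triangle_ineq[of a "c * b"] c by (simp add: abs_mult)
  have "(\<Sum>x\<in>{..<k} \<rightarrow>\<^sub>E W. \<Prod>p\<in>insert p P. F p (x (fst p)) (x (snd p)))
      = (\<Sum>x\<in>{..<k} \<rightarrow>\<^sub>E W. (F p (x i) (x j) - c) * G x) + c * (\<Sum>x\<in>{..<k} \<rightarrow>\<^sub>E W. G x)"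
    using insert.hyps by (simp add: G_def p sum_distrib_left algebra_simps flip: sum.distrib)
  then have "(\<Sum>x\<in>{..<k} \<rightarrow>\<^sub>E W. \<Prod>p\<in>insert p P. F p (x (fst p)) (x (snd p)))
        - c ^ card (insert p P) * real (card W) ^ k
      = (\<Sum>x\<in>{..<k} \<rightarrow>\<^sub>E W. (F p (x i) (x j) - c) * G x)
        + c * ((\<Sum>x\<in>{..<k} \<rightarrow>\<^sub>E W. G x) - c ^ card P * real (card W) ^ k)"
    using insert.hyps by (simp add: algebra_simps)
  also have "\<bar>\<dots>\<bar> \<le> \<bar>\<Sum>x\<in>{..<k} \<rightarrow>\<^sub>E W. (F p (x i) (x j) - c) * G x\<bar>
      + c * \<bar>(\<Sum>x\<in>{..<k} \<rightarrow>\<^sub>E W. G x) - c ^ card P * real (card W) ^ k\<bar>"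
    by (rule tri)
  also have "\<dots> \<le> \<delta> * real (card W) ^ (k - 2)
      + 1 * \<bar>(\<Sum>x\<in>{..<k} \<rightarrow>\<^sub>E W. G x) - c ^ card P * real (card W) ^ k\<bar>"
    using replace c by (intro add_mono mult_right_mono) auto
  also have "\<dots> \<le> \<delta> * real (card W) ^ (k - 2) + real (card P) * \<delta> * real (card W) ^ (k - 2)"
    using IH by simp
  also have "\<dots> = real (card (insert p P)) * \<delta> * real (card W) ^ (k - 2)"
    using insert.hyps by (simp add: algebra_simps)
  finally show ?case .
qed

section \<open>Roles read off residues\<close>

lemma card_residue_class:
  assumes "r < M"
  shows "card {t. t < m \<and> t mod M = r} = (m + (M - 1 - r)) div M"
proof (induction m)
  case 0
  then show ?case using assms by simp
next
  case (Suc m)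
  have "{t. t < Suc m \<and> t mod M = r} = (if m mod M = r then insert m {t. t < m \<and> t mod M = r} else {t. t < m \<and> t mod M = r})"
    by (auto simp: less_Suc_eq)
  then have "card {t. t < Suc m \<and> t mod M = r} = (m + (M - 1 - r)) div M + (if m mod M = r then 1 else 0)"
    using Suc by simp
  moreover have "Suc (m + (M - 1 - r)) mod M = 0 \<longleftrightarrow> m mod M = r"
  proof -
    have "Suc (m + (M - 1 - r)) = m + (M - r)" using assms by simp
    moreover have "(m + (M - r)) mod M = (m mod M + (M - r)) mod M" by (simp add: mod_simps)
    moreover have "(m mod M + (M - r)) mod M = 0 \<longleftrightarrow> m mod M = r"
    proof (cases "m mod M < r")
      case True
      then show ?thesis using assms by simp
    next
      case False
      then have "m mod M + (M - r) = (m mod M - r) + M" using assms by simp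
      moreover have "m mod M - r < M" using assms by (meson less_imp_diff_less mod_less_divisor order_le_less_trans zero_le)
      ultimately have "(m mod M + (M - r)) mod M = m mod M - r" by (simp only: mod_add_self2 mod_less)
      then show ?thesis using False by simp
    qed
    ultimately show ?thesis by (simp only:)
  qed
  ultimately show ?case by (simp add: div_Suc)
qed

lemma card_residue_class_approx:
  assumes "r < M"
  shows "\<bar>real (card {t. t < m \<and> t mod M = r}) - real m / real M\<bar> \<le> 1"
proof -
  let ?N = "(m + (M - 1 - r)) div M"
  have M: "0 < M" using assms by simp
  have "?N * M \<le> m + (M - 1 - r)" by (rule div_times_less_eq_dividend)
  also have "\<dots> \<le> m + M" by simp
  finally have u: "real ?N * real M \<le> real m + real M" by (simp only: of_nat_le_iff flip: of_nat_mult of_nat_add)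
  have "m + (M - 1 - r) < M + ?N * M" using M by (rule dividend_less_div_times)
  then have "m \<le> M + ?N * M" by linarith
  then have l: "real m \<le> real M + real ?N * real M" by (simp only: of_nat_le_iff flip: of_nat_mult of_nat_add)
  show ?thesis unfolding card_residue_class[OF assms] using u l M
    by (simp add: abs_le_iff field_simps)
qed

text \<open>The two vertices of a pair see opposite determinants \<open>t\<close> and \<open>q - t\<close>. Both read the two roles off
  the residue of the smaller one modulo \<open>k^2\<close>, and whether one's own is the smaller one decides
  which of the two is one's role. Thus all \<open>k^2\<close> pairs of roles are almost equally likely.\<close>
definition role_of :: "nat \<Rightarrow> nat \<Rightarrow> nat \<Rightarrow> nat" where
  "role_of k q t = (if 2 * t < q then (t mod k ^ 2) div k else ((q - t) mod k ^ 2) mod k)"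

lemma residue_eq_iff:
  fixes i j k x :: nat
  assumes "i < k" "j < k"
  shows "x div k = i \<and> x mod k = j \<longleftrightarrow> x = i * k + j"
  using assms by (auto simp: div_mult_mod_eq)

text \<open>Since \<open>q\<close> is odd, exactly one of \<open>t\<close> and \<open>q - t\<close>
  is below \<open>q / 2\<close>. For \<open>t = 0\<close> both ends read role 0; this fails the left
  side by \<open>i < j\<close> and the right side by \<open>i * k + j > 0\<close>.\<close>

lemma role_of_pair_iff:
  assumes q: "odd q" and ij: "i < j" "j < k" and t: "t < q"
  shows "role_of k q t = i \<and> role_of k q ((q - t) mod q) = j \<longleftrightarrow>
    (if 2 * t < q then t mod k ^ 2 = i * k + j else (q - t) mod k ^ 2 = j * k + i)"
proof (cases "t = 0")
  case True
  then show ?thesis using ij t by (auto simp: role_of_def)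
next
  case False
  then have m: "(q - t) mod q = q - t" using t by simp
  show ?thesis
  proof (cases "2 * t < q")
    case True
    then have "\<not> 2 * (q - t) < q" "q - (q - t) = t" by auto
    then show ?thesis using True residue_eq_iff[of i k j "t mod k ^ 2"] ij unfolding m by (simp add: role_of_def)
  next
    case f: False
    have "2 * t \<noteq> q" using q by auto
    then have "2 * (q - t) < q" using f t by auto
    then show ?thesis using f residue_eq_iff[of j k i "(q - t) mod k ^ 2"] ij unfolding m by (auto simp: role_of_def)
  qed
qed

text \<open>Each half of the range is an interval of integers counted along one class modulo
  \<open>k^2\<close>, with error at most 1. The two intervals contain \<open>q + 1\<close> integers
  in total, since 0 lies in both, and the surplus \<open>1 / k^2\<close> accounts for the third
  unit.\<close>

lemma sum_role_pair_le:
  assumes q: "odd q" and ij: "i < j" "j < k"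
  shows "\<bar>\<Sum>t<q. of_bool (role_of k q t = i \<and> role_of k q ((q - t) mod q) = j) - 1 / real k ^ 2\<bar> \<le> 3"
proof -
  define M where "M = k ^ 2"
  have M: "0 < M" "real M \<ge> 1" using ij by (auto simp: M_def Suc_le_eq)
  have r: "i * k + j < M" "j * k + i < M"
  proof -
    have "i * k + j < (i + 1) * k" using ij by simp
    also have "\<dots> \<le> k * k" using ij by (intro mult_right_mono) auto
    finally show "i * k + j < M" by (simp add: M_def power2_eq_square)
    have "j * k + i < (j + 1) * k" using ij by simp
    also have "\<dots> \<le> k * k" using ij by (intro mult_right_mono) auto
    finally show "j * k + i < M" by (simp add: M_def power2_eq_square)
  qed
  define X where "X = {t. t < (q + 1) div 2 \<and> t mod M = i * k + j}"
  define Y where "Y = {s. s < q div 2 + 1 \<and> s mod M = j * k + i}"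
  let ?S = "{t \<in> {..<q}. role_of k q t = i \<and> role_of k q ((q - t) mod q) = j}"
  have "?S = X \<union> (\<lambda>s. q - s) ` Y"
  proof (intro set_eqI iffI)
    fix t assume t: "t \<in> ?S"
    show "t \<in> X \<union> (\<lambda>s. q - s) ` Y"
    proof (cases "2 * t < q")
      case True
      then show ?thesis using t role_of_pair_iff[OF q ij, of t] by (auto simp: X_def M_def)
    next
      case False
      have tq: "t < q" and rr: "role_of k q t = i \<and> role_of k q ((q - t) mod q) = j" using t by simp_all
      have "(q - t) mod M = j * k + i"
        using iffD1[OF role_of_pair_iff[OF q ij tq] rr] False by (simp add: M_def)
      moreover have "q - t < q div 2 + 1" using False by linarith
      ultimately have "q - t \<in> Y" by (simp add: Y_def)
      moreover have "t = q - (q - t)" using t by simp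
      ultimately show ?thesis by blast
    qed
  next
    fix t assume "t \<in> X \<union> (\<lambda>s. q - s) ` Y"
    then consider "t \<in> X" | s where "s \<in> Y" "t = q - s" by blast
    then show "t \<in> ?S"
    proof cases
      case 1
      then have "t < (q + 1) div 2" "t mod k ^ 2 = i * k + j" by (simp_all add: X_def M_def)
      moreover have t2: "2 * t < q" using \<open>t < (q + 1) div 2\<close> q by presburger
      moreover have tq: "t < q" using t2 by simp
      ultimately have "if 2 * t < q then t mod k ^ 2 = i * k + j else (q - t) mod k ^ 2 = j * k + i"
        by (simp only: if_True)
      then show ?thesis using tq iffD2[OF role_of_pair_iff[OF q ij tq]] by blast
    next
      case 2
      have s: "s < q div 2 + 1" "s mod k ^ 2 = j * k + i" using 2(1) by (simp_all add: Y_def M_def)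
      have "s \<noteq> 0" using s(2) ij by (intro notI) simp
      moreover have "2 * s \<le> q" using s(1) by linarith
      ultimately have t: "\<not> 2 * t < q" "t < q" "q - t = s" using 2(2) by simp_all
      then have "if 2 * t < q then t mod k ^ 2 = i * k + j else (q - t) mod k ^ 2 = j * k + i"
        using s(2) by (simp only: if_False)
      then show ?thesis using t(2) iffD2[OF role_of_pair_iff[OF q ij t(2)]] by blast
    qed
  qed
  moreover have "X \<inter> (\<lambda>s. q - s) ` Y = {}"
  proof (rule ccontr)
    assume "\<not> ?thesis"
    then obtain s where "s < q div 2 + 1" "q - s < (q + 1) div 2" by (auto simp: X_def Y_def)
    then show False using q by presburger
  qed
  moreover have "finite X" "finite Y" by (simp_all add: X_def Y_def)
  ultimately have "card ?S = card X + card ((\<lambda>s. q - s) ` Y)" by (simp add: card_Un_disjoint)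
  also have "card ((\<lambda>s. q - s) ` Y) = card Y"
    by (rule card_image, rule inj_onI) (auto simp: Y_def)
  finally have c: "real (card ?S) = real (card X) + real (card Y)" by simp
  have "(\<Sum>t<q. of_bool (role_of k q t = i \<and> role_of k q ((q - t) mod q) = j) - 1 / real k ^ 2)
      = real (card ?S) - real q / real M"
    by (simp add: sum_subtractf M_def sum.inter_filter[symmetric] of_bool_def)
  moreover have "\<bar>real (card X) - real ((q + 1) div 2) / real M\<bar> \<le> 1"
    unfolding X_def by (rule card_residue_class_approx[OF r(1)])
  moreover have "\<bar>real (card Y) - real (q div 2 + 1) / real M\<bar> \<le> 1"
    unfolding Y_def by (rule card_residue_class_approx[OF r(2)])
  moreover have "real ((q + 1) div 2) / real M + real (q div 2 + 1) / real M = real q / real M + 1 / real M"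
  proof -
    have "(q + 1) div 2 + (q div 2 + 1) = q + 1" using q by (auto elim!: oddE)
    then show ?thesis by (metis add_divide_distrib of_nat_1 of_nat_add)
  qed
  moreover have "0 \<le> 1 / real M" "1 / real M \<le> 1" using M by auto
  ultimately show ?thesis using c unfolding abs_le_iff by linarith
qed

definition host_role :: "nat \<Rightarrow> nat \<Rightarrow> nat \<Rightarrow> nat \<Rightarrow> nat \<Rightarrow> nat" where
  "host_role k L q u v = (if u < k ^ L \<and> v < k ^ L then planted k L u v else role_of k q (det_mod q u v))"

text \<open>The second moment bound with \<open>C = 3\<close> gives
  \<open>9 q^6 + 2 q^7 <= 11 q^7\<close>. The planted pairs alter at most
  \<open>(k^L)^2 <= q^2\<close> terms, each by at most 1. Both errors are negligible against the
  \<open>q^4\<close> pairs of vertices.\<close>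

lemma host_discrepancy:
  assumes q: "prime q" "odd q" and L: "k ^ L \<le> q" and W: "W \<subseteq> {..<q ^ 2}" and ij: "i < j" "j < k"
    and \<alpha>: "\<And>u. 0 \<le> \<alpha> u \<and> \<alpha> u \<le> 1" and \<beta>: "\<And>v. 0 \<le> \<beta> v \<and> \<beta> v \<le> 1"
  shows "\<bar>\<Sum>u\<in>W. \<Sum>v\<in>W. \<alpha> u * \<beta> v *
      (of_bool (host_role k L q u v = i \<and> host_role k L q v u = j) - 1 / real k ^ 2)\<bar>
    \<le> sqrt (11 * real q ^ 7) + real q ^ 2"
proof -
  have q0: "0 < q" using q prime_gt_0_nat by blast
  define f :: "nat \<Rightarrow> real" where
    "f t = of_bool (role_of k q t = i \<and> role_of k q ((q - t) mod q) = j) - 1 / real k ^ 2" for t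
  define h :: "nat \<Rightarrow> nat \<Rightarrow> real" where
    "h u v = of_bool (host_role k L q u v = i \<and> host_role k L q v u = j) - 1 / real k ^ 2" for u v
  have k1: "0 \<le> 1 / real k ^ 2" "1 / real k ^ 2 \<le> 1" using ij by (auto simp: divide_simps)
  have "\<bar>of_bool P - x\<bar> \<le> 1" if "0 \<le> x" "x \<le> 1" for P and x :: real using that by (cases P) auto
  then have f1: "\<bar>f t\<bar> \<le> 1" for t unfolding f_def using k1 by blast
  have hf: "\<bar>h u v - f (det_mod q u v)\<bar> \<le> of_bool (u < k ^ L \<and> v < k ^ L)" for u v
    unfolding h_def f_def using det_mod_swap[OF q0, of v u]
    by (auto simp: host_role_def of_bool_def)
  have finW: "finite W" using W finite_subset by blast
  define a b where "a u = (if u \<in> W then \<alpha> u else 0)" and "b u = (if u \<in> W then \<beta> u else 0)" for u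
  have ext: "(\<Sum>u\<in>W. \<Sum>v\<in>W. \<alpha> u * \<beta> v * g u v) = (\<Sum>u<q ^ 2. \<Sum>v<q ^ 2. a u * b v * g u v)" for g :: "nat \<Rightarrow> nat \<Rightarrow> real"
  proof -
    have "(\<Sum>u<q ^ 2. \<Sum>v<q ^ 2. a u * b v * g u v) = (\<Sum>u\<in>W. \<Sum>v<q ^ 2. a u * b v * g u v)"
      by (rule sum.mono_neutral_right) (use W in \<open>auto simp: a_def\<close>)
    also have "\<dots> = (\<Sum>u\<in>W. \<Sum>v\<in>W. a u * b v * g u v)"
      by (rule sum.cong[OF refl], rule sum.mono_neutral_right) (use W in \<open>auto simp: b_def\<close>)
    also have "\<dots> = (\<Sum>u\<in>W. \<Sum>v\<in>W. \<alpha> u * \<beta> v * g u v)" by (simp add: a_def b_def)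
    finally show ?thesis by simp
  qed
  have "(\<Sum>u\<in>W. \<Sum>v\<in>W. \<alpha> u * \<beta> v * f (det_mod q u v)) ^ 2 \<le> 3 ^ 2 * real q ^ 6 + 2 * real q ^ 7"
    unfolding ext
  proof (rule det_mod_discrepancy[OF q(1) f1])
    show "\<bar>\<Sum>t<q. f t\<bar> \<le> 3" unfolding f_def by (rule sum_role_pair_le[OF q(2) ij])
    show "\<bar>a u\<bar> \<le> 1" "\<bar>b u\<bar> \<le> 1" for u using \<alpha>[of u] \<beta>[of u] by (auto simp: a_def b_def)
  qed
  also have "\<dots> \<le> 11 * real q ^ 7"
  proof -
    have "real q ^ 6 \<le> real q ^ 7" using q0 by (intro power_increasing) auto
    then show ?thesis by simp
  qed
  finally have "sqrt ((\<Sum>u\<in>W. \<Sum>v\<in>W. \<alpha> u * \<beta> v * f (det_mod q u v)) ^ 2) \<le> sqrt (11 * real q ^ 7)"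
    by (rule real_sqrt_le_mono)
  then have main: "\<bar>\<Sum>u\<in>W. \<Sum>v\<in>W. \<alpha> u * \<beta> v * f (det_mod q u v)\<bar> \<le> sqrt (11 * real q ^ 7)"
    by (simp only: real_sqrt_abs)
  have "\<bar>\<Sum>u\<in>W. \<Sum>v\<in>W. \<alpha> u * \<beta> v * (h u v - f (det_mod q u v))\<bar>
      \<le> (\<Sum>u\<in>W. \<Sum>v\<in>W. \<bar>\<alpha> u * \<beta> v * (h u v - f (det_mod q u v))\<bar>)"
    by (intro order_trans[OF sum_abs] sum_mono sum_abs)
  also have "\<dots> \<le> (\<Sum>u\<in>W. \<Sum>v\<in>W. of_bool (u < k ^ L) * of_bool (v < k ^ L))"
  proof (intro sum_mono)
    fix u v
    have "0 \<le> \<alpha> u * \<beta> v" "\<alpha> u * \<beta> v \<le> 1" using \<alpha>[of u] \<beta>[of v] by (auto intro: mult_le_one)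
    then have "\<bar>\<alpha> u * \<beta> v\<bar> * \<bar>h u v - f (det_mod q u v)\<bar> \<le> 1 * of_bool (u < k ^ L \<and> v < k ^ L)"
      using hf by (intro mult_mono) auto
    then show "\<bar>\<alpha> u * \<beta> v * (h u v - f (det_mod q u v))\<bar> \<le> of_bool (u < k ^ L) * of_bool (v < k ^ L)"
      by (simp add: abs_mult of_bool_conj)
  qed
  also have "\<dots> = (\<Sum>u\<in>W. of_bool (u < k ^ L)) ^ 2" by (simp add: power2_eq_square sum_product)
  also have "(\<Sum>u\<in>W. of_bool (u < k ^ L)) = real (card {u \<in> W. u < k ^ L})"
    using finW by (simp add: of_bool_def sum.inter_filter[symmetric])
  also have "real (card {u \<in> W. u < k ^ L}) ^ 2 \<le> real q ^ 2"
  proof (intro power_mono of_nat_mono)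
    have "card {u \<in> W. u < k ^ L} \<le> card {..<k ^ L}" by (rule card_mono) auto
    then show "card {u \<in> W. u < k ^ L} \<le> q" using L by simp
  qed simp
  finally have "\<bar>\<Sum>u\<in>W. \<Sum>v\<in>W. \<alpha> u * \<beta> v * (h u v - f (det_mod q u v))\<bar> \<le> real q ^ 2" .
  moreover have "(\<Sum>u\<in>W. \<Sum>v\<in>W. \<alpha> u * \<beta> v * h u v) = (\<Sum>u\<in>W. \<Sum>v\<in>W. \<alpha> u * \<beta> v * f (det_mod q u v))
      + (\<Sum>u\<in>W. \<Sum>v\<in>W. \<alpha> u * \<beta> v * (h u v - f (det_mod q u v)))"
    by (simp add: algebra_simps flip: sum.distrib)
  ultimately show ?thesis using main unfolding h_def[symmetric] by linarith
qed

lemma card_copies_eq_sum: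
  assumes "finite W"
  shows "real (card (copies k R W)) = (\<Sum>x\<in>{..<k} \<rightarrow>\<^sub>E W. \<Prod>p\<in>{(i, j). i < j \<and> j < k}.
      of_bool (R (x (fst p)) (x (snd p)) = fst p \<and> R (x (snd p)) (x (fst p)) = snd p))"
proof -
  let ?P = "{(i, j). i < j \<and> j < k}"
  have finP: "finite ?P" by (rule finite_subset[of _ "{..<k} \<times> {..<k}"]) auto
  have "(\<Prod>p\<in>?P. of_bool (R (x (fst p)) (x (snd p)) = fst p \<and> R (x (snd p)) (x (fst p)) = snd p))
      = (if x \<in> copies k R W then 1 else 0 :: real)" if x: "x \<in> {..<k} \<rightarrow>\<^sub>E W" for x
  proof (cases "x \<in> copies k R W")
    case True
    then show ?thesis by (auto intro!: prod.neutral simp: copies_def)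
  next
    case False
    then obtain i j where ij: "i < k" "j < k" "i \<noteq> j" "R (x i) (x j) \<noteq> i"
      using x by (auto simp: copies_def)
    define p where "p = (if i < j then (i, j) else (j, i))"
    have "p \<in> ?P" "\<not> (R (x (fst p)) (x (snd p)) = fst p \<and> R (x (snd p)) (x (fst p)) = snd p)"
      using ij by (auto simp: p_def)
    then have "\<exists>p\<in>?P. of_bool (R (x (fst p)) (x (snd p)) = fst p \<and> R (x (snd p)) (x (fst p)) = snd p) = (0 :: real)"
      by (intro bexI[of _ p]) simp_all
    then have "(\<Prod>p\<in>?P. of_bool (R (x (fst p)) (x (snd p)) = fst p \<and> R (x (snd p)) (x (fst p)) = snd p)) = (0 :: real)"
      by (rule prod_zero[OF finP])
    then show ?thesis using False by (simp only: if_False)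
  qed
  then have "(\<Sum>x\<in>{..<k} \<rightarrow>\<^sub>E W. \<Prod>p\<in>?P. of_bool (R (x (fst p)) (x (snd p)) = fst p \<and> R (x (snd p)) (x (fst p)) = snd p))
      = (\<Sum>x\<in>{..<k} \<rightarrow>\<^sub>E W. if x \<in> copies k R W then 1 else 0 :: real)" by (rule sum.cong[OF refl])
  also have "\<dots> = real (card (({..<k} \<rightarrow>\<^sub>E W) \<inter> copies k R W))"
    using assms by (simp add: finite_PiE sum.If_cases)
  also have "({..<k} \<rightarrow>\<^sub>E W) \<inter> copies k R W = copies k R W" by (auto simp: copies_def)
  finally show ?thesis by simp
qed

lemma host_count:
  assumes q: "prime q" "odd q" and L: "k ^ L \<le> q" and W: "W \<subseteq> {..<q ^ 2}" and k: "2 \<le> k"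
  defines "P \<equiv> {(i, j). i < j \<and> j < k}"
  shows "\<bar>real (card (copies k (host_role k L q) W)) - (1 / real k ^ 2) ^ card P * real (card W) ^ k\<bar>
    \<le> real (card P) * (sqrt (11 * real q ^ 7) + real q ^ 2) * real (card W) ^ (k - 2)"
proof -
  define F :: "nat \<times> nat \<Rightarrow> nat \<Rightarrow> nat \<Rightarrow> real" where
    "F p u v = of_bool (host_role k L q u v = fst p \<and> host_role k L q v u = snd p)" for p u v
  have finW: "finite W" using W finite_subset by blast
  have "\<bar>(\<Sum>x\<in>{..<k} \<rightarrow>\<^sub>E W. \<Prod>p\<in>P. F p (x (fst p)) (x (snd p))) - (1 / real k ^ 2) ^ card P * real (card W) ^ k\<bar>
    \<le> real (card P) * (sqrt (11 * real q ^ 7) + real q ^ 2) * real (card W) ^ (k - 2)"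
  proof (rule counting_lemma[OF finW])
    show "0 \<le> 1 / real k ^ 2" "1 / real k ^ 2 \<le> 1" using k by (auto simp: divide_simps)
    show "0 \<le> F p u v \<and> F p u v \<le> 1" for p u v by (auto simp: F_def)
    show "finite P" unfolding P_def by (rule finite_subset[of _ "{..<k} \<times> {..<k}"]) auto
    show "P \<subseteq> {(i, j). i < j \<and> j < k}" by (simp add: P_def)
    fix i j :: nat and \<alpha> \<beta> :: "nat \<Rightarrow> real"
    assume "i < j" "j < k" "\<And>u. 0 \<le> \<alpha> u \<and> \<alpha> u \<le> 1" "\<And>u. 0 \<le> \<beta> u \<and> \<beta> u \<le> 1"
    then show "\<bar>\<Sum>u\<in>W. \<Sum>v\<in>W. \<alpha> u * \<beta> v * (F (i, j) u v - 1 / real k ^ 2)\<bar>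
        \<le> sqrt (11 * real q ^ 7) + real q ^ 2"
      unfolding F_def fst_conv snd_conv by (intro host_discrepancy[OF q L W])
  qed
  then show ?thesis unfolding card_copies_eq_sum[OF finW] F_def P_def .
qed

section \<open>The quasirandom sequence\<close>

text \<open>Above 2 for oddness, above \<open>k^n\<close> so that the planted set takes up less than
  the square root of the number of vertices, and above \<open>n\<close> so that the hosts grow
  whatever \<open>k\<close> is.\<close>

definition host_prime :: "nat \<Rightarrow> nat \<Rightarrow> nat" where
  "host_prime k n = (SOME q. prime q \<and> max 2 (max n (k ^ n)) < q)"

lemma host_prime: "prime (host_prime k n)" "n < host_prime k n" "k ^ n \<le> host_prime k n" "odd (host_prime k n)"
proof -
  have "prime (host_prime k n) \<and> max 2 (max n (k ^ n)) < host_prime k n"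
    unfolding host_prime_def by (rule someI_ex) (rule bigger_prime)
  then show "prime (host_prime k n)" "n < host_prime k n" "k ^ n \<le> host_prime k n" "odd (host_prime k n)"
    by (auto simp: prime_odd_nat)
qed

definition host_V :: "nat \<Rightarrow> nat \<Rightarrow> nat set" where
  "host_V k n = {..<host_prime k n ^ 2}"

definition host_R :: "nat \<Rightarrow> nat \<Rightarrow> nat \<Rightarrow> nat \<Rightarrow> nat" where
  "host_R k n = host_role k n (host_prime k n)"

definition host_E :: "nat \<Rightarrow> nat \<Rightarrow> nat set set" where
  "host_E k n = edges k (host_R k n) (host_V k n)"

section \<open>Limits along the sequence of hosts\<close>

lemma filterlim_host_prime: "filterlim (host_prime k) at_top sequentially"
  by (rule filterlim_at_top_mono[OF filterlim_ident]) (simp add: host_prime(2) less_imp_le)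

lemma card_host_V: "card (host_V k n) = host_prime k n ^ 2"
  by (simp add: host_V_def)

lemma filterlim_card_host_V: "filterlim (\<lambda>n. card (host_V k n)) at_top sequentially"
proof (rule filterlim_at_top_mono[OF filterlim_host_prime])
  show "\<forall>\<^sub>F n in sequentially. host_prime k n \<le> card (host_V k n)"
    by (intro always_eventually allI) (simp add: card_host_V power2_eq_square)
qed

lemma error_tendsto:
  "(\<lambda>n. (sqrt (11 * real (host_prime k n) ^ 7) + real (host_prime k n) ^ 2) / real (host_prime k n) ^ 4) \<longlonglongrightarrow> 0"
proof -
  have "((\<lambda>x. (sqrt (11 * x ^ 7) + x ^ 2) / x ^ 4) \<longlongrightarrow> 0) at_top" for x :: real by real_asymp
  moreover have "filterlim (\<lambda>n. real (host_prime k n)) at_top sequentially"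
    using filterlim_real_sequentially filterlim_host_prime by (rule filterlim_compose)
  ultimately show ?thesis by (rule filterlim_compose)
qed

lemma quasirandom_host:
  assumes k: "2 \<le> k"
  defines "a \<equiv> (1 / real k ^ 2) ^ card {(i, j). i < j \<and> j < k}"
  shows "quasirandom k (a * fact k) (host_V k) (host_E k)"
  unfolding quasirandom_def
proof (intro allI impI)
  fix \<epsilon> :: real assume \<epsilon>: "0 < \<epsilon>"
  define P where "P = card {(i, j). i < j \<and> j < k}"
  define \<rho> where "\<rho> = a * fact k"
  have a: "0 < a" using k by (simp add: a_def)
  then have \<rho>: "0 < \<rho>" by (simp add: \<rho>_def)
  \<comment> \<open>The induced density is a product \<open>x * A\<close> with \<open>x\<close>
    within \<open>\<theta>\<close> of \<open>a\<close> and \<open>A\<close> within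
    \<open>\<theta>\<close> of \<open>k!\<close>; its error is at most
    \<open>\<theta> * (k! + 1) + a * \<theta>\<close>, and this fixes the denominator.\<close>
  define \<theta> where "\<theta> = min 1 (\<rho> * \<epsilon> / (a + fact k + 1))"
  have den: "0 < a + fact k + 1" using a by (intro add_pos_pos) auto
  have \<theta>: "0 < \<theta>" "\<theta> \<le> 1" "\<theta> * (a + fact k + 1) \<le> \<rho> * \<epsilon>"
  proof -
    show "0 < \<theta>" using \<rho> \<epsilon> den by (simp add: \<theta>_def)
    show "\<theta> \<le> 1" by (simp add: \<theta>_def)
    have "\<theta> \<le> \<rho> * \<epsilon> / (a + fact k + 1)" by (simp add: \<theta>_def)
    then show "\<theta> * (a + fact k + 1) \<le> \<rho> * \<epsilon>" using den by (simp add: pos_le_divide_eq)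
  qed
  define err where "err n = (sqrt (11 * real (host_prime k n) ^ 7) + real (host_prime k n) ^ 2)" for n
  have "(\<lambda>n. real P / \<epsilon> ^ 2 * (err n / real (host_prime k n) ^ 4)) \<longlonglongrightarrow> real P / \<epsilon> ^ 2 * 0"
    unfolding err_def by (intro tendsto_intros error_tendsto)
  then have "\<forall>\<^sub>F n in sequentially. real P / \<epsilon> ^ 2 * (err n / real (host_prime k n) ^ 4) < \<theta>"
    using \<theta>(1) by (intro order_tendstoD(2)) auto
  then obtain n1 where n1: "\<And>n. n1 \<le> n \<Longrightarrow> real P / \<epsilon> ^ 2 * (err n / real (host_prime k n) ^ 4) < \<theta>"
    unfolding eventually_sequentially by blast
  have "\<forall>\<^sub>F s in sequentially. dist (real s ^ k / real (s choose k)) (fact k) < \<theta>"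
    using power_over_choose_tendsto \<theta>(1) by (rule tendstoD)
  then obtain s1 where s1: "\<And>s. s1 \<le> s \<Longrightarrow> \<bar>real s ^ k / real (s choose k) - fact k\<bar> < \<theta>"
    unfolding eventually_sequentially dist_real_def by blast
  \<comment> \<open>Beyond this index every admissible \<open>W\<close> has at least
    \<open>s1\<close> vertices, because \<open>n\<close> is at most \<open>q^2\<close>.\<close>
  define n2 where "n2 = nat \<lceil>(real s1 + 1) / \<epsilon>\<rceil>"
  show "\<exists>n0. \<forall>n>n0. \<forall>W. W \<subseteq> host_V k n \<and> \<epsilon> * real (card (host_V k n)) \<le> real (card W) \<longrightarrow>
      induced_density k (host_E k n) W \<in> {a * fact k * (1 - \<epsilon>)..a * fact k * (1 + \<epsilon>)}"
  proof (intro exI[of _ "max n1 n2"] allI impI, elim conjE)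
    fix n W assume n: "max n1 n2 < n" and W: "W \<subseteq> host_V k n"
      and big: "\<epsilon> * real (card (host_V k n)) \<le> real (card W)"
    define q where "q = host_prime k n"
    define w where "w = card W"
    have q: "prime q" "odd q" "k ^ n \<le> q" "n < q" using host_prime[where k = k and n = n] by (simp_all add: q_def)
    have Wq: "W \<subseteq> {..<q ^ 2}" using W by (simp add: host_V_def q_def)
    have wq: "\<epsilon> * real q ^ 2 \<le> real w" using big by (simp add: card_host_V q_def w_def)
    have q0: "0 < real q" using q(4) by simp
    have w0: "0 < real w" using wq \<epsilon> q0 by (meson less_le_trans mult_pos_pos zero_less_power)
    have "s1 \<le> w"
    proof -
      have "(real s1 + 1) / \<epsilon> \<le> real n" using n unfolding n2_def by linarith
      then have "real s1 + 1 \<le> \<epsilon> * real n" using \<epsilon> by (simp add: field_simps)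
      also have "\<dots> \<le> \<epsilon> * real q ^ 2"
      proof (rule mult_left_mono)
        have "n \<le> q * q" using q(4) by (metis le_square less_imp_le order_trans)
        then show "real n \<le> real q ^ 2" unfolding power2_eq_square by (simp only: of_nat_le_iff flip: of_nat_mult)
      qed (use \<epsilon> in simp)
      finally show ?thesis using wq by linarith
    qed
    define x where "x = real (card (copies k (host_R k n) W)) / real w ^ k"
    define A where "A = real w ^ k / real (w choose k)"
    have dens: "induced_density k (host_E k n) W = x * A"
      unfolding host_E_def induced_density_edges[OF k W] x_def A_def w_def[symmetric] using w0 by simp
    have A: "\<bar>A - fact k\<bar> \<le> \<theta>" using s1[OF \<open>s1 \<le> w\<close>] by (simp add: A_def)
    have x: "\<bar>x - a\<bar> \<le> \<theta>"
    proof -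
      have "\<bar>real (card (copies k (host_R k n) W)) - a * real w ^ k\<bar> \<le> real P * err n * real w ^ (k - 2)"
        using host_count[OF q(1,2,3) Wq k] by (simp only: host_R_def q_def a_def w_def P_def err_def)
      moreover have "x - a = (real (card (copies k (host_R k n) W)) - a * real w ^ k) / real w ^ k"
        using w0 by (simp add: x_def diff_divide_distrib)
      ultimately have "\<bar>x - a\<bar> \<le> real P * err n * real w ^ (k - 2) / real w ^ k"
        using w0 by (simp add: abs_divide divide_right_mono)
      also have "\<dots> = real P * err n / real w ^ 2"
      proof -
        have "real w ^ k = real w ^ (k - 2) * real w ^ 2" by (metis k le_add_diff_inverse2 power_add)
        then show ?thesis using w0 by simp
      qed
      also have "\<dots> \<le> real P * err n / (\<epsilon> * real q ^ 2) ^ 2"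
      proof (rule divide_left_mono)
        show "(\<epsilon> * real q ^ 2) ^ 2 \<le> real w ^ 2" using wq \<epsilon> by (intro power_mono) auto
        show "0 \<le> real P * err n" by (simp add: err_def)
        show "0 < real w ^ 2 * (\<epsilon> * real q ^ 2) ^ 2" using w0 \<epsilon> q0 by simp
      qed
      also have "\<dots> = real P / \<epsilon> ^ 2 * (err n / real q ^ 4)" by (simp add: power_mult_distrib flip: power_mult)
      also have "\<dots> \<le> \<theta>" using n1[of n] n unfolding q_def by simp
      finally show ?thesis .
    qed
    have "\<bar>x * A - \<rho>\<bar> \<le> \<rho> * \<epsilon>"
    proof -
      have "0 \<le> (fact k :: real)" by simp
      then have Ab: "\<bar>A\<bar> \<le> fact k + 1" using A \<theta>(2) by linarith
      have "x * A - \<rho> = (x - a) * A + a * (A - fact k)" by (simp add: \<rho>_def algebra_simps)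
      also have "\<bar>\<dots>\<bar> \<le> \<bar>x - a\<bar> * \<bar>A\<bar> + a * \<bar>A - fact k\<bar>"
        using abs_triangle_ineq[of "(x - a) * A" "a * (A - fact k)"] a by (simp add: abs_mult)
      also have "\<dots> \<le> \<theta> * (fact k + 1) + a * \<theta>"
        using x A Ab \<theta> a by (intro add_mono mult_mono) auto
      also have "\<dots> = \<theta> * (a + fact k + 1)" by (simp add: algebra_simps)
      also have "\<dots> \<le> \<rho> * \<epsilon>" by (rule \<theta>(3))
      finally show ?thesis .
    qed
    then show "induced_density k (host_E k n) W \<in> {a * fact k * (1 - \<epsilon>)..a * fact k * (1 + \<epsilon>)}"
      unfolding dens by (simp add: \<rho>_def[symmetric] abs_le_iff algebra_simps)
  qed
qed

text \<open>Testing quasirandomness with the full vertex set yields the convergence of densities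
  that \<open>kgraph_seq\<close> requires.\<close>

lemma quasirandom_density_tendsto:
  assumes "quasirandom k \<rho> V E" "0 < \<rho>" and E: "\<And>n e. e \<in> E n \<Longrightarrow> e \<subseteq> V n"
  shows "(\<lambda>n. Defs.density k (V n) (E n)) \<longlonglongrightarrow> \<rho>"
proof (rule LIMSEQ_I)
  fix r :: real assume r: "0 < r"
  define \<epsilon> where "\<epsilon> = min 1 (r / (2 * \<rho>))"
  have \<epsilon>: "0 < \<epsilon>" "\<epsilon> \<le> 1" "\<rho> * \<epsilon> < r"
  proof -
    show "0 < \<epsilon>" "\<epsilon> \<le> 1" using r assms(2) by (simp_all add: \<epsilon>_def)
    have "\<epsilon> \<le> r / (2 * \<rho>)" by (simp add: \<epsilon>_def)
    then have "\<rho> * \<epsilon> \<le> r / 2" using assms(2) by (simp add: field_simps)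
    then show "\<rho> * \<epsilon> < r" using r by simp
  qed
  obtain n0 where n0: "\<And>n W. n0 < n \<Longrightarrow> W \<subseteq> V n \<Longrightarrow> \<epsilon> * real (card (V n)) \<le> real (card W) \<Longrightarrow>
      induced_density k (E n) W \<in> {\<rho> * (1 - \<epsilon>)..\<rho> * (1 + \<epsilon>)}"
    using assms(1)[unfolded quasirandom_def, rule_format, OF \<epsilon>(1)] by (metis (no_types, lifting))
  have "norm (Defs.density k (V n) (E n) - \<rho>) < r" if "Suc n0 \<le> n" for n
  proof -
    have "\<epsilon> * real (card (V n)) \<le> real (card (V n))" using \<epsilon> by (simp add: mult_left_le_one_le)
    then have "induced_density k (E n) (V n) \<in> {\<rho> * (1 - \<epsilon>)..\<rho> * (1 + \<epsilon>)}" using n0[of n "V n"] that by simp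
    moreover have "{e \<in> E n. e \<subseteq> V n} = E n" using E by blast
    ultimately show ?thesis using \<epsilon>(3) by (simp add: induced_density_def abs_less_iff algebra_simps)
  qed
  then show "\<exists>no. \<forall>n\<ge>no. norm (Defs.density k (V n) (E n) - \<rho>) < r" by blast
qed

lemma induced_density_edges_le:
  assumes k: "4 \<le> k" and S: "finite S" "S \<subseteq> V"
  shows "induced_density k (edges k R V) S
    \<le> 1 / (real k ^ k - real k) * (real (card S) ^ k / real (card S choose k))"
proof -
  have "induced_density k (edges k R V) S = real (card (copies k R S)) / real (card S choose k)"
    using k S by (intro induced_density_edges) auto
  also have "\<dots> \<le> (real (card S) ^ k / (real k ^ k - real k)) / real (card S choose k)"
    using card_copies_le[OF k S(1)] by (intro divide_right_mono) auto
  finally show ?thesis by simp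
qed

lemma copies_cong:
  assumes "\<And>u v. u \<in> S \<Longrightarrow> v \<in> S \<Longrightarrow> R u v = R' u v"
  shows "copies k R S = copies k R' S"
proof -
  have "R (x i) (x j) = R' (x i) (x j)" if "x \<in> {..<k} \<rightarrow>\<^sub>E S" "i < k" "j < k" for x i j
    using that by (intro assms) (auto simp: PiE_iff)
  then show ?thesis unfolding copies_def by (intro Collect_cong conj_cong refl) simp
qed

text \<open>The host with index \<open>s\<close> serves size \<open>s\<close>: its planted set has
  \<open>k^s >= s\<close> vertices, and averaging finds a subset of the exact size.\<close>

lemma exists_dense_host_subset:
  assumes k: "2 \<le> k" and s: "k \<le> s"
  shows "\<exists>S\<subseteq>host_V k s. card S = s \<and> fact k / (real k ^ k - real k) \<le> induced_density k (host_E k s) S"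
proof -
  define T where "T = {..<k ^ s}"
  have TV: "T \<subseteq> host_V k s"
  proof -
    have "k ^ s \<le> host_prime k s * host_prime k s"
      using host_prime(3)[of k s] by (metis le_square order_trans)
    then show ?thesis by (auto simp: T_def host_V_def power2_eq_square)
  qed
  have "copies k (host_R k s) T = copies k (planted k s) T"
  proof -
    have "host_R k s u v = planted k s u v" if "u \<in> T" "v \<in> T" for u v
      using that by (simp add: host_R_def host_role_def T_def)
    then show ?thesis by (rule copies_cong)
  qed
  then have dT: "fact k / (real k ^ k - real k) \<le> induced_density k (host_E k s) T"
    unfolding host_E_def induced_density_edges[OF k TV] using planted_density_ge[OF k, of s] k s by (simp add: T_def)
  have "s \<le> card T" using less_exp[of s] power_mono[of 2 k s] k by (simp add: T_def)
  moreover have "card e = k" if "e \<in> host_E k s" for e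
    using that kgraph_edges[of "host_V k s" k "host_R k s"] by (simp add: host_E_def kgraph_def host_V_def)
  ultimately obtain S where "S \<subseteq> T" "card S = s" "induced_density k (host_E k s) T \<le> induced_density k (host_E k s) S"
    using exists_denser_subset[of T k s "host_E k s"] s by (auto simp: T_def)
  then show ?thesis using dT TV by (intro exI[of _ S]) auto
qed

text \<open>From size \<open>k\<close> on, the maximum lies between the limit \<open>d\<close>
  itself and the bound \<open>b s\<close> of \<open>card_copies_le\<close>, which tends to
  \<open>d\<close> as \<open>s^k / (s choose k)\<close> tends to \<open>k!\<close>.\<close>

lemma has_upper_density_host:
  assumes k: "4 \<le> k"
  shows "has_upper_density k (host_V k) (host_E k) (fact k / (real k ^ k - real k))"
proof -
  define d where "d = fact k / (real k ^ k - real k)"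
  define b where "b s = 1 / (real k ^ k - real k) * (real s ^ k / real (s choose k))" for s
  have bound: "d \<le> max_sub_density k (host_V k) (host_E k) s \<and> max_sub_density k (host_V k) (host_E k) s \<le> b s"
    if s: "k \<le> s" for s
  proof -
    let ?D = "{induced_density k (host_E k n) S | n S. S \<subseteq> host_V k n \<and> card S = s}"
    have le: "x \<le> b s" if xD: "x \<in> ?D" for x
    proof -
      obtain n S where x: "x = induced_density k (host_E k n) S" "S \<subseteq> host_V k n" "card S = s" using xD by blast
      have "finite S" using x(2) by (rule finite_subset) (simp add: host_V_def)
      then show ?thesis using induced_density_edges_le[OF k _ x(2)] x by (simp add: host_E_def b_def)
    qed
    obtain S where S: "S \<subseteq> host_V k s" "card S = s" "d \<le> induced_density k (host_E k s) S"
      using exists_dense_host_subset[of k s] k s by (auto simp: d_def)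
    then have mem: "induced_density k (host_E k s) S \<in> ?D" by blast
    have "d \<le> Sup ?D" using S(3) cSup_upper[OF mem] le by (meson bdd_aboveI order_trans)
    moreover have "Sup ?D \<le> b s" using mem le by (intro cSup_least) auto
    ultimately show ?thesis by (simp add: max_sub_density_def)
  qed
  have "b \<longlonglongrightarrow> 1 / (real k ^ k - real k) * fact k"
    unfolding b_def by (intro tendsto_intros power_over_choose_tendsto)
  then have lim: "b \<longlonglongrightarrow> d" by (simp add: d_def)
  have "\<forall>\<^sub>F s in sequentially. d \<le> max_sub_density k (host_V k) (host_E k) s"
    "\<forall>\<^sub>F s in sequentially. max_sub_density k (host_V k) (host_E k) s \<le> b s"
    using bound unfolding eventually_sequentially by blast+
  then have "max_sub_density k (host_V k) (host_E k) \<longlonglongrightarrow> d"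
    using tendsto_const lim by (rule tendsto_sandwich)
  then show ?thesis by (simp add: has_upper_density_def d_def)
qed

theorem theorem1p7:
  fixes k :: nat
  assumes "k \<ge> 4"
  shows "\<exists>(\<rho>::real) V E. \<rho> > 0 \<and> kgraph_seq k V E \<and> quasirandom k \<rho> V E
           \<and> has_upper_density k V E (fact k / (real k ^ k - real k))"
proof -
  \<comment> \<open>A tuple is a copy when all \<open>k (k - 1) / 2\<close> pairs of its vertices
    have the right roles, each with frequency about \<open>1 / k^2\<close>; the factor
    \<open>k!\<close> counts the orderings of a vertex set.\<close>
  define \<rho> :: real where "\<rho> = (1 / real k ^ 2) ^ card {(i, j). i < j \<and> j < k} * fact k"
  have \<rho>: "0 < \<rho>" using assms by (simp add: \<rho>_def)
  have qr: "quasirandom k \<rho> (host_V k) (host_E k)"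
    unfolding \<rho>_def using assms by (intro quasirandom_host) simp
  have kg: "kgraph k (host_V k n) (host_E k n)" for n
    unfolding host_E_def by (rule kgraph_edges) (simp add: host_V_def)
  then have "convergent (\<lambda>n. Defs.density k (host_V k n) (host_E k n))"
    using quasirandom_density_tendsto[OF qr \<rho>] unfolding convergent_def kgraph_def by blast
  then have "kgraph_seq k (host_V k) (host_E k)"
    unfolding kgraph_seq_def using kg filterlim_card_host_V by blast
  then show ?thesis using \<rho> qr has_upper_density_host[OF assms] by blast
qed

end
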